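(* For $T>0$ let $Y_T=\sum_{p\le T}\left(\frac{\sin(TU\log p)}{\sqrt p}-\frac{\mathbf{E}\sin(TU\log p)}{\sqrt p}\right)$, the sum being over primes $p$. Then $$\langle DY_T,D(-L)^{-1}Y_T\rangle=\sum_{p_1,p_2\le T}\frac{\log p_2}{\log p_1}\frac{1}{\sqrt{p_1p_2}}\Big[(U-1)\cos(TU\log p_2)-U\cos(TU\log p_2)\cos(T\log p_1)+\cos(TU\log p_1)\cos(TU\log p_2)\Big],$$ where $p_1,p_2$ range over primes.
   Context: $H$ is a real separable Hilbert space with scalar product $\langle\cdot,\cdot\rangle$ and $(W(h),h\in H)$ is an isonormal Gaussian process (centered Gaussian family with $\mathbf{E}[W(h)W(h')]=\langle h,h'\rangle$). $U=\exp\left(-\frac12(W(f)^2+W(g)^2)\right)$ with $f,g\in H$, $\|f\|=\|g\|=1$, $\langle f,g\rangle=0$; $U$ is uniform on $[0,1]$. $D$ is the Malliavin derivative with respect to $W$ (closure of $DF=\sum_i\partial_i\varphi(W(h_1),\ldots,W(h_n))h_i$ for $F=\varphi(W(h_1),\ldots,W(h_n))$), $L$ is the infinitesimal generator of the Ornstein–Uhlenbeck semigroup, and $(-L)^{-1}$ is the (pseudo-)inverse of $-L$ on centered square integrable functionals of $W$. *)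

theory Defs
  imports "HOL-Probability.Probability" "HOL-Computational_Algebra.Primes"
begin

text \<open>
  Degenerate (almost surely constant) variables count as Gaussian; this is needed because linear
  relations between the \<open>h\<close>'s make some linear combinations of the \<open>W h\<close> vanish.
\<close>

definition gaussian_rv :: "'w measure \<Rightarrow> ('w \<Rightarrow> real) \<Rightarrow> bool" where
  "gaussian_rv M X \<longleftrightarrow> X \<in> borel_measurable M \<and>
     ((\<exists>\<mu> \<sigma>. 0 < \<sigma> \<and> distributed M lborel X (\<lambda>x. ennreal (normal_density \<mu> \<sigma> x))) \<or>
      (\<exists>c. AE w in M. X w = c))"

locale isonormal_gaussian_process = prob_space M
  for M :: "'w measure"
  and W :: "'h::{real_inner, banach, second_countable_topology} \<Rightarrow> 'w \<Rightarrow> real" +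
  assumes jointly_gaussian:
      "finite A \<Longrightarrow> gaussian_rv M (\<lambda>w. \<Sum>h\<in>A. c h * W h w)"
    and centered: "expectation (W h) = 0"
    and covariance: "expectation (\<lambda>w. W h w * W h' w) = inner h h'"

definition square_integrable ::
    "'w measure \<Rightarrow> ('w \<Rightarrow> 'b::{banach, second_countable_topology}) \<Rightarrow> bool" where
  "square_integrable M X \<longleftrightarrow>
     X \<in> borel_measurable M \<and> integrable M (\<lambda>w. (norm (X w))\<^sup>2)"

definition tendsto_L2 ::
    "'w measure \<Rightarrow> ('i \<Rightarrow> 'w \<Rightarrow> 'b::{banach, second_countable_topology}) \<Rightarrow> ('w \<Rightarrow> 'b)
      \<Rightarrow> 'i filter \<Rightarrow> bool" where
  "tendsto_L2 M X Z Fl \<longleftrightarrow>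
     ((\<lambda>i. \<integral>\<^sup>+ w. ennreal ((norm (X i w - Z w))\<^sup>2) \<partial>M) \<longlongrightarrow> 0) Fl"

text \<open>
  Functions on \<open>n\<close>-dimensional Euclidean space are functions on the carrier of
  \<^const>\<open>Euclidean_space\<close>, that is, on the sequences vanishing from index \<open>n\<close> on.
\<close>

definition partial_deriv :: "nat \<Rightarrow> ((nat \<Rightarrow> real) \<Rightarrow> real) \<Rightarrow> (nat \<Rightarrow> real) \<Rightarrow> real" where
  "partial_deriv i \<phi> x = deriv (\<lambda>s. \<phi> (x(i := s))) (x i)"

text \<open>Smooth functions all of whose partial derivatives have at most polynomial growth.\<close>

definition smooth_poly_growth :: "nat \<Rightarrow> ((nat \<Rightarrow> real) \<Rightarrow> real) \<Rightarrow> bool" where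
  "smooth_poly_growth n \<phi> \<longleftrightarrow>
     (\<forall>\<alpha>. set \<alpha> \<subseteq> {..<n} \<longrightarrow>
        (let \<psi> = foldr partial_deriv \<alpha> \<phi> in
           continuous_map (Euclidean_space n) euclideanreal \<psi> \<and>
           (\<forall>x \<in> topspace (Euclidean_space n). \<forall>i<n.
              (\<lambda>s. \<psi> (x(i := s))) differentiable (at (x i))) \<and>
           (\<exists>C (k::nat). \<forall>x \<in> topspace (Euclidean_space n).
              \<bar>\<psi> x\<bar> \<le> C * (1 + (\<Sum>i<n. \<bar>x i\<bar>)) ^ k)))"

definition sample :: "('h \<Rightarrow> 'w \<Rightarrow> real) \<Rightarrow> nat \<Rightarrow> (nat \<Rightarrow> 'h) \<Rightarrow> 'w \<Rightarrow> nat \<Rightarrow> real" where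
  "sample W n h w = (\<lambda>i. if i < n then W (h i) w else 0)"

text \<open>The graph of the Malliavin derivative on smooth cylindrical functionals.\<close>

definition cylindrical_derivative ::
    "('h::real_vector \<Rightarrow> 'w \<Rightarrow> real) \<Rightarrow> ('w \<Rightarrow> real) \<Rightarrow> ('w \<Rightarrow> 'h) \<Rightarrow> bool" where
  "cylindrical_derivative W F X \<longleftrightarrow>
     (\<exists>n h \<phi>. smooth_poly_growth n \<phi> \<and>
        F = (\<lambda>w. \<phi> (sample W n h w)) \<and>
        X = (\<lambda>w. \<Sum>i<n. partial_deriv i \<phi> (sample W n h w) *\<^sub>R h i))"

text \<open>
  The closure of this graph in \<open>L\<^sup>2(\<Omega>) \<times> L\<^sup>2(\<Omega>; H)\<close>. The derivative is determined almost surely,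
  so it is given as a relation between a functional and the versions of its derivative.
\<close>

definition has_malliavin_derivative ::
    "'w measure \<Rightarrow> ('h::{real_inner, banach, second_countable_topology} \<Rightarrow> 'w \<Rightarrow> real)
      \<Rightarrow> ('w \<Rightarrow> real) \<Rightarrow> ('w \<Rightarrow> 'h) \<Rightarrow> bool" where
  "has_malliavin_derivative M W F X \<longleftrightarrow>
     square_integrable M F \<and> square_integrable M X \<and>
     (\<exists>Fs Xs. (\<forall>k::nat. cylindrical_derivative W (Fs k) (Xs k)) \<and>
        tendsto_L2 M Fs F sequentially \<and> tendsto_L2 M Xs X sequentially)"

text \<open>
  The Ornstein--Uhlenbeck semigroup by Mehler's formula, for the functional
  \<open>F = \<Phi> (\<lambda>h. W h)\<close> of \<open>W\<close>: the second argument \<open>w'\<close> carries an independent copy of \<open>W\<close>, which is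
  integrated out.
\<close>

definition OU_semigroup ::
    "'w measure \<Rightarrow> ('h \<Rightarrow> 'w \<Rightarrow> real) \<Rightarrow> real \<Rightarrow> (('h \<Rightarrow> real) \<Rightarrow> real) \<Rightarrow> 'w \<Rightarrow> real" where
  "OU_semigroup M W t \<Phi> w =
     (\<integral>w'. \<Phi> (\<lambda>h. exp (- t) * W h w + sqrt (1 - exp (- 2 * t)) * W h w') \<partial>M)"

text \<open>
  \<open>LF\<close> is a version of the generator applied to \<open>F\<close>. Measurability of \<open>F\<close> with respect to the
  \<open>\<sigma>\<close>-algebra generated by \<open>W\<close> is expressed by the factorization through a measurable \<open>\<Phi>\<close>.
\<close>

definition has_OU_generator ::
    "'w measure \<Rightarrow> ('h \<Rightarrow> 'w \<Rightarrow> real) \<Rightarrow> ('w \<Rightarrow> real) \<Rightarrow> ('w \<Rightarrow> real) \<Rightarrow> bool" where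
  "has_OU_generator M W F LF \<longleftrightarrow>
     square_integrable M F \<and> square_integrable M LF \<and>
     (\<exists>\<Phi> \<in> borel_measurable (Pi\<^sub>M UNIV (\<lambda>_. borel)).
        (AE w in M. F w = \<Phi> (\<lambda>h. W h w)) \<and>
        tendsto_L2 M (\<lambda>t w. (OU_semigroup M W t \<Phi> w - F w) / t) LF (at_right 0))"

text \<open>\<open>G\<close> is a version of \<open>(-L)\<^sup>-\<^sup>1 F\<close>, for centered \<open>F\<close>.\<close>

definition has_OU_pseudo_inverse ::
    "'w measure \<Rightarrow> ('h \<Rightarrow> 'w \<Rightarrow> real) \<Rightarrow> ('w \<Rightarrow> real) \<Rightarrow> ('w \<Rightarrow> real) \<Rightarrow> bool" where
  "has_OU_pseudo_inverse M W F G \<longleftrightarrow>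
     square_integrable M F \<and> (\<integral>w. F w \<partial>M) = 0 \<and> (\<integral>w. G w \<partial>M) = 0 \<and>
     (\<exists>LG. has_OU_generator M W G LG \<and> (AE w in M. - LG w = F w))"

end

theory Submission
  imports Defs "HOL-Real_Asymp.Real_Asymp"
begin

text \<open>
  Let \<open>x = (W(f)\<^sup>2 + W(g)\<^sup>2) / 2\<close>, so \<open>U = exp (- x)\<close>. On functionals \<open>\<Gamma> x\<close> the generator acts as
  \<open>L \<Gamma> = 2 x \<Gamma>'' + 2 (1 - x) \<Gamma>'\<close>, and \<open>D (\<Gamma> x) = \<Gamma>' x (W(f) f + W(g) g)\<close>. For \<open>Y = y U\<close> the
  equation \<open>- L \<Gamma> = Y\<close> integrates once to \<open>2 x \<Gamma>' x = U\<^sup>-\<^sup>1 (\<integral>v\<in>{0..U}. y v)\<close>, whose right-hand side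
  vanishes at \<open>x = 0\<close> because \<open>y\<close> is centered. Hence \<open>\<Gamma>\<close> is smooth with polynomial growth, and
  \<open>\<langle>D Y, D \<Gamma>\<rangle> = - y' U (\<integral>v\<in>{0..U}. y v)\<close>, which is the claimed sum. That \<open>U\<close> is uniform enters only
  through the means of \<open>sin (c U)\<close>, and these follow from \<open>E (L \<Gamma>) = 0\<close>.

  The versions of \<open>D\<close> and of \<open>(-L)\<^sup>-\<^sup>1\<close> are arbitrary, so both must be shown to be unique. Each time one tests
  against \<open>cos (W(k) + \<theta>)\<close>: for \<open>D\<close> through Gaussian integration by parts, for \<open>L\<close> through the
  symmetry of the semigroup, which Mehler's formula turns into a rotation of two independent copies of \<open>W\<close>.
\<close>

subsection \<open>Uniqueness of laws via characteristic functions\<close>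

text \<open>Four obstacles shape what follows. (1) Recovering \<open>\<Gamma>'\<close> means
  dividing by \<open>2 x\<close>, singular at the origin; the quotient is written as an average
  along the segment from 0 to \<open>x\<close>, which keeps all derivatives and their growth under
  control. (2) The factor \<open>exp x\<close> hidden in the right-hand side of the integrated
  equation grows too fast to be treated factor by factor; a first-order relation satisfied by the
  whole expression replaces such an analysis. (3) Mehler's coefficient
  \<open>sqrt (1 - exp (- 2 * t))\<close> is not differentiable at \<open>t = 0\<close>. With
  \<open>exp (- t) = cos \<theta>\<close> the semigroup averages a rotation through
  \<open>\<theta>\<close>, smooth in \<open>\<theta>\<close>: the first-order term averages to zero,
  the second-order term gives the generator, and \<open>t\<close> behaves like half the squared
  angle. (4) Orthogonality to the cosines only controls functionals of the path of \<open>W\<close>,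
  while a version lives on the whole probability space. For the generator the factorization through
  \<open>\<Phi>\<close> is part of the notion; for \<open>D\<close> the approximating cylindrical
  functionals have to supply it.\<close>

lemma integrable_bounded_mult:
  fixes b q :: "'a \<Rightarrow> real"
  assumes "integrable M q" "b \<in> borel_measurable M" "\<And>w. \<bar>b w\<bar> \<le> C"
  shows "integrable M (\<lambda>w. b w * q w)"
proof (rule Bochner_Integration.integrable_bound)
  show "integrable M (\<lambda>w. C * \<bar>q w\<bar>)" using assms by auto
  show "(\<lambda>w. b w * q w) \<in> borel_measurable M" using assms by auto
  have "\<bar>b w\<bar> * \<bar>q w\<bar> \<le> C * \<bar>q w\<bar>" for w by (intro mult_right_mono assms) auto
  moreover have "C \<ge> 0" using assms(3)[of undefined] by linarith
  ultimately show "AE w in M. norm (b w * q w) \<le> norm (C * \<bar>q w\<bar>)"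
    by (auto simp: abs_mult)
qed

text \<open>The positive and negative parts of \<open>Z\<close> have the same mass \<open>m\<close>
  (take \<open>s = 0\<close>), so division by \<open>m\<close> makes them two probability densities
  whose images under \<open>X\<close> have equal characteristic functions; Levy's uniqueness theorem
  applies. The free phase lets one family of cosines carry real and imaginary parts.\<close>

lemma signed_char_unique:
  fixes X Z :: "'a \<Rightarrow> real"
  assumes Z: "integrable M Z" and X[measurable]: "X \<in> borel_measurable M"
    and cos0: "\<And>s \<theta>. (\<integral>w. cos (s * X w + \<theta>) * Z w \<partial>M) = 0"
    and S[measurable]: "S \<in> sets borel"
  shows "(\<integral>w. indicator S (X w) * Z w \<partial>M) = 0"
proof -
  define p where "p w = max 0 (Z w)" for w
  define n where "n w = max 0 (- Z w)" for w
  have [measurable]: "Z \<in> borel_measurable M" using Z by auto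
  have pint: "integrable M p" and nint: "integrable M n"
    unfolding p_def[abs_def] n_def[abs_def] using Z by auto
  have Zpn: "Z w = p w - n w" for w by (auto simp: p_def n_def)
  have p0: "p w \<ge> 0" and n0: "n w \<ge> 0" for w by (auto simp: p_def n_def)
  have [measurable]: "p \<in> borel_measurable M" "n \<in> borel_measurable M" using pint nint by auto
  have split: "(\<integral>w. b w * p w \<partial>M) = (\<integral>w. b w * n w \<partial>M)"
    if "(\<integral>w. b w * Z w \<partial>M) = 0" "b \<in> borel_measurable M" "\<And>w. \<bar>b w\<bar> \<le> 1" for b :: "'a \<Rightarrow> real"
  proof -
    have "(\<integral>w. b w * Z w \<partial>M) = (\<integral>w. b w * p w - b w * n w \<partial>M)"
      by (simp add: Zpn algebra_simps)
    also have "\<dots> = (\<integral>w. b w * p w \<partial>M) - (\<integral>w. b w * n w \<partial>M)"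
      by (intro Bochner_Integration.integral_diff integrable_bounded_mult[of _ _ _ 1] that pint nint)
    finally show ?thesis using that by simp
  qed
  define m where "m = integral\<^sup>L M p"
  have mn: "integral\<^sup>L M n = m"
    using split[of "\<lambda>_. 1"] cos0[of 0 0] by (simp add: m_def)
  \<comment> \<open>For \<open>m = 0\<close> no normalisation is possible, but then \<open>Z\<close>
    vanishes almost everywhere.\<close>
  show ?thesis
  proof (cases "m = 0")
    case True
    then have "AE w in M. p w = 0" "AE w in M. n w = 0"
      using integral_nonneg_eq_0_iff_AE[OF pint] integral_nonneg_eq_0_iff_AE[OF nint] p0 n0 mn m_def
      by auto
    then have "AE w in M. indicator S (X w) * Z w = 0"
      by eventually_elim (auto simp: Zpn)
    then show ?thesis by (rule integral_eq_zero_AE)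
  next
    case False
    then have m: "m > 0" unfolding m_def
      using p0 by (simp add: less_le)
    define D where "D q = distr (density M (\<lambda>w. ennreal (q w / m))) borel X" for q
    have mass: "real_distribution (D q)"
      if "integrable M q" "\<And>w. q w \<ge> 0" "integral\<^sup>L M q = m" for q
    proof -
      have [measurable]: "q \<in> borel_measurable M" using that by auto
      have "prob_space (density M (\<lambda>w. ennreal (q w / m)))"
      proof
        have "emeasure (density M (\<lambda>w. ennreal (q w / m))) (space M) = (\<integral>\<^sup>+w. ennreal (q w / m) \<partial>M)"
          by (subst emeasure_density) (auto intro!: nn_integral_cong)
        also have "\<dots> = ennreal (\<integral>w. q w / m \<partial>M)"
          using that m by (intro nn_integral_eq_integral) auto
        also have "\<dots> = 1" using that m by simp
        finally show "emeasure (density M (\<lambda>w. ennreal (q w / m)))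
            (space (density M (\<lambda>w. ennreal (q w / m)))) = 1" by simp
      qed
      then show ?thesis
        unfolding D_def by (intro prob_space.real_distribution_distr) auto
    qed
    have charD: "char (D q) s = (CLINT w|M. (q w / m) *\<^sub>R iexp (s * X w))"
        "complex_integrable M (\<lambda>w. (q w / m) *\<^sub>R iexp (s * X w))"
      if "integrable M q" "\<And>w. q w \<ge> 0" for q s
    proof -
      have [measurable]: "q \<in> borel_measurable M" using that by auto
      show "char (D q) s = (CLINT w|M. (q w / m) *\<^sub>R iexp (s * X w))"
        unfolding D_def char_def using that m
        by (subst integral_distr; (simp del: times_divide_eq_left)?) (subst integral_density; auto)
      show "complex_integrable M (\<lambda>w. (q w / m) *\<^sub>R iexp (s * X w))"
        using that m by (intro Bochner_Integration.integrable_bound[OF that(1)[THEN integrable_divide_zero, of m]])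
          (auto simp: norm_mult)
    qed
    have "D p = D n"
    proof (rule Levy_uniqueness)
      show "real_distribution (D p)" using pint p0 m_def by (intro mass) auto
      show "real_distribution (D n)" using nint n0 mn by (intro mass) auto
      show "char (D p) = char (D n)"
      proof
        fix s
        note P = charD[OF pint p0, of s] and N = charD[OF nint n0, of s]
        let ?f = "\<lambda>w. (Z w / m) *\<^sub>R iexp (s * X w)"
        have "?f = (\<lambda>w. (p w / m) *\<^sub>R iexp (s * X w) - (n w / m) *\<^sub>R iexp (s * X w))"
          by (simp add: Zpn diff_divide_distrib scaleR_diff_left)
        then have f: "complex_integrable M ?f" "char (D p) s - char (D n) s = (CLINT w|M. ?f w)"
          using P N by simp_all
        have "(CLINT w|M. ?f w) = 0"
        proof (rule complex_eqI)
          have "(\<lambda>w. Re (?f w)) = (\<lambda>w. cos (s * X w + 0) * Z w / m)"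
            "(\<lambda>w. Im (?f w)) = (\<lambda>w. cos (s * X w + - (pi / 2)) * Z w / m)"
            by (simp_all add: Re_exp Im_exp cos_diff fun_eq_iff)
          then have z: "(\<integral>w. Re (?f w) \<partial>M) = 0" "(\<integral>w. Im (?f w) \<partial>M) = 0"
            using cos0[of s 0] cos0[of s "- (pi / 2)"] by (simp_all only: integral_divide_zero div_0)
          show "Re (CLINT w|M. ?f w) = Re 0" "Im (CLINT w|M. ?f w) = Im 0"
            using trans[OF integral_Re[OF f(1), symmetric] z(1)] trans[OF integral_Im[OF f(1), symmetric] z(2)]
            by (simp_all only: zero_complex.sel)
        qed
        with f(2) show "char (D p) s = char (D n) s" by simp
      qed
    qed
    then have "measure (D p) S = measure (D n) S" by simp
    moreover have "measure (D q) S = (\<integral>w. indicator S (X w) * q w \<partial>M) / m"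
      if q: "integrable M q" "\<And>w. q w \<ge> 0" for q
    proof -
      have [measurable]: "q \<in> borel_measurable M" using that by auto
      have "measure (D q) S = (\<integral>x. indicator S x \<partial>D q)"
        by (simp add: D_def)
      also have "\<dots> = (\<integral>w. (q w / m) *\<^sub>R indicator S (X w) \<partial>M)"
        unfolding D_def using that m
        by (subst integral_distr; (simp del: times_divide_eq_left)?) (subst integral_density; auto)
      also have "\<dots> = (\<integral>w. (indicator S (X w) * q w) / m \<partial>M)"
        by (intro Bochner_Integration.integral_cong) auto
      finally show ?thesis by simp
    qed
    ultimately have eq: "(\<integral>w. indicator S (X w) * p w \<partial>M) = (\<integral>w. indicator S (X w) * n w \<partial>M)"
      using m pint nint p0 n0 by simp
    have "(\<integral>w. indicator S (X w) * Z w \<partial>M) = (\<integral>w. indicator S (X w) * p w - indicator S (X w) * n w \<partial>M)"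
      by (simp add: Zpn algebra_simps)
    also have "\<dots> = 0"
      using integrable_bounded_mult[OF pint, of "\<lambda>w. indicator S (X w)" 1] integrable_bounded_mult[OF nint, of "\<lambda>w. indicator S (X w)" 1]
      by (subst Bochner_Integration.integral_diff) (simp_all add: eq)
    finally show ?thesis .
  qed
qed

text \<open>The set \<open>L\<close> plays the role of the linear combinations of the coordinates of \<open>X\<close>.\<close>

lemma signed_law_unique:
  fixes X :: "'i \<Rightarrow> 'a \<Rightarrow> real" and Z :: "'a \<Rightarrow> real"
  assumes Z: "integrable M Z" and X[measurable]: "\<And>i. X i \<in> borel_measurable M"
    and L0: "(\<lambda>_. 0) \<in> L"
    and Ladd: "\<And>l s i. l \<in> L \<Longrightarrow> (\<lambda>w. l w + s * X i w) \<in> L"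
    and Lm: "L \<subseteq> borel_measurable M"
    and cos0: "\<And>l \<theta>. l \<in> L \<Longrightarrow> (\<integral>w. cos (l w + \<theta>) * Z w \<partial>M) = 0"
    and \<Phi>[measurable]: "\<Phi> \<in> borel_measurable (Pi\<^sub>M UNIV (\<lambda>_. borel))"
    and int: "integrable M (\<lambda>w. \<Phi> (\<lambda>i. X i w) * Z w)"
  shows "(\<integral>w. \<Phi> (\<lambda>i. X i w) * Z w \<partial>M) = 0"
proof -
  have [measurable]: "Z \<in> borel_measurable M" using Z by auto
  have [measurable]: "l \<in> borel_measurable M" if "l \<in> L" for l using that Lm by auto
  \<comment> \<open>Indicators of coordinates enter one at a time while a cosine stays in front.
    Both \<open>l\<close> and \<open>\<theta>\<close> are arbitrary in the induction because the
    product formula shifts both.\<close>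
  have box: "(\<integral>w. cos (l w + \<theta>) * ((\<Prod>j\<in>J. indicator (S j) (X j w)) * Z w) \<partial>M) = 0"
    if J: "finite J" and S[measurable]: "\<And>j. j \<in> J \<Longrightarrow> S j \<in> sets borel" and "l \<in> L" for J S l \<theta>
    using that
  proof (induction J arbitrary: l \<theta> rule: finite_induct)
    case empty then show ?case using cos0 by simp
  next
    case (insert j J)
    have [measurable]: "S j \<in> sets borel" and SJ[measurable]: "\<And>j. j \<in> J \<Longrightarrow> S j \<in> sets borel"
      using insert by auto
    define V where "V w = (\<Prod>j\<in>J. indicator (S j) (X j w)) * Z w" for w
    have pb: "\<bar>(\<Prod>j\<in>J. indicator (S j) (X j w)) :: real\<bar> \<le> 1" for w
      by (simp add: abs_prod) (intro prod_le_1, auto simp: indicator_def)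
    have V: "integrable M V" unfolding V_def[abs_def]
      by (intro integrable_bounded_mult[OF Z _ pb]) measurable
    have tr: "integrable M (\<lambda>w. cos (l w + \<theta>) * V w)" if "l \<in> L" for l \<theta>
      using that by (auto intro!: integrable_bounded_mult[OF V, of _ 1])
    \<comment> \<open>A product of two cosines is half a sum of two cosines, whose arguments are
      again elements of \<open>L\<close> plus a phase. This is why \<open>L\<close> has to be closed
      under adding multiples of coordinates.\<close>
    have cc: "(\<integral>w. cos (s * X j w + \<theta>') * (cos (l w + \<theta>) * V w) \<partial>M) = 0" for s \<theta>'
    proof -
      have L: "(\<lambda>w. l w + s * X j w) \<in> L" for s by (rule Ladd) fact
      have "(\<integral>w. cos (s * X j w + \<theta>') * (cos (l w + \<theta>) * V w) \<partial>M)
        = (\<integral>w. 1/2 * (cos (l w + s * X j w + (\<theta> + \<theta>')) * V w)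
            + 1/2 * (cos (l w + (- s) * X j w + (\<theta> - \<theta>')) * V w) \<partial>M)"
        by (intro Bochner_Integration.integral_cong) (auto simp: cos_add cos_diff sin_add sin_diff algebra_simps)
      also have "\<dots> = 0"
        using insert.IH[OF insert.prems(1) L[of s]] insert.IH[OF insert.prems(1) L[of "- s"]]
          tr[OF L[of s]] tr[OF L[of "- s"]]
        unfolding V_def[symmetric] by (subst Bochner_Integration.integral_add) auto
      finally show ?thesis .
    qed
    have "(\<integral>w. indicator (S j) (X j w) * (cos (l w + \<theta>) * V w) \<partial>M) = 0"
      by (rule signed_char_unique[OF tr[OF insert.prems(2)]]) (auto simp: cc)
    then show ?case using insert.hyps by (simp add: V_def ac_simps)
  qed
  define p where "p w = max 0 (Z w)" for w
  define n where "n w = max 0 (- Z w)" for w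
  have pint: "integrable M p" and nint: "integrable M n"
    unfolding p_def[abs_def] n_def[abs_def] using Z by auto
  have Zpn: "Z w = p w - n w" for w by (auto simp: p_def n_def)
  have p0: "p w \<ge> 0" and n0: "n w \<ge> 0" for w by (auto simp: p_def n_def)
  have [measurable]: "p \<in> borel_measurable M" "n \<in> borel_measurable M" using pint nint by auto
  let ?P = "Pi\<^sub>M UNIV (\<lambda>_::'i. borel :: real measure)"
  have Xm[measurable]: "(\<lambda>w i. X i w) \<in> measurable M ?P"
    by (intro measurable_PiM_single') auto
  define D where "D q = distr (density M (\<lambda>w. ennreal (q w))) ?P (\<lambda>w i. X i w)" for q
  have D_integral: "integral\<^sup>L (D q) \<Psi> = (\<integral>w. \<Psi> (\<lambda>i. X i w) * q w \<partial>M)"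
    if q: "integrable M q" "\<And>w. q w \<ge> 0" and [measurable]: "\<Psi> \<in> borel_measurable ?P" for q and \<Psi> :: "_ \<Rightarrow> real"
  proof -
    have [measurable]: "q \<in> borel_measurable M" using q by auto
    show ?thesis unfolding D_def using that
      by (subst integral_distr; (simp)?) (subst integral_density; auto simp: mult.commute)
  qed
  have fin: "finite_measure (D q)" if q: "integrable M q" "\<And>w. q w \<ge> 0" for q
  proof -
    have [measurable]: "q \<in> borel_measurable M" using q by auto
    have "finite_measure (density M (\<lambda>w. ennreal (q w)))"
      using q by (intro finite_measureI)
        (simp add: emeasure_density nn_integral_eq_integral cong: nn_integral_cong)
    then show ?thesis unfolding D_def by (intro finite_measure.finite_measure_distr) auto
  qed
  \<comment> \<open>Boxes over finitely many coordinates are stable under intersection and generate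
    the product sigma-algebra, so agreement on them suffices, even for an uncountable index
    set.\<close>
  have "D p = D n"
  proof (rule measure_eqI_PiM_infinite)
    have sets_D: "sets (D q) = sets ?P" for q by (simp add: D_def)
    show "sets (D p) = sets ?P" "sets (D n) = sets ?P" by (rule sets_D)+
    show "finite_measure (D p)" by (rule fin[OF pint p0])
    fix A :: "'i \<Rightarrow> real set" and J :: "'i set"
    assume J: "finite J" "J \<subseteq> UNIV" and A[measurable]: "\<And>i. i \<in> J \<Longrightarrow> A i \<in> sets borel"
    let ?E = "prod_emb UNIV (\<lambda>_. borel) J (Pi\<^sub>E J A)"
    have E[measurable]: "?E \<in> sets ?P" using J A by (intro sets_PiM_I) auto
    have mem: "(\<lambda>i. X i w) \<in> ?E \<longleftrightarrow> (\<forall>j\<in>J. X j w \<in> A j)" for w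
      by (auto simp: prod_emb_def PiE_iff restrict_def extensional_def)
    have eD: "emeasure (D q) ?E = ennreal (\<integral>w. (\<Prod>j\<in>J. indicator (A j) (X j w)) * q w \<partial>M)"
      if q: "integrable M q" "\<And>w. q w \<ge> 0" for q
    proof -
      interpret finite_measure "D q" by (rule fin[OF q])
      have "(\<Prod>j\<in>J. indicator (A j) (X j w)) = (indicator ?E (\<lambda>i. X i w) :: real)" for w
        using J by (auto simp: indicator_def mem)
      then show ?thesis
        using D_integral[OF q, of "indicator ?E"] E sets_D[of q] by (simp add: emeasure_eq_measure)
    qed
    have pb: "\<bar>(\<Prod>j\<in>J. indicator (A j) (X j w)) :: real\<bar> \<le> 1" for w
        by (simp add: abs_prod) (intro prod_le_1, auto simp: indicator_def)
    have "(\<integral>w. (\<Prod>j\<in>J. indicator (A j) (X j w)) * p w \<partial>M) - (\<integral>w. (\<Prod>j\<in>J. indicator (A j) (X j w)) * n w \<partial>M)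
       = (\<integral>w. (\<Prod>j\<in>J. indicator (A j) (X j w)) * Z w \<partial>M)"
      using integrable_bounded_mult[OF pint _ pb] integrable_bounded_mult[OF nint _ pb]
      by (subst Bochner_Integration.integral_diff[symmetric]) (simp_all add: Zpn algebra_simps)
    also have "\<dots> = 0" using box[OF J(1) A L0, where \<theta> = 0] by simp
    finally show "emeasure (D p) ?E = emeasure (D n) ?E"
      using eD[OF pint p0] eD[OF nint n0] by simp
  qed
  then have eq: "(\<integral>w. \<Phi> (\<lambda>i. X i w) * p w \<partial>M) = (\<integral>w. \<Phi> (\<lambda>i. X i w) * n w \<partial>M)"
    using D_integral[OF pint p0 \<Phi>] D_integral[OF nint n0 \<Phi>] by simp
  have i: "integrable M (\<lambda>w. \<Phi> (\<lambda>i. X i w) * p w)" "integrable M (\<lambda>w. \<Phi> (\<lambda>i. X i w) * n w)"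
    by (intro Bochner_Integration.integrable_bound[OF int];
        auto simp: abs_mult p_def n_def intro!: mult_left_mono)+
  have "(\<integral>w. \<Phi> (\<lambda>i. X i w) * Z w \<partial>M) = (\<integral>w. \<Phi> (\<lambda>i. X i w) * p w - \<Phi> (\<lambda>i. X i w) * n w \<partial>M)"
    by (simp add: Zpn algebra_simps)
  also have "\<dots> = 0" using i eq by simp
  finally show ?thesis .
qed

text \<open>The Boolean factor carries counting measure rather than a fair coin, so the two
  integrals add without weights.\<close>

lemma mixture_integral:
  fixes h1 h2 :: "'a \<Rightarrow> real"
  assumes "sigma_finite_measure K" and h: "integrable K h1" "integrable K h2"
  shows "integrable (K \<Otimes>\<^sub>M count_space (UNIV :: bool set)) (\<lambda>x. if snd x then h1 (fst x) else h2 (fst x))"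
      (is "integrable ?K ?h")
    and "(\<integral>x. (if snd x then h1 (fst x) else h2 (fst x)) \<partial>(K \<Otimes>\<^sub>M count_space (UNIV :: bool set)))
      = (\<integral>x. h1 x \<partial>K) + (\<integral>x. h2 x \<partial>K)"
proof -
  interpret K: sigma_finite_measure K by fact
  interpret C: sigma_finite_measure "count_space (UNIV :: bool set)"
    by (rule sigma_finite_measure_count_space_finite) auto
  interpret KC: pair_sigma_finite K "count_space (UNIV :: bool set)" ..
  have [measurable]: "h1 \<in> borel_measurable K" "h2 \<in> borel_measurable K" using h by auto
  have inner: "(\<integral>b. f b \<partial>count_space (UNIV :: bool set)) = f True + f False" for f :: "bool \<Rightarrow> real"
    by (subst lebesgue_integral_count_space_finite) (auto simp: UNIV_bool)
  have ic: "integrable (count_space (UNIV :: bool set)) f" for f :: "bool \<Rightarrow> real"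
    by (rule integrable_count_space) auto
  show i: "integrable ?K ?h"
  proof (rule KC.Fubini_integrable)
    show "?h \<in> borel_measurable ?K" by measurable
    show "integrable K (\<lambda>x. \<integral>y. norm (?h (x, y)) \<partial>count_space UNIV)" using h by (simp add: inner)
    show "AE x in K. integrable (count_space UNIV) (\<lambda>y. ?h (x, y))" by (simp add: ic)
  qed
  show "integral\<^sup>L ?K ?h = (\<integral>x. h1 x \<partial>K) + (\<integral>x. h2 x \<partial>K)"
    using h by (subst KC.integral_fst'[OF i, symmetric]) (simp add: inner)
qed

lemma integral_pair_mult:
  fixes u :: "'a \<Rightarrow> real" and v :: "'b \<Rightarrow> real"
  assumes "prob_space M" "prob_space N" and u: "integrable M u" and v: "integrable N v"
  shows "integrable (M \<Otimes>\<^sub>M N) (\<lambda>x. u (fst x) * v (snd x))"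
    and "(\<integral>x. u (fst x) * v (snd x) \<partial>(M \<Otimes>\<^sub>M N)) = integral\<^sup>L M u * integral\<^sup>L N v"
proof -
  interpret M: prob_space M by fact
  interpret N: prob_space N by fact
  interpret MN: pair_prob_space M N ..
  have [measurable]: "u \<in> borel_measurable M" "v \<in> borel_measurable N" using assms by auto
  show i: "integrable (M \<Otimes>\<^sub>M N) (\<lambda>x. u (fst x) * v (snd x))"
    using u v by (intro MN.Fubini_integrable) (auto simp: abs_mult)
  show "(\<integral>x. u (fst x) * v (snd x) \<partial>(M \<Otimes>\<^sub>M N)) = integral\<^sup>L M u * integral\<^sup>L N v"
    using u v by (subst MN.integral_fst'[OF i, symmetric]) auto
qed

text \<open>Reduction to one space: a mixture carries both processes, the second one with weight \<open>- Z'\<close>.\<close>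

lemma signed_law_unique2:
  fixes X :: "'i \<Rightarrow> 'a \<Rightarrow> real" and Z :: "'a \<Rightarrow> real"
    and X' :: "'i \<Rightarrow> 'b \<Rightarrow> real" and Z' :: "'b \<Rightarrow> real"
  assumes M: "prob_space M" and N: "prob_space N"
    and Z: "integrable M Z" "integrable N Z'"
    and X[measurable]: "\<And>i. X i \<in> borel_measurable M" "\<And>i. X' i \<in> borel_measurable N"
    and L0: "((\<lambda>_. 0), (\<lambda>_. 0)) \<in> L"
    and Ladd: "\<And>l l' s i. (l, l') \<in> L \<Longrightarrow> ((\<lambda>w. l w + s * X i w), (\<lambda>w. l' w + s * X' i w)) \<in> L"
    and Lm: "L \<subseteq> borel_measurable M \<times> borel_measurable N"
    and cos0: "\<And>l l' \<theta>. (l, l') \<in> L \<Longrightarrow>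
      (\<integral>w. cos (l w + \<theta>) * Z w \<partial>M) = (\<integral>w. cos (l' w + \<theta>) * Z' w \<partial>N)"
    and \<Phi>[measurable]: "\<Phi> \<in> borel_measurable (Pi\<^sub>M UNIV (\<lambda>_. borel))"
    and int: "integrable M (\<lambda>w. \<Phi> (\<lambda>i. X i w) * Z w)" "integrable N (\<lambda>w. \<Phi> (\<lambda>i. X' i w) * Z' w)"
  shows "(\<integral>w. \<Phi> (\<lambda>i. X i w) * Z w \<partial>M) = (\<integral>w. \<Phi> (\<lambda>i. X' i w) * Z' w \<partial>N)"
proof -
  interpret M: prob_space M by fact
  interpret N: prob_space N by fact
  interpret MN: pair_prob_space M N ..
  let ?K = "(M \<Otimes>\<^sub>M N) \<Otimes>\<^sub>M count_space (UNIV :: bool set)"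
  define mix where "mix u v x = (if snd x then u (fst (fst x)) else v (snd (fst x)))"
    for u :: "'a \<Rightarrow> real" and v :: "'b \<Rightarrow> real" and x :: "('a \<times> 'b) \<times> bool"
  have mixm[measurable]: "mix u v \<in> borel_measurable ?K"
    if [measurable]: "u \<in> borel_measurable M" "v \<in> borel_measurable N" for u v
    unfolding mix_def by measurable
  \<comment> \<open>Each integrand depends on one coordinate of the product only; the other
    integrates to 1 because both measures are probabilities.\<close>
  have mixi: "integrable ?K (mix u v)" "integral\<^sup>L ?K (mix u v) = integral\<^sup>L M u + integral\<^sup>L N v"
    if "integrable M u" "integrable N v" for u v
    using mixture_integral[OF MN.sigma_finite_measure_axioms, of "\<lambda>x. u (fst x)" "\<lambda>x. v (snd x)"]
      integral_pair_mult[OF M N that(1), of "\<lambda>_. 1"] integral_pair_mult[OF M N _ that(2), of "\<lambda>_. 1"]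
    unfolding mix_def by (auto simp: M.prob_space N.prob_space)
  have Zm[measurable]: "Z \<in> borel_measurable M" "Z' \<in> borel_measurable N" using Z by auto
  have tr: "integrable M (\<lambda>w. cos (l w + \<theta>) * Z w)" "integrable N (\<lambda>w. cos (l' w + \<theta>) * Z' w)"
    if "(l, l') \<in> L" for l l' \<theta>
    using that Lm by (auto intro!: integrable_bounded_mult[OF Z(1), of _ 1] integrable_bounded_mult[OF Z(2), of _ 1])
  have "(\<integral>x. \<Phi> (\<lambda>i. mix (X i) (X' i) x) * mix Z (\<lambda>v. - Z' v) x \<partial>?K) = 0"
  proof (rule signed_law_unique[where X = "\<lambda>i. mix (X i) (X' i)" and L = "(\<lambda>(l, l'). mix l l') ` L"])
    show "integrable ?K (mix Z (\<lambda>v. - Z' v))" using Z by (intro mixi) auto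
    show "mix (X i) (X' i) \<in> borel_measurable ?K" for i by measurable
    let ?L = "(\<lambda>(l, l'). mix l l') ` L"
    show "(\<lambda>_. 0) \<in> ?L" using L0 by (intro rev_image_eqI[of "((\<lambda>_. 0), (\<lambda>_. 0))"]) (auto simp: mix_def)
    show "(\<lambda>w. l w + s * mix (X i) (X' i) w) \<in> ?L" if "l \<in> ?L" for l s i
    proof -
      from that obtain a b where ab: "(a, b) \<in> L" "l = mix a b" by auto
      show ?thesis
        by (intro rev_image_eqI[OF Ladd[OF ab(1), of s i]]) (auto simp: mix_def fun_eq_iff ab)
    qed
    show "?L \<subseteq> borel_measurable ?K" using Lm mixm by auto
    fix l \<theta> assume "l \<in> ?L"
    then obtain a b where ab: "(a, b) \<in> L" "l = mix a b" by auto
    have "(\<lambda>w. cos (l w + \<theta>) * mix Z (\<lambda>v. - Z' v) w)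
        = mix (\<lambda>w. cos (a w + \<theta>) * Z w) (\<lambda>w. - (cos (b w + \<theta>) * Z' w))"
      by (auto simp: mix_def ab)
    then show "(\<integral>w. cos (l w + \<theta>) * mix Z (\<lambda>v. - Z' v) w \<partial>?K) = 0"
      using tr[OF ab(1)] cos0[OF ab(1)] by (simp add: mixi)
  next
    show "\<Phi> \<in> borel_measurable (Pi\<^sub>M UNIV (\<lambda>_. borel))" by fact
    have "(\<lambda>w. \<Phi> (\<lambda>i. mix (X i) (X' i) w) * mix Z (\<lambda>v. - Z' v) w)
        = mix (\<lambda>w. \<Phi> (\<lambda>i. X i w) * Z w) (\<lambda>w. - (\<Phi> (\<lambda>i. X' i w) * Z' w))"
      by (auto simp: mix_def)
    then show "integrable ?K (\<lambda>w. \<Phi> (\<lambda>i. mix (X i) (X' i) w) * mix Z (\<lambda>v. - Z' v) w)"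
      using int by (auto intro!: mixi)
  qed
  moreover have "(\<lambda>w. \<Phi> (\<lambda>i. mix (X i) (X' i) w) * mix Z (\<lambda>v. - Z' v) w)
        = mix (\<lambda>w. \<Phi> (\<lambda>i. X i w) * Z w) (\<lambda>w. - (\<Phi> (\<lambda>i. X' i w) * Z' w))"
    by (auto simp: mix_def)
  ultimately show ?thesis using int by (simp add: mixi)
qed

subsection \<open>Isonormal Gaussian processes\<close>

text \<open>Having all moments is stable under sums and products, so integrability of any polynomial
  expression in the process is settled by closure rules, without tracking exponents.\<close>

definition has_moments :: "'a measure \<Rightarrow> ('a \<Rightarrow> real) \<Rightarrow> bool" where
  "has_moments M X \<longleftrightarrow> X \<in> borel_measurable M \<and> (\<forall>k::nat. integrable M (\<lambda>w. \<bar>X w\<bar> ^ k))"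

lemma has_moments_measurable: "has_moments M X \<Longrightarrow> X \<in> borel_measurable M"
  by (simp add: has_moments_def)

lemma has_moments_integrable_abs_power: "has_moments M X \<Longrightarrow> integrable M (\<lambda>w. \<bar>X w\<bar> ^ k)"
  by (simp add: has_moments_def)

lemma has_moments_integrable: "has_moments M X \<Longrightarrow> integrable M X"
  using has_moments_integrable_abs_power[of M X 1] integrable_abs_cancel[of M X]
  by (auto simp: has_moments_def)

lemma has_moments_bound:
  assumes "has_moments M X" "Y \<in> borel_measurable M" "\<And>w. w \<in> space M \<Longrightarrow> \<bar>Y w\<bar> \<le> \<bar>X w\<bar>"
  shows "has_moments M Y"
  unfolding has_moments_def
proof (intro conjI allI)
  have [measurable]: "Y \<in> borel_measurable M" by fact
  fix k :: nat
  show "integrable M (\<lambda>w. \<bar>Y w\<bar> ^ k)"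
    using assms(3) by (intro Bochner_Integration.integrable_bound[OF has_moments_integrable_abs_power[OF assms(1), of k]])
      (auto intro!: power_mono AE_I2)
qed fact

lemma has_moments_add:
  assumes X: "has_moments M X" and Y: "has_moments M Y"
  shows "has_moments M (\<lambda>w. X w + Y w)"
  unfolding has_moments_def
proof (intro conjI allI)
  have [measurable]: "X \<in> borel_measurable M" "Y \<in> borel_measurable M"
    using assms by (auto simp: has_moments_def)
  show "(\<lambda>w. X w + Y w) \<in> borel_measurable M" by measurable
  fix k :: nat
  show "integrable M (\<lambda>w. \<bar>X w + Y w\<bar> ^ k)"
  proof (rule Bochner_Integration.integrable_bound)
    show "integrable M (\<lambda>w. 2 ^ k * (\<bar>X w\<bar> ^ k + \<bar>Y w\<bar> ^ k))"
      using assms by (auto simp: has_moments_def)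
    have "\<bar>a + b\<bar> ^ k \<le> 2 ^ k * (\<bar>a\<bar> ^ k + \<bar>b\<bar> ^ k)" for a b :: real
    proof -
      have "\<bar>a + b\<bar> ^ k \<le> (2 * max \<bar>a\<bar> \<bar>b\<bar>) ^ k" by (intro power_mono) auto
      also have "\<dots> = 2 ^ k * max \<bar>a\<bar> \<bar>b\<bar> ^ k" by (simp add: power_mult_distrib)
      also have "\<dots> \<le> 2 ^ k * (\<bar>a\<bar> ^ k + \<bar>b\<bar> ^ k)" by (intro mult_left_mono) (auto simp: max_def)
      finally show ?thesis .
    qed
    then show "AE w in M. norm (\<bar>X w + Y w\<bar> ^ k) \<le> norm (2 ^ k * (\<bar>X w\<bar> ^ k + \<bar>Y w\<bar> ^ k))"
      by (auto simp: abs_mult)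
  qed measurable
qed

lemma has_moments_mult:
  assumes X: "has_moments M X" and Y: "has_moments M Y"
  shows "has_moments M (\<lambda>w. X w * Y w)"
  unfolding has_moments_def
proof (intro conjI allI)
  have [measurable]: "X \<in> borel_measurable M" "Y \<in> borel_measurable M"
    using assms by (auto simp: has_moments_def)
  show "(\<lambda>w. X w * Y w) \<in> borel_measurable M" by measurable
  fix k :: nat
  show "integrable M (\<lambda>w. \<bar>X w * Y w\<bar> ^ k)"
  proof (rule Bochner_Integration.integrable_bound)
    show "integrable M (\<lambda>w. \<bar>X w\<bar> ^ (2 * k) + \<bar>Y w\<bar> ^ (2 * k))"
      using assms by (auto simp: has_moments_def)
    have "\<bar>a * b\<bar> ^ k \<le> \<bar>a\<bar> ^ (2 * k) + \<bar>b\<bar> ^ (2 * k)" for a b :: real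
    proof -
      have "\<bar>a * b\<bar> \<le> (max \<bar>a\<bar> \<bar>b\<bar>)\<^sup>2"
        by (auto simp: abs_mult power2_eq_square intro!: mult_mono)
      then have "\<bar>a * b\<bar> ^ k \<le> ((max \<bar>a\<bar> \<bar>b\<bar>)\<^sup>2) ^ k" by (intro power_mono) auto
      also have "\<dots> = max \<bar>a\<bar> \<bar>b\<bar> ^ (2 * k)" by (simp add: power_mult)
      also have "\<dots> \<le> \<bar>a\<bar> ^ (2 * k) + \<bar>b\<bar> ^ (2 * k)" by (auto simp: max_def)
      finally show ?thesis .
    qed
    then show "AE w in M. norm (\<bar>X w * Y w\<bar> ^ k) \<le> norm (\<bar>X w\<bar> ^ (2 * k) + \<bar>Y w\<bar> ^ (2 * k))"
      by (auto simp: abs_mult)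
  qed measurable
qed

lemma (in finite_measure) has_moments_const: "has_moments M (\<lambda>_. c)"
  by (auto simp: has_moments_def)

lemma (in finite_measure) has_moments_power:
  "has_moments M X \<Longrightarrow> has_moments M (\<lambda>w. X w ^ k)"
  by (induction k) (auto intro: has_moments_mult has_moments_const)

lemma (in finite_measure) has_moments_cmult:
  "has_moments M X \<Longrightarrow> has_moments M (\<lambda>w. c * X w)"
  by (auto intro: has_moments_mult has_moments_const)

lemma (in finite_measure) has_moments_diff:
  "has_moments M X \<Longrightarrow> has_moments M Y \<Longrightarrow> has_moments M (\<lambda>w. X w - Y w)"
  using has_moments_add[of M X "\<lambda>w. (-1) * Y w"] has_moments_cmult[of Y "-1"] by simp

lemma has_moments_abs: "has_moments M X \<Longrightarrow> has_moments M (\<lambda>w. \<bar>X w\<bar>)"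
  by (rule has_moments_bound) (auto simp: has_moments_def)

lemma (in finite_measure) has_moments_sum:
  "(\<And>i. i \<in> A \<Longrightarrow> has_moments M (X i)) \<Longrightarrow> has_moments M (\<lambda>w. \<Sum>i\<in>A. X i w)"
  by (induction A rule: infinite_finite_induct) (auto intro: has_moments_add has_moments_const)

lemma (in finite_measure) has_moments_bounded:
  "X \<in> borel_measurable M \<Longrightarrow> (\<And>w. \<bar>X w\<bar> \<le> C) \<Longrightarrow> has_moments M X"
  by (rule has_moments_bound[OF has_moments_const[of C]]) (auto intro: order_trans[OF _ abs_ge_self])

lemmas (in finite_measure) has_moments_intros =
  has_moments_const has_moments_add has_moments_mult has_moments_diff has_moments_abs
  has_moments_sum has_moments_power

section \<open>Polynomial growth relative to a gauge\<close>

text \<open>The gauge \<open>b\<close> is kept apart from the argument so that one notion covers the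
  half line, sequences measured by a sum of absolute coordinates, and the parameter tuples of the
  Taylor estimate.\<close>

definition poly_growth :: "'a set \<Rightarrow> ('a \<Rightarrow> real) \<Rightarrow> ('a \<Rightarrow> real) \<Rightarrow> bool" where
  "poly_growth A b f \<longleftrightarrow> (\<exists>C m. 0 \<le> C \<and> (\<forall>x\<in>A. \<bar>f x\<bar> \<le> C * (1 + \<bar>b x\<bar>) ^ (m::nat)))"

lemma poly_growthI: "0 \<le> C \<Longrightarrow> (\<And>x. x \<in> A \<Longrightarrow> \<bar>f x\<bar> \<le> C * (1 + \<bar>b x\<bar>) ^ m) \<Longrightarrow> poly_growth A b f"
  unfolding poly_growth_def by blast

lemma poly_growth_bounded: "(\<And>x. x \<in> A \<Longrightarrow> \<bar>f x\<bar> \<le> C) \<Longrightarrow> poly_growth A b f"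
  by (rule poly_growthI[of "\<bar>C\<bar>" _ _ _ 0]) (auto intro: order_trans[OF _ abs_ge_self])

lemma poly_growth_const: "poly_growth A b (\<lambda>_. c)"
  by (rule poly_growth_bounded) auto

lemma poly_growth_gauge: "poly_growth A b b"
  by (rule poly_growthI[of 1 _ _ _ 1]) auto

lemma poly_growth_le:
  "poly_growth A b g \<Longrightarrow> (\<And>x. x \<in> A \<Longrightarrow> \<bar>f x\<bar> \<le> \<bar>g x\<bar>) \<Longrightarrow> poly_growth A b f"
  unfolding poly_growth_def by (meson order_trans)

lemma poly_growth_abs: "poly_growth A b f \<Longrightarrow> poly_growth A b (\<lambda>x. \<bar>f x\<bar>)"
  by (rule poly_growth_le) auto

lemma poly_growth_add:
  assumes "poly_growth A b f" "poly_growth A b g"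
  shows "poly_growth A b (\<lambda>x. f x + g x)"
proof -
  obtain C m D n where f: "0 \<le> C" "\<And>x. x \<in> A \<Longrightarrow> \<bar>f x\<bar> \<le> C * (1 + \<bar>b x\<bar>) ^ m"
    and g: "0 \<le> D" "\<And>x. x \<in> A \<Longrightarrow> \<bar>g x\<bar> \<le> D * (1 + \<bar>b x\<bar>) ^ n"
    using assms unfolding poly_growth_def by blast
  show ?thesis
  proof (rule poly_growthI[of "C + D" _ _ _ "m + n"])
    fix x assume x: "x \<in> A"
    have "(1 + \<bar>b x\<bar>) ^ m \<le> (1 + \<bar>b x\<bar>) ^ (m + n)" "(1 + \<bar>b x\<bar>) ^ n \<le> (1 + \<bar>b x\<bar>) ^ (m + n)"
      by (auto intro!: power_increasing)
    from mult_left_mono[OF this(1) f(1)] mult_left_mono[OF this(2) g(1)] f(2)[OF x] g(2)[OF x]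
    show "\<bar>f x + g x\<bar> \<le> (C + D) * (1 + \<bar>b x\<bar>) ^ (m + n)"
      unfolding distrib_right by linarith
  qed (use f g in auto)
qed

lemma poly_growth_mult:
  assumes "poly_growth A b f" "poly_growth A b g"
  shows "poly_growth A b (\<lambda>x. f x * g x)"
proof -
  obtain C m D n where f: "0 \<le> C" "\<And>x. x \<in> A \<Longrightarrow> \<bar>f x\<bar> \<le> C * (1 + \<bar>b x\<bar>) ^ m"
    and g: "0 \<le> D" "\<And>x. x \<in> A \<Longrightarrow> \<bar>g x\<bar> \<le> D * (1 + \<bar>b x\<bar>) ^ n"
    using assms unfolding poly_growth_def by blast
  show ?thesis
  proof (rule poly_growthI[of "C * D" _ _ _ "m + n"])
    fix x assume "x \<in> A"
    then have "\<bar>f x\<bar> * \<bar>g x\<bar> \<le> (C * (1 + \<bar>b x\<bar>) ^ m) * (D * (1 + \<bar>b x\<bar>) ^ n)"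
      using f g by (intro mult_mono) auto
    then show "\<bar>f x * g x\<bar> \<le> (C * D) * (1 + \<bar>b x\<bar>) ^ (m + n)"
      by (simp add: abs_mult power_add algebra_simps)
  qed (use f g in auto)
qed

lemma poly_growth_diff: "poly_growth A b f \<Longrightarrow> poly_growth A b g \<Longrightarrow> poly_growth A b (\<lambda>x. f x - g x)"
  using poly_growth_add[OF _ poly_growth_mult[OF poly_growth_const[of _ _ "-1"]], of A b f g] by simp

lemma poly_growth_power: "poly_growth A b f \<Longrightarrow> poly_growth A b (\<lambda>x. f x ^ k)"
  by (induction k) (auto intro: poly_growth_mult poly_growth_const)

lemma poly_growth_sum: "(\<And>i. i \<in> I \<Longrightarrow> poly_growth A b (f i)) \<Longrightarrow> poly_growth A b (\<lambda>x. \<Sum>i\<in>I. f i x)"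
  by (induction I rule: infinite_finite_induct) (auto intro: poly_growth_add poly_growth_const)

lemma poly_growth_compose:
  assumes f: "poly_growth A b f" and h: "\<And>y. y \<in> A' \<Longrightarrow> h y \<in> A" and bh: "poly_growth A' b' (\<lambda>y. b (h y))"
  shows "poly_growth A' b' (\<lambda>y. f (h y))"
proof -
  obtain C m where C: "0 \<le> C" "\<And>x. x \<in> A \<Longrightarrow> \<bar>f x\<bar> \<le> C * (1 + \<bar>b x\<bar>) ^ m"
    using f unfolding poly_growth_def by blast
  have "poly_growth A' b' (\<lambda>y. C * (1 + \<bar>b (h y)\<bar>) ^ m)"
    by (intro poly_growth_mult poly_growth_power poly_growth_add poly_growth_const poly_growth_abs bh)
  then show ?thesis
    by (rule poly_growth_le) (use C h in \<open>auto intro!: order_trans[OF C(2) abs_ge_self]\<close>)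
qed

lemmas poly_growth_intros =
  poly_growth_mult poly_growth_add poly_growth_diff poly_growth_power poly_growth_sum
  poly_growth_const poly_growth_abs

lemma (in finite_measure) poly_growth_has_moments:
  assumes "poly_growth A b f" "has_moments M (\<lambda>w. b (X w))" "(\<lambda>w. f (X w)) \<in> borel_measurable M" "\<And>w. X w \<in> A"
  shows "has_moments M (\<lambda>w. f (X w))"
proof -
  obtain C m where C: "\<And>x. x \<in> A \<Longrightarrow> \<bar>f x\<bar> \<le> C * (1 + \<bar>b x\<bar>) ^ m"
    using assms(1) unfolding poly_growth_def by blast
  show ?thesis
  proof (rule has_moments_bound[OF _ assms(3)])
    show "has_moments M (\<lambda>w. C * (1 + \<bar>b (X w)\<bar>) ^ m)"
      by (intro has_moments_const has_moments_mult has_moments_add has_moments_power has_moments_abs assms)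
    show "\<bar>f (X w)\<bar> \<le> \<bar>C * (1 + \<bar>b (X w)\<bar>) ^ m\<bar>" for w
      using C[OF assms(4)] by (rule order_trans) simp
  qed
qed

lemma (in prob_space) normal_has_moments:
  assumes "0 < \<sigma>" and D: "distributed M lborel X (\<lambda>x. ennreal (normal_density \<mu> \<sigma> x))"
  shows "has_moments M X"
proof -
  have [measurable]: "X \<in> borel_measurable M" using D by (auto simp: distributed_def)
  have "has_moments M (\<lambda>w. X w - \<mu>)"
    unfolding has_moments_def
  proof (intro conjI allI)
    fix k :: nat
    have "integrable M (\<lambda>w. \<bar>X w - \<mu>\<bar> ^ k) \<longleftrightarrow> integrable lborel (\<lambda>x. normal_density \<mu> \<sigma> x * \<bar>x - \<mu>\<bar> ^ k)"
      by (subst distributed_integrable[OF D, symmetric]) auto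
    then show "integrable M (\<lambda>w. \<bar>X w - \<mu>\<bar> ^ k)"
      using integrable_normal_moment_abs[OF \<open>0 < \<sigma>\<close>] by simp
  qed measurable
  from has_moments_add[OF this has_moments_const[of \<mu>]] show ?thesis by simp
qed

lemma std_normal_cos:
  "(\<integral>x. cos (r * x + \<theta>) \<partial>std_normal_distribution) = exp (- r\<^sup>2 / 2) * cos \<theta>"
proof -
  interpret S: prob_space std_normal_distribution
    by (simp add: prob_space_normal_density)
  have c: "complex_integrable std_normal_distribution (\<lambda>x. iexp (r * x))"
    by (intro S.integrable_const_bound[of _ 1]) auto
  have ch: "(CLINT x|std_normal_distribution. iexp (r * x)) = complex_of_real (exp (- (r^2) / 2))"
    using char_std_normal_distribution by (simp add: char_def fun_eq_iff)
  have "(\<integral>x. cos (r * x) \<partial>std_normal_distribution) = exp (- r\<^sup>2 / 2)"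
    using integral_Re[OF c] unfolding ch by (simp add: Re_exp)
  moreover have "(\<integral>x. sin (r * x) \<partial>std_normal_distribution) = 0"
    using integral_Im[OF c] unfolding ch by (simp add: Im_exp)
  moreover have "integrable std_normal_distribution (\<lambda>x. cos (r * x))"
    "integrable std_normal_distribution (\<lambda>x. sin (r * x))"
    by (auto intro!: S.integrable_const_bound[of _ 1])
  ultimately show ?thesis by (simp add: cos_add)
qed

section \<open>Almost sure linearity, marginal laws and characteristic functions of the
  process\<close>

context isonormal_gaussian_process
begin

lemma W_gaussian: "gaussian_rv M (W h)"
  using jointly_gaussian[of "{h}" "\<lambda>_. 1"] by simp

lemma W_measurable[measurable]: "W h \<in> borel_measurable M"
  using W_gaussian[of h] by (simp add: gaussian_rv_def)

lemma W_has_moments: "has_moments M (W h)"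
proof -
  consider \<mu> \<sigma> where "0 < \<sigma>" "distributed M lborel (W h) (\<lambda>x. ennreal (normal_density \<mu> \<sigma> x))"
    | c where "AE w in M. W h w = c"
    using W_gaussian[of h] by (auto simp: gaussian_rv_def)
  then show ?thesis
  proof cases
    case 1 then show ?thesis by (rule normal_has_moments)
  next
    case 2
    have "integrable M (\<lambda>w. \<bar>W h w\<bar> ^ k) \<longleftrightarrow> integrable M (\<lambda>w. \<bar>c\<bar> ^ k)" for k
      using 2 by (intro integrable_cong_AE) auto
    then show ?thesis by (auto simp: has_moments_def)
  qed
qed

lemma W_integrable: "integrable M (W h)" "integrable M (\<lambda>w. W h w * W h' w)"
  by (auto intro!: has_moments_integrable has_moments_mult W_has_moments)

text \<open>Linearity of \<open>W\<close> is a consequence of the covariance: the mean square of the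
  defect expands to zero. The exceptional null set depends on \<open>a\<close>, \<open>s\<close> and
  \<open>b\<close>, so linearity can be invoked only for one relation at a time.\<close>

lemma W_add_scale: "AE w in M. W (a + s *\<^sub>R b) w = W a w + s * W b w"
proof -
  define c where "c = a + s *\<^sub>R b"
  have 1: "(W c w - W a w - s * W b w)\<^sup>2 = W c w * W c w + W a w * W a w + s\<^sup>2 * (W b w * W b w)
     - 2 * (W c w * W a w) - 2 * s * (W c w * W b w) + 2 * s * (W a w * W b w)" for w
    by (simp add: power2_eq_square algebra_simps)
  have i: "integrable M (\<lambda>w. (W c w - W a w - s * W b w)\<^sup>2)"
    by (intro has_moments_integrable has_moments_power has_moments_diff has_moments_cmult W_has_moments)
  have "expectation (\<lambda>w. (W c w - W a w - s * W b w)\<^sup>2) =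
     inner c c + inner a a + s\<^sup>2 * inner b b - 2 * inner c a - 2 * s * inner c b + 2 * s * inner a b"
    unfolding 1 by (simp add: W_integrable covariance)
  also have "\<dots> = 0"
    unfolding c_def by (simp add: inner_simps algebra_simps power2_eq_square inner_commute)
  finally have "AE w in M. (W c w - W a w - s * W b w)\<^sup>2 = 0"
    using i by (subst (asm) integral_nonneg_eq_0_iff_AE) auto
  then show ?thesis unfolding c_def by eventually_elim auto
qed

lemma W_zero: "AE w in M. W 0 w = 0"
  using W_add_scale[of 0 "-1" 0] by eventually_elim simp

lemma W_scale: "AE w in M. W (s *\<^sub>R b) w = s * W b w"
  using W_add_scale[of 0 s b] W_zero by eventually_elim simp

text \<open>Mean 0 and second moment 1 determine the parameters of the normal law. The degenerate
  alternative in \<open>gaussian_rv\<close> is excluded because a constant with mean 0 has second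
  moment 0.\<close>

lemma W_std_normal:
  assumes "norm e = 1"
  shows "distr M borel (W e) = std_normal_distribution"
proof -
  have ne: "expectation (\<lambda>w. (W e w)\<^sup>2) = 1"
    using covariance[of e e] assms by (simp add: power2_eq_square[symmetric] power2_norm_eq_inner[symmetric])
  consider \<mu> \<sigma> where "0 < \<sigma>" "distributed M lborel (W e) (\<lambda>x. ennreal (normal_density \<mu> \<sigma> x))"
    | c where "AE w in M. W e w = c"
    using W_gaussian[of e] by (auto simp: gaussian_rv_def)
  then show ?thesis
  proof cases
    case 1
    have "\<mu> = 0" using normal_distributed_expectation[OF 1] centered by simp
    moreover have "\<sigma>\<^sup>2 = 1"
      using normal_distributed_variance[OF 1] ne centered by simp
    then have "\<sigma> = 1" using \<open>0 < \<sigma>\<close> by (simp add: power2_eq_1_iff)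
    ultimately have "distributed M lborel (W e) std_normal_density" using 1 by simp
    from distributed_distr_eq_density[OF this] show ?thesis
      by (simp add: distr_cong[OF refl sets_lborel refl])
  next
    case 2
    have "c = expectation (W e)"
      using 2 by (subst integral_cong_AE[of _ _ "\<lambda>_. c"]) (auto simp: prob_space)
    then have c: "c = 0" using centered by simp
    have "expectation (\<lambda>w. (W e w)\<^sup>2) = 0"
      using 2 c by (intro integral_eq_zero_AE) auto
    then show ?thesis using ne by simp
  qed
qed

lemma W_cos: "expectation (\<lambda>w. cos (W h w + \<theta>)) = exp (- (norm h)\<^sup>2 / 2) * cos \<theta>"
proof (cases "h = 0")
  case True
  have "expectation (\<lambda>w. cos (W h w + \<theta>)) = expectation (\<lambda>w. cos \<theta>)"
    using W_zero True by (intro integral_cong_AE) auto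
  then show ?thesis using True by (simp add: prob_space)
next
  case False
  let ?e = "h /\<^sub>R norm h"
  have "expectation (\<lambda>w. cos (W h w + \<theta>)) = expectation (\<lambda>w. cos (norm h * W ?e w + \<theta>))"
    using W_scale[of "norm h" ?e] False by (intro integral_cong_AE) auto
  also have "\<dots> = (\<integral>x. cos (norm h * x + \<theta>) \<partial>(distr M borel (W ?e)))"
    by (rule integral_distr[symmetric]) auto
  also have "\<dots> = exp (- (norm h)\<^sup>2 / 2) * cos \<theta>"
    using False by (subst W_std_normal) (auto simp: std_normal_cos)
  finally show ?thesis .
qed

abbreviation M2 :: "('w \<times> 'w) measure" where "M2 \<equiv> M \<Otimes>\<^sub>M M"

sublocale MM: pair_prob_space M M ..

text \<open>The addition formula splits the cosine into products of one-variable factors. Sines are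
  written as cosines with phase shifted by \<open>pi / 2\<close>, so that \<open>W_cos\<close>
  evaluates every factor.\<close>

lemma W_pair_cos:
  "(\<integral>x. cos (W a (fst x) + W b (snd x) + \<theta>) \<partial>M2) = exp (- ((norm a)\<^sup>2 + (norm b)\<^sup>2) / 2) * cos \<theta>"
proof -
  define C where "C \<theta> h w = cos (W h w + \<theta>)" for \<theta> h w
  have i: "integrable M (C \<theta> h)" for \<theta> h
    unfolding C_def by (auto intro!: integrable_const_bound[of _ 1])
  have E: "integral\<^sup>L M (C \<theta> h) = exp (- (norm h)\<^sup>2 / 2) * cos \<theta>" for \<theta> h
    unfolding C_def by (rule W_cos)
  note p = integral_pair_mult[OF prob_space_axioms prob_space_axioms i i]
  have "cos (W a (fst x) + W b (snd x) + \<theta>) =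
      C 0 a (fst x) * C \<theta> b (snd x) - C (- (pi / 2)) a (fst x) * C (\<theta> - pi / 2) b (snd x)" for x
    by (simp add: C_def cos_add cos_diff sin_add algebra_simps)
  then show ?thesis
    by (simp add: p E exp_add[symmetric] add_divide_distrib diff_divide_distrib)
qed

lemma AE_fst_snd:
  assumes "AE w in M. P w"
  shows "AE x in M2. P (fst x)" "AE x in M2. P (snd x)"
proof -
  obtain N where N: "{w \<in> space M. \<not> P w} \<subseteq> N" "N \<in> null_sets M"
    using assms by (auto simp: eventually_ae_filter)
  have [measurable]: "N \<in> sets M" using N by auto
  have "emeasure M2 (N \<times> space M) = 0" "emeasure M2 (space M \<times> N) = 0"
    using N by (auto simp: emeasure_pair_measure_Times)
  then have n: "N \<times> space M \<in> null_sets M2" "space M \<times> N \<in> null_sets M2"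
    by auto
  show "AE x in M2. P (fst x)" "AE x in M2. P (snd x)"
    by (rule AE_I'[OF n(1)], use N in \<open>force simp: space_pair_measure\<close>)
       (rule AE_I'[OF n(2)], use N in \<open>force simp: space_pair_measure\<close>)
qed

end

subsection \<open>The Ornstein--Uhlenbeck semigroup on characters\<close>

text \<open>Cauchy-Schwarz against a fixed square integrable \<open>B\<close>. The conditions on the
  approximants are required only eventually, because the difference quotients of the semigroup are
  controlled for positive times only.\<close>

lemma tendsto_L2_pairing:
  fixes X :: "'i \<Rightarrow> 'w \<Rightarrow> real"
  assumes L: "tendsto_L2 M X Z F"
    and X: "eventually (\<lambda>i. X i \<in> borel_measurable M) F" and Z[measurable]: "Z \<in> borel_measurable M"
    and B[measurable]: "B \<in> borel_measurable M" and B2: "integrable M (\<lambda>w. (B w)\<^sup>2)"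
    and XB: "eventually (\<lambda>i. integrable M (\<lambda>w. X i w * B w)) F" and ZB: "integrable M (\<lambda>w. Z w * B w)"
  shows "((\<lambda>i. \<integral>w. \<bar>X i w * B w - Z w * B w\<bar> \<partial>M) \<longlongrightarrow> 0) F"
    and "((\<lambda>i. \<integral>w. X i w * B w \<partial>M) \<longlongrightarrow> (\<integral>w. Z w * B w \<partial>M)) F"
proof -
  let ?s = "\<lambda>i. \<integral>\<^sup>+w. ennreal (norm (X i w - Z w) * \<bar>B w\<bar>) \<partial>M"
  define b where "b = (\<integral>w. (B w)\<^sup>2 \<partial>M)"
  have b: "(\<integral>\<^sup>+w. ennreal ((B w)\<^sup>2) \<partial>M) = ennreal b"
    unfolding b_def using B2 by (intro nn_integral_eq_integral) auto
  have sq: "((\<lambda>i. (?s i)\<^sup>2) \<longlongrightarrow> 0) F"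
  proof (rule tendsto_sandwich[OF _ _ tendsto_const])
    show "eventually (\<lambda>i. (?s i)\<^sup>2 \<le> ennreal b * (\<integral>\<^sup>+w. ennreal ((norm (X i w - Z w))\<^sup>2) \<partial>M)) F"
      using X
    proof eventually_elim
      case (elim i)
      then have [measurable]: "X i \<in> borel_measurable M" .
      have "(?s i)\<^sup>2 = (\<integral>\<^sup>+w. ennreal (norm (X i w - Z w)) * ennreal \<bar>B w\<bar> \<partial>M)\<^sup>2"
        by (simp add: ennreal_mult)
      also have "\<dots> \<le> (\<integral>\<^sup>+w. (ennreal (norm (X i w - Z w)))\<^sup>2 \<partial>M) * (\<integral>\<^sup>+w. (ennreal \<bar>B w\<bar>)\<^sup>2 \<partial>M)"
        by (rule Cauchy_Schwarz_nn_integral) measurable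
      also have "\<dots> = (\<integral>\<^sup>+w. ennreal ((norm (X i w - Z w))\<^sup>2) \<partial>M) * ennreal b"
        by (simp add: ennreal_power b[symmetric])
      finally show ?case by (simp add: mult.commute)
    qed
    show "((\<lambda>i. ennreal b * (\<integral>\<^sup>+w. ennreal ((norm (X i w - Z w))\<^sup>2) \<partial>M)) \<longlongrightarrow> 0) F"
      using ennreal_tendsto_cmult[OF _ L[unfolded tendsto_L2_def], of "ennreal b"] by simp
  qed simp
  have "((\<lambda>i. sqrt (enn2real ((?s i)\<^sup>2))) \<longlongrightarrow> sqrt 0) F"
    using tendsto_enn2real[of _ 0 F] sq by (intro tendsto_real_sqrt) simp
  then have t: "((\<lambda>i. enn2real (?s i)) \<longlongrightarrow> 0) F"
    by (simp add: power2_eq_square enn2real_mult)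
  show 1: "((\<lambda>i. \<integral>w. \<bar>X i w * B w - Z w * B w\<bar> \<partial>M) \<longlongrightarrow> 0) F"
  proof (rule Lim_transform_eventually[OF t])
    show "eventually (\<lambda>i. enn2real (\<integral>\<^sup>+w. ennreal (norm (X i w - Z w) * \<bar>B w\<bar>) \<partial>M)
        = (\<integral>w. \<bar>X i w * B w - Z w * B w\<bar> \<partial>M)) F"
      using X XB
    proof eventually_elim
      case (elim i)
      have "norm (X i w - Z w) * \<bar>B w\<bar> = \<bar>X i w * B w - Z w * B w\<bar>" for w
        by (simp add: abs_mult[symmetric] algebra_simps)
      then show ?case
        using elim ZB by (subst nn_integral_eq_integral) auto
    qed
  qed
  show "((\<lambda>i. \<integral>w. X i w * B w \<partial>M) \<longlongrightarrow> (\<integral>w. Z w * B w \<partial>M)) F"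
  proof (rule LIM_zero_cancel, rule Lim_null_comparison[OF _ 1])
    show "eventually (\<lambda>i. norm ((\<integral>w. X i w * B w \<partial>M) - (\<integral>w. Z w * B w \<partial>M))
       \<le> (\<integral>w. \<bar>X i w * B w - Z w * B w\<bar> \<partial>M)) F"
      using XB
    proof eventually_elim
      case (elim i)
      have "norm (\<integral>w. X i w * B w - Z w * B w \<partial>M) \<le> (\<integral>w. norm (X i w * B w - Z w * B w) \<partial>M)"
        by (rule integral_norm_bound)
      then show ?case using elim ZB by simp
    qed
  qed
qed

lemma square_integrable_imp_L1:
  assumes "finite_measure M" "square_integrable M X" shows "integrable M X"
proof -
  interpret finite_measure M by fact
  have [measurable]: "X \<in> borel_measurable M" and i: "integrable M (\<lambda>w. (norm (X w))\<^sup>2)"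
    using assms by (auto simp: square_integrable_def)
  show ?thesis
  proof (rule Bochner_Integration.integrable_bound)
    show "integrable M (\<lambda>w. 1 + (norm (X w))\<^sup>2)" using i by simp
    have "a \<le> 1 + a\<^sup>2" for a :: real using sum_power2_ge_zero[of "a - 1" a] by (auto simp: power2_eq_square algebra_simps)
    then show "AE w in M. norm (X w) \<le> norm (1 + (norm (X w))\<^sup>2)" by auto
  qed measurable
qed

lemma square_integrable_add:
  assumes "square_integrable M X" "square_integrable M Y"
  shows "square_integrable M (\<lambda>w. X w + Y w)"
  unfolding square_integrable_def
proof
  have [measurable]: "X \<in> borel_measurable M" "Y \<in> borel_measurable M"
    using assms by (auto simp: square_integrable_def)
  show "(\<lambda>w. X w + Y w) \<in> borel_measurable M" by measurable
  show "integrable M (\<lambda>w. (norm (X w + Y w))\<^sup>2)"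
  proof (rule Bochner_Integration.integrable_bound)
    show "integrable M (\<lambda>w. 2 * (norm (X w))\<^sup>2 + 2 * (norm (Y w))\<^sup>2)"
      using assms by (auto simp: square_integrable_def)
    have "(norm (x + y))\<^sup>2 \<le> 2 * (norm x)\<^sup>2 + 2 * (norm y)\<^sup>2" for x y :: 'b
    proof -
      have "(norm (x + y))\<^sup>2 \<le> (norm x + norm y)\<^sup>2" by (intro power_mono norm_triangle_ineq) auto
      also have "\<dots> \<le> 2 * (norm x)\<^sup>2 + 2 * (norm y)\<^sup>2"
        using zero_le_power2[of "norm x - norm y"] by (simp add: power2_eq_square algebra_simps)
      finally show ?thesis .
    qed
    then show "AE w in M. norm ((norm (X w + Y w))\<^sup>2) \<le> norm (2 * (norm (X w))\<^sup>2 + 2 * (norm (Y w))\<^sup>2)"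
      by auto
  qed measurable
qed

lemma square_integrable_minus: "square_integrable M X \<Longrightarrow> square_integrable M (\<lambda>w. - X w)"
  by (auto simp: square_integrable_def)

lemma square_integrable_diff:
  "square_integrable M X \<Longrightarrow> square_integrable M Y \<Longrightarrow> square_integrable M (\<lambda>w. X w - Y w)"
  using square_integrable_add[OF _ square_integrable_minus, of M X Y] by simp

lemma has_moments_square_integrable: "has_moments M X \<Longrightarrow> square_integrable M X"
  using has_moments_integrable_abs_power[of M X 2] by (auto simp: has_moments_def square_integrable_def)

section \<open>Mixing two independent copies, and the symmetry of Mehler's semigroup\<close>

context isonormal_gaussian_process
begin

abbreviation \<Omega> :: "('h \<Rightarrow> real) measure" where "\<Omega> \<equiv> Pi\<^sub>M UNIV (\<lambda>_. borel)"

abbreviation path :: "'w \<Rightarrow> 'h \<Rightarrow> real" where "path w \<equiv> \<lambda>h. W h w"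

abbreviation OU :: "real \<Rightarrow> (('h \<Rightarrow> real) \<Rightarrow> real) \<Rightarrow> 'w \<Rightarrow> real" where "OU \<equiv> OU_semigroup M W"

lemma path_measurable[measurable]:
  "path \<in> measurable M \<Omega>"
  "(\<lambda>x h. c * W h (fst x) + s * W h (snd x)) \<in> measurable M2 \<Omega>"
  by (intro measurable_PiM_single'; auto)+

text \<open>
  For \<open>k = 0\<close> this says that \<open>V\<close> has the law of \<open>W\<close>. For a rotation \<open>V\<close> and general \<open>k\<close> it is the symmetry of
  the semigroup.
\<close>

lemma W_pair_pairing:
  fixes V :: "'h \<Rightarrow> 'w \<times> 'w \<Rightarrow> real"
  assumes V[measurable]: "\<And>a. V a \<in> borel_measurable M2"
    and VSR: "\<And>a. AE x in M2. V a x = W (S a) (fst x) + W (R a) (snd x)"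
    and lin: "linear S" "linear R" and norm: "\<And>a. (norm (S a))\<^sup>2 + (norm (R a))\<^sup>2 = (norm a)\<^sup>2"
    and adj: "\<And>a. inner (S a) k = inner a k'"
    and \<Phi>: "\<Phi> \<in> borel_measurable \<Omega>" and int: "integrable M2 (\<lambda>x. \<Phi> (\<lambda>h. V h x))" "integrable M (\<lambda>w. \<Phi> (path w))"
  shows "(\<integral>x. \<Phi> (\<lambda>h. V h x) * cos (W k (fst x) + \<theta>) \<partial>M2)
    = (\<integral>w. \<Phi> (path w) * (exp (- ((norm k)\<^sup>2 - (norm k')\<^sup>2) / 2) * cos (W k' w + \<theta>)) \<partial>M)"
proof -
  let ?Z = "\<lambda>x. cos (W k (fst x) + \<theta>)"
  let ?e = "exp (- ((norm k)\<^sup>2 - (norm k')\<^sup>2) / 2)"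
  let ?Z' = "\<lambda>w. ?e * cos (W k' w + \<theta>)"
  \<comment> \<open>The members of a pair are only almost surely equal to the process at
    \<open>a\<close>, since \<open>W\<close> is linear only up to null sets; closure under adding
    multiples of coordinates would fail otherwise.\<close>
  define L where "L = {(l, l'). l \<in> borel_measurable M2 \<and> l' \<in> borel_measurable M \<and>
      (\<exists>a. (AE x in M2. l x = W (S a) (fst x) + W (R a) (snd x)) \<and> (AE w in M. l' w = W a w))}"
  show ?thesis
  proof (rule signed_law_unique2[OF MM.P.prob_space_axioms prob_space_axioms,
      where X = V and X' = W and L = L, OF _ _ V W_measurable _ _ _ _ \<Phi>])
    show "integrable M2 ?Z" by (intro MM.P.integrable_const_bound[of _ 1]) auto
    show "integrable M ?Z'" by (intro integrable_const_bound[of _ ?e]) (auto simp: abs_mult)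
    show "((\<lambda>_. 0), (\<lambda>_. 0)) \<in> L"
      using AE_fst_snd[OF W_zero] W_zero lin by (auto simp: L_def linear_0 intro!: exI[of _ 0])
    show "L \<subseteq> borel_measurable M2 \<times> borel_measurable M" by (auto simp: L_def)
    show "integrable M2 (\<lambda>x. \<Phi> (\<lambda>h. V h x) * ?Z x)"
      using integrable_bounded_mult[OF int(1), of ?Z 1] by (simp add: mult.commute)
    show "integrable M (\<lambda>w. \<Phi> (path w) * ?Z' w)"
      using integrable_bounded_mult[OF int(2), of ?Z' ?e] by (simp add: abs_mult mult.commute)
    fix l l' assume "(l, l') \<in> L"
    then obtain a where [measurable]: "l \<in> borel_measurable M2" "l' \<in> borel_measurable M"
      and a: "AE x in M2. l x = W (S a) (fst x) + W (R a) (snd x)" "AE w in M. l' w = W a w" by (auto simp: L_def)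
    show "(\<lambda>w. l w + r * V i w, \<lambda>w. l' w + r * W i w) \<in> L" for r i
    proof -
      have "AE x in M2. l x + r * V i x = W (S (a + r *\<^sub>R i)) (fst x) + W (R (a + r *\<^sub>R i)) (snd x)"
        using a(1) VSR[of i] AE_fst_snd(1)[OF W_add_scale[of "S a" r "S i"]] AE_fst_snd(2)[OF W_add_scale[of "R a" r "R i"]]
        by eventually_elim (simp add: lin linear_add linear_scale algebra_simps)
      moreover have "AE x in M. l' x + r * W i x = W (a + r *\<^sub>R i) x"
        using a(2) W_add_scale[of a r i] by eventually_elim simp
      ultimately show ?thesis by (auto simp: L_def)
    qed
    \<comment> \<open>The product of \<open>cos (l x + \<alpha>)\<close> with the test cosine splits
      into cosines at the sum and the difference, that is, at the vectors \<open>u\<close>,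
      \<open>v\<close> on the product space and \<open>u'\<close>, \<open>v'\<close> on
      \<open>M\<close>.\<close>
    define u v where "u = S a + 1 *\<^sub>R k" and "v = S a + (- 1) *\<^sub>R k"
    define u' v' where "u' = a + 1 *\<^sub>R k'" and "v' = a + (- 1) *\<^sub>R k'"
    have sq: "(norm (p + r *\<^sub>R q))\<^sup>2 = (norm p)\<^sup>2 + 2 * r * inner p q + r\<^sup>2 * (norm q)\<^sup>2" for r and p q :: 'h
      unfolding power2_norm_eq_inner
      by (simp add: inner_simps inner_commute[of q p] power2_eq_square algebra_simps)
    \<comment> \<open>The adjoint relation makes the mixed inner products agree, so both squared
      norms change by the same amount, independent of \<open>a\<close> and of the sign. The Gaussian
      factors then differ by one common constant, which is \<open>?e\<close>.\<close>
    have nu: "(norm u)\<^sup>2 + (norm (R a))\<^sup>2 = (norm u')\<^sup>2 + ((norm k)\<^sup>2 - (norm k')\<^sup>2)"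
      "(norm v)\<^sup>2 + (norm (R a))\<^sup>2 = (norm v')\<^sup>2 + ((norm k)\<^sup>2 - (norm k')\<^sup>2)"
      unfolding u_def v_def u'_def v'_def sq adj norm[of a, symmetric] by simp_all
    have lk: "AE x in M2. l x + W k (fst x) = W u (fst x) + W (R a) (snd x)"
       "AE x in M2. l x - W k (fst x) = W v (fst x) + W (R a) (snd x)"
       "AE w in M. l' w + W k' w = W u' w" "AE w in M. l' w - W k' w = W v' w"
      subgoal using a(1) AE_fst_snd(1)[OF W_add_scale[of "S a" 1 k]] by eventually_elim (simp add: u_def)
      subgoal using a(1) AE_fst_snd(1)[OF W_add_scale[of "S a" "-1" k]] by eventually_elim (simp add: v_def)
      subgoal using a(2) W_add_scale[of a 1 k'] by eventually_elim (simp add: u'_def)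
      subgoal using a(2) W_add_scale[of a "-1" k'] by eventually_elim (simp add: v'_def)
      done
  have i: "integrable M2 (\<lambda>x. cos (f x))"
      if "f \<in> borel_measurable M2" for f :: "_ \<Rightarrow> real"
      using that by (auto intro!: MM.P.integrable_const_bound[of _ 1])
    have i': "integrable M (\<lambda>x. cos (f x))" if "f \<in> borel_measurable M" for f :: "_ \<Rightarrow> real"
      using that by (auto intro!: integrable_const_bound[of _ 1])
    have e1: "exp (- ((norm u)\<^sup>2 + (norm (R a))\<^sup>2) / 2) = ?e * exp (- (norm u')\<^sup>2 / 2)"
      unfolding nu exp_add[symmetric] by (simp add: field_simps)
    have e2: "exp (- ((norm v)\<^sup>2 + (norm (R a))\<^sup>2) / 2) = ?e * exp (- (norm v')\<^sup>2 / 2)"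
      unfolding nu exp_add[symmetric] by (simp add: field_simps)
    note pc = W_pair_cos[of u "R a", unfolded e1] W_pair_cos[of v "R a", unfolded e2]
    fix \<alpha>
    let ?c = "\<lambda>x. cos (W u (fst x) + W (R a) (snd x) + (\<alpha> + \<theta>))"
    let ?d = "\<lambda>x. cos (W v (fst x) + W (R a) (snd x) + (\<alpha> - \<theta>))"
    let ?c' = "\<lambda>w. cos (W u' w + (\<alpha> + \<theta>))" and ?d' = "\<lambda>w. cos (W v' w + (\<alpha> - \<theta>))"
    have "(\<integral>x. cos (l x + \<alpha>) * ?Z x \<partial>M2) = (\<integral>x. 1/2 * ?c x + 1/2 * ?d x \<partial>M2)"
    proof (rule integral_cong_AE)
      show "AE x in M2. cos (l x + \<alpha>) * ?Z x = 1/2 * ?c x + 1/2 * ?d x"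
        using lk(1,2)
      proof eventually_elim
        case (elim x)
        show ?case unfolding elim[symmetric] by (simp add: cos_add cos_diff sin_add sin_diff algebra_simps)
      qed
    qed measurable
    also have "\<dots> = 1/2 * integral\<^sup>L M2 ?c + 1/2 * integral\<^sup>L M2 ?d"
      by (subst Bochner_Integration.integral_add) (simp_all add: i)
    also have "\<dots> = ?e * (1/2 * integral\<^sup>L M ?c' + 1/2 * integral\<^sup>L M ?d')"
      unfolding pc W_cos by (simp add: algebra_simps)
    also have "\<dots> = ?e * (\<integral>w. 1/2 * ?c' w + 1/2 * ?d' w \<partial>M)"
      by (subst Bochner_Integration.integral_add) (simp_all add: i')
    also have "\<dots> = (\<integral>w. ?e * (1/2 * ?c' w + 1/2 * ?d' w) \<partial>M)" by simp
    also have "\<dots> = (\<integral>w. cos (l' w + \<alpha>) * ?Z' w \<partial>M)"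
    proof (rule integral_cong_AE)
      show "AE w in M. ?e * (1/2 * ?c' w + 1/2 * ?d' w) = cos (l' w + \<alpha>) * ?Z' w"
        using lk(3,4)
      proof eventually_elim
        case (elim x)
        show ?case unfolding elim[symmetric] by (simp add: cos_add cos_diff sin_add sin_diff algebra_simps)
      qed
    qed measurable
    finally show "(\<integral>x. cos (l x + \<alpha>) * ?Z x \<partial>M2) = (\<integral>w. cos (l' w + \<alpha>) * ?Z' w \<partial>M)" .
  qed
qed

lemma W_pair_law:
  fixes V :: "'h \<Rightarrow> 'w \<times> 'w \<Rightarrow> real"
  assumes V[measurable]: "\<And>a. V a \<in> borel_measurable M2"
    and VSR: "\<And>a. AE x in M2. V a x = W (S a) (fst x) + W (R a) (snd x)"
    and lin: "linear S" "linear R" and norm: "\<And>a. (norm (S a))\<^sup>2 + (norm (R a))\<^sup>2 = (norm a)\<^sup>2"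
  shows "distr M2 \<Omega> (\<lambda>x h. V h x) = distr M \<Omega> path" (is "?D = ?D'")
proof (rule measure_eqI)
  have [measurable]: "(\<lambda>x h. V h x) \<in> measurable M2 \<Omega>" by (intro measurable_PiM_single') auto
  interpret D: prob_space ?D by (intro MM.P.prob_space_distr) auto
  interpret D': prob_space ?D' by (intro prob_space_distr) auto
  show "sets ?D = sets ?D'" by simp
  fix A assume "A \<in> sets ?D"
  then have A[measurable]: "A \<in> sets \<Omega>" by simp
  let ?i = "indicator A :: _ \<Rightarrow> real"
  have "measure ?D A = (\<integral>x. ?i x \<partial>?D)" by simp
  also have "\<dots> = (\<integral>x. ?i (\<lambda>h. V h x) \<partial>M2)" by (rule integral_distr) measurable
  \<comment> \<open>The inserted cosine is almost surely 1, since \<open>W 0\<close> vanishes almost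
    surely; it brings the integral into the form of the pairing at the zero vector.\<close>
  also have "\<dots> = (\<integral>x. ?i (\<lambda>h. V h x) * cos (W 0 (fst x) + 0) \<partial>M2)"
    using AE_fst_snd(1)[OF W_zero] by (intro integral_cong_AE) auto
  also have "\<dots> = (\<integral>w. ?i (path w) * (exp (- ((norm (0::'h))\<^sup>2 - (norm (0::'h))\<^sup>2) / 2) * cos (W 0 w + 0)) \<partial>M)"
    by (intro W_pair_pairing[OF V VSR lin norm]) (auto intro!: MM.P.integrable_const_bound[of _ 1] integrable_const_bound[of _ 1])
  also have "\<dots> = (\<integral>w. ?i (path w) \<partial>M)"
    using W_zero by (intro integral_cong_AE) auto
  also have "\<dots> = (\<integral>x. ?i x \<partial>?D')" by (rule integral_distr[symmetric]) measurable
  also have "\<dots> = measure ?D' A" by simp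
  finally show "emeasure ?D A = emeasure ?D' A"
    by (simp add: D.emeasure_eq_measure D'.emeasure_eq_measure)
qed

lemma W_pair_AE: "AE x in M2. c * W a (fst x) + s * W b (snd x) = W (c *\<^sub>R a) (fst x) + W (s *\<^sub>R b) (snd x)"
  using AE_fst_snd(1)[OF W_scale[of c a]] AE_fst_snd(2)[OF W_scale[of s b]]
  by eventually_elim simp

lemma rotation_law:
  assumes cs: "c\<^sup>2 + s\<^sup>2 = 1"
  shows "distr M2 \<Omega> (\<lambda>x h. c * W h (fst x) + s * W h (snd x)) = distr M \<Omega> path"
  by (rule W_pair_law[OF _ W_pair_AE])
    (use cs in \<open>auto simp: power_mult_distrib linear_scale_self simp flip: distrib_right\<close>)

lemma integrable_rotation:
  fixes \<Phi> :: "('h \<Rightarrow> real) \<Rightarrow> real"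
  assumes "c\<^sup>2 + s\<^sup>2 = 1" and [measurable]: "\<Phi> \<in> borel_measurable \<Omega>" and "integrable M (\<lambda>w. \<Phi> (path w))"
  shows "integrable M2 (\<lambda>x. \<Phi> (\<lambda>h. c * W h (fst x) + s * W h (snd x)))"
proof -
  have "integrable (distr M \<Omega> path) \<Phi>"
    using assms(3) by (subst integrable_distr_eq) auto
  then show ?thesis
    unfolding rotation_law[OF assms(1), symmetric] by (subst (asm) integrable_distr_eq) auto
qed

lemma OU_coeffs: "t \<ge> 0 \<Longrightarrow> (exp (- t))\<^sup>2 + (sqrt (1 - exp (- 2 * t)))\<^sup>2 = (1::real)"
  by (simp add: exp_double[symmetric])

text \<open>By Mehler's formula the semigroup maps \<open>cos (W k + \<theta>)\<close> to
  \<open>cos (exp (- t) * W k + \<theta>)\<close> times the Gaussian factor, so the right-hand side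
  has the semigroup on the test function. The proof undoes the inner integral by Fubini and uses
  that scaling by \<open>exp (- t)\<close> is self-adjoint.\<close>

lemma OU_semigroup_pairing:
  assumes t: "t \<ge> 0" and [measurable]: "\<Phi> \<in> borel_measurable \<Omega>" and int: "integrable M (\<lambda>w. \<Phi> (path w))"
  shows "integrable M (OU t \<Phi>)"
    and "(\<integral>w. OU t \<Phi> w * cos (W k w + \<theta>) \<partial>M)
      = exp (- (1 - exp (- 2 * t)) * (norm k)\<^sup>2 / 2) * (\<integral>w. \<Phi> (path w) * cos (exp (- t) * W k w + \<theta>) \<partial>M)"
proof -
  define c s where "c = exp (- t)" and "s = sqrt (1 - exp (- 2 * t))"
  have cs: "c\<^sup>2 + s\<^sup>2 = 1" using OU_coeffs[OF t] by (simp add: c_def s_def)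
  have s2: "s\<^sup>2 = 1 - exp (- 2 * t)" using t by (simp add: s_def)
  let ?R = "\<lambda>x. \<Phi> (\<lambda>h. c * W h (fst x) + s * W h (snd x))"
  have iR: "integrable M2 ?R" by (rule integrable_rotation[OF cs]) fact+
  have OU: "OU t \<Phi> = (\<lambda>w. \<integral>w'. ?R (w, w') \<partial>M)"
    by (simp add: OU_semigroup_def c_def s_def fun_eq_iff)
  show "integrable M (OU t \<Phi>)"
    unfolding OU by (rule MM.integrable_fst'[OF iR])
  have iRc: "integrable M2 (\<lambda>x. ?R x * cos (W k (fst x) + \<theta>))"
    using integrable_bounded_mult[OF iR, of "\<lambda>x. cos (W k (fst x) + \<theta>)" 1] by (simp add: mult.commute)
  have "(\<integral>w. OU t \<Phi> w * cos (W k w + \<theta>) \<partial>M) =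
      (\<integral>w. (\<integral>w'. ?R (w, w') * cos (W k w + \<theta>) \<partial>M) \<partial>M)"
    unfolding OU by simp
  also have "\<dots> = (\<integral>x. ?R x * cos (W k (fst x) + \<theta>) \<partial>M2)"
    using MM.integral_fst'[OF iRc] by simp
  also have "\<dots> = (\<integral>w. \<Phi> (path w) * (exp (- ((norm k)\<^sup>2 - (norm (c *\<^sub>R k))\<^sup>2) / 2) * cos (W (c *\<^sub>R k) w + \<theta>)) \<partial>M)"
    using cs
    by (intro W_pair_pairing[OF _ W_pair_AE _ _ _ _ _ iR int])
      (auto simp: power_mult_distrib linear_scale_self simp flip: distrib_right)
  also have "\<dots> = (\<integral>w. \<Phi> (path w) * (exp (- s\<^sup>2 * (norm k)\<^sup>2 / 2) * cos (c * W k w + \<theta>)) \<partial>M)"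
  proof -
    have "c\<^sup>2 = 1 - s\<^sup>2" using cs by simp
    then have "(norm k)\<^sup>2 - (norm (c *\<^sub>R k))\<^sup>2 = s\<^sup>2 * (norm k)\<^sup>2"
      by (simp add: power_mult_distrib left_diff_distrib)
    then show ?thesis using W_scale[of c k] by (intro integral_cong_AE) auto
  qed
  also have "\<dots> = (\<integral>w. exp (- s\<^sup>2 * (norm k)\<^sup>2 / 2) * (\<Phi> (path w) * cos (c * W k w + \<theta>)) \<partial>M)"
    by (simp add: ac_simps)
  also have "\<dots> = exp (- s\<^sup>2 * (norm k)\<^sup>2 / 2) * (\<integral>w. \<Phi> (path w) * cos (c * W k w + \<theta>) \<partial>M)"
    by simp
  finally show "(\<integral>w. OU t \<Phi> w * cos (W k w + \<theta>) \<partial>M)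
      = exp (- (1 - exp (- 2 * t)) * (norm k)\<^sup>2 / 2) * (\<integral>w. \<Phi> (path w) * cos (exp (- t) * W k w + \<theta>) \<partial>M)"
    unfolding s2 c_def .
qed

text \<open>Totality of the cosines among functionals of the path. \<open>Z\<close> itself may
  depend on more than the process, so the conclusion concerns only its pairing with functions of
  \<open>path w\<close>.\<close>

lemma W_total:
  assumes Z: "integrable M Z" and cos0: "\<And>k \<theta>. (\<integral>w. Z w * cos (W k w + \<theta>) \<partial>M) = 0"
    and \<Phi>: "\<Phi> \<in> borel_measurable \<Omega>" and int: "integrable M (\<lambda>w. \<Phi> (path w) * Z w)"
  shows "(\<integral>w. \<Phi> (path w) * Z w \<partial>M) = 0"
proof (rule signed_law_unique[OF Z W_measurable _ _ _ _ \<Phi> int,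
    where L = "{l. l \<in> borel_measurable M \<and> (\<exists>a. AE w in M. l w = W a w)}"])
  have [measurable]: "Z \<in> borel_measurable M" using Z by auto
  let ?L = "{l. l \<in> borel_measurable M \<and> (\<exists>a. AE w in M. l w = W a w)}"
  show "(\<lambda>_. 0) \<in> ?L" using W_zero by (auto intro!: exI[of _ 0])
  show "?L \<subseteq> borel_measurable M" by auto
  fix l assume "l \<in> ?L"
  then obtain a where [measurable]: "l \<in> borel_measurable M" and a: "AE w in M. l w = W a w" by auto
  show "(\<lambda>w. l w + s * W i w) \<in> ?L" for s i
  proof -
    have "AE x in M. l x + s * W i x = W (a + s *\<^sub>R i) x"
      using a W_add_scale[of a s i] by eventually_elim simp
    then show ?thesis by auto
  qed
  have "(\<integral>w. cos (l w + \<theta>) * Z w \<partial>M) = (\<integral>w. Z w * cos (W a w + \<theta>) \<partial>M)" for \<theta>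
    using a by (intro integral_cong_AE) auto
  then show "(\<integral>w. cos (l w + \<theta>) * Z w \<partial>M) = 0" for \<theta> using cos0 by simp
qed

end

subsection \<open>Injectivity of the generator\<close>

context isonormal_gaussian_process
begin

text \<open>Pairing with the constant 1 weakens mean square convergence to convergence in mean,
  which is enough because all later test functions are bounded cosines.\<close>

lemma has_OU_generatorE:
  assumes "has_OU_generator M W F LF"
  obtains \<Phi> where "\<Phi> \<in> borel_measurable \<Omega>" "AE w in M. F w = \<Phi> (path w)"
    "integrable M (\<lambda>w. \<Phi> (path w))" "integrable M F" "integrable M LF"
    "((\<lambda>t. \<integral>w. \<bar>(OU t \<Phi> w - F w) / t - LF w\<bar> \<partial>M) \<longlongrightarrow> 0) (at_right 0)"
    "((\<lambda>t. \<integral>w. (OU t \<Phi> w - F w) / t \<partial>M) \<longlongrightarrow> (\<integral>w. LF w \<partial>M)) (at_right 0)"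
proof -
  obtain \<Phi> where \<Phi>[measurable]: "\<Phi> \<in> borel_measurable \<Omega>" and F\<Phi>: "AE w in M. F w = \<Phi> (path w)"
    and L: "tendsto_L2 M (\<lambda>t w. (OU t \<Phi> w - F w) / t) LF (at_right 0)"
    and sq: "square_integrable M F" "square_integrable M LF"
    using assms unfolding has_OU_generator_def by auto
  have iF: "integrable M F" "integrable M LF"
    using square_integrable_imp_L1[OF finite_measure_axioms] sq by auto
  then have [measurable]: "F \<in> borel_measurable M" "LF \<in> borel_measurable M" by auto
  have i\<Phi>: "integrable M (\<lambda>w. \<Phi> (path w))"
    by (rule integrable_cong_AE_imp[OF iF(1) _ F\<Phi>]) measurable
  have OU: "integrable M (OU t \<Phi>)" if "t \<ge> 0" for t
    by (rule OU_semigroup_pairing[OF that \<Phi> i\<Phi>])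
  have pos: "eventually (\<lambda>t::real. t > 0) (at_right 0)" by (simp add: eventually_at_right_less)
  have X: "integrable M (\<lambda>w. (OU t \<Phi> w - F w) / t)" if "t > 0" for t
    using OU[of t] iF that by auto
  have m: "eventually (\<lambda>t. (\<lambda>w. (OU t \<Phi> w - F w) / t) \<in> borel_measurable M) (at_right 0)"
    using pos by eventually_elim (use X in auto)
  have i: "eventually (\<lambda>t. integrable M (\<lambda>w. (OU t \<Phi> w - F w) / t * 1)) (at_right 0)"
    using pos by eventually_elim (use X in auto)
  show thesis
    using tendsto_L2_pairing[OF L m, of "\<lambda>_. 1"] i iF by (intro that[OF \<Phi> F\<Phi> i\<Phi> iF]) auto
qed

text \<open>At the zero vector the symmetry says that the semigroup preserves means. All difference
  quotients therefore have mean 0, and so has their limit.\<close>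

lemma OU_generator_mean:
  assumes "has_OU_generator M W F LF"
  shows "expectation LF = 0"
proof -
  obtain \<Phi> where \<Phi>: "\<Phi> \<in> borel_measurable \<Omega>" and F\<Phi>: "AE w in M. F w = \<Phi> (path w)"
    and i: "integrable M (\<lambda>w. \<Phi> (path w))" "integrable M F" "integrable M LF"
    and L: "((\<lambda>t. \<integral>w. (OU t \<Phi> w - F w) / t \<partial>M) \<longlongrightarrow> (\<integral>w. LF w \<partial>M)) (at_right 0)"
    by (rule has_OU_generatorE[OF assms])
  have [measurable]: "F \<in> borel_measurable M" using i by auto
  note [measurable] = \<Phi>
  have FF: "expectation F = (\<integral>w. \<Phi> (path w) \<partial>M)"
    using F\<Phi> by (intro integral_cong_AE) auto
  have m: "(\<integral>w. OU t \<Phi> w \<partial>M) = expectation F" if "t \<ge> 0" for t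
  proof -
    have "(\<integral>w. OU t \<Phi> w * cos (W 0 w + 0) \<partial>M) = (\<integral>w. OU t \<Phi> w \<partial>M)"
      using W_zero OU_semigroup_pairing(1)[OF that \<Phi> i(1)] by (intro integral_cong_AE) auto
    moreover have "(\<integral>w. \<Phi> (path w) * cos (exp (- t) * W 0 w + 0) \<partial>M) = (\<integral>w. \<Phi> (path w) \<partial>M)"
      using W_zero by (intro integral_cong_AE) auto
    ultimately show ?thesis using OU_semigroup_pairing(2)[OF that \<Phi> i(1), of 0 0] FF by simp
  qed
  have "eventually (\<lambda>t. (\<integral>w. (OU t \<Phi> w - F w) / t \<partial>M) = 0) (at_right 0)"
    using eventually_at_right_less[of 0]
  proof eventually_elim
    case (elim t)
    then show ?case using m[of t] OU_semigroup_pairing(1)[OF _ \<Phi> i(1), of t] i by simp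
  qed
  then have "((\<lambda>t. \<integral>w. (OU t \<Phi> w - F w) / t \<partial>M) \<longlongrightarrow> 0) (at_right 0)"
    by (rule tendsto_eventually)
  from tendsto_unique[OF _ L this] show ?thesis by simp
qed

text \<open>
  Tested against \<open>cos (W k + \<theta>)\<close>, the semigroup becomes, up to an explicit factor, a shift of the parameter
  \<open>\<tau>\<close> of the function \<open>C\<close> below. So \<open>C\<close> has derivative zero, and its limit at infinity is a multiple of the mean.
\<close>

lemma OU_invariant_eq_0:
  assumes d[measurable]: "d \<in> borel_measurable \<Omega>" and id: "integrable M (\<lambda>w. d (path w))"
    and sq: "integrable M (\<lambda>w. d (path w) * d (path w))" and mean: "(\<integral>w. d (path w) \<partial>M) = 0"
    and r: "(r \<longlongrightarrow> 0) (at_right 0)"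
    and d_r: "\<And>\<delta>. \<delta> > 0 \<Longrightarrow> (\<integral>w. \<bar>OU \<delta> d w - d (path w)\<bar> \<partial>M) \<le> \<delta> * r \<delta>"
  shows "AE w in M. d (path w) = 0"
proof -
  have r0: "r \<delta> \<ge> 0" if "\<delta> > 0" for \<delta>
    using order_trans[OF _ d_r[OF that], of 0] that by (simp add: zero_le_mult_iff)
  have Z0: "(\<integral>w. d (path w) * cos (W k w + \<theta>) \<partial>M) = 0" for k \<theta>
  proof -
    \<comment> \<open>\<open>E\<close> absorbs the Gaussian factor of
      \<open>OU_semigroup_pairing\<close>: for the vector \<open>exp (- \<tau>) *\<^sub>R k\<close>
      and time \<open>\<delta>\<close> that factor times \<open>E \<tau>\<close> equals
      \<open>E (\<tau> + \<delta>)\<close>.\<close>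
    define E where "E \<tau> = exp (exp (- 2 * \<tau>) * (norm k)\<^sup>2 / 2)" for \<tau> :: real
    define C where "C \<tau> = E \<tau> * (\<integral>w. d (path w) * cos (exp (- \<tau>) * W k w + \<theta>) \<partial>M)" for \<tau>
    have step: "\<bar>C (\<tau> + \<delta>) - C \<tau>\<bar> \<le> E \<tau> * (\<delta> * r \<delta>)" if \<delta>: "\<delta> > 0" for \<tau> \<delta>
    proof -
      let ?c = "\<lambda>w. cos (exp (- \<tau>) * W k w + \<theta>)" and ?k = "exp (- \<tau>) *\<^sub>R k"
      define A where "A w = OU \<delta> d w" for w
      have c1: "\<bar>?c w\<bar> \<le> 1" for w by simp
      have iA: "integrable M A"
        unfolding A_def[abs_def] using OU_semigroup_pairing(1)[OF _ d id] \<delta> by simp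
      have ic: "integrable M (\<lambda>w. f w * ?c w)" if "integrable M f" for f
        using integrable_bounded_mult[OF that _ c1] by (simp add: mult.commute)
      have [measurable]: "A \<in> borel_measurable M" using iA by auto
      have "(\<integral>w. A w * ?c w \<partial>M) = (\<integral>w. A w * cos (W ?k w + \<theta>) \<partial>M)"
        using W_scale[of "exp (- \<tau>)" k] by (intro integral_cong_AE) auto
      also have "\<dots> = exp (- (1 - exp (- 2 * \<delta>)) * (norm ?k)\<^sup>2 / 2) *
          (\<integral>w. d (path w) * cos (exp (- \<delta>) * W ?k w + \<theta>) \<partial>M)"
        unfolding A_def using \<delta> by (intro OU_semigroup_pairing(2)[OF _ d id]) auto
      also have "(\<integral>w. d (path w) * cos (exp (- \<delta>) * W ?k w + \<theta>) \<partial>M) =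
          (\<integral>w. d (path w) * cos (exp (- (\<tau> + \<delta>)) * W k w + \<theta>) \<partial>M)"
        using W_scale[of "exp (- \<tau>)" k]
        by (intro integral_cong_AE) (auto simp: mult.assoc[symmetric] exp_add[symmetric] algebra_simps)
      finally have *: "(\<integral>w. A w * ?c w \<partial>M) = exp (- (1 - exp (- 2 * \<delta>)) * (norm ?k)\<^sup>2 / 2) *
          (\<integral>w. d (path w) * cos (exp (- (\<tau> + \<delta>)) * W k w + \<theta>) \<partial>M)" .
      have "exp (- 2 * \<tau>) = (exp (- \<tau>))\<^sup>2" "exp (- 2 * (\<tau> + \<delta>)) = (exp (- \<tau>))\<^sup>2 * exp (- 2 * \<delta>)"
        by (simp_all add: exp_double[symmetric] exp_add[symmetric])
      then have "E \<tau> * exp (- (1 - exp (- 2 * \<delta>)) * (norm ?k)\<^sup>2 / 2) = E (\<tau> + \<delta>)"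
        unfolding E_def exp_add[symmetric] by (simp add: power_mult_distrib algebra_simps diff_divide_distrib)
      then have "C (\<tau> + \<delta>) = E \<tau> * (\<integral>w. A w * ?c w \<partial>M)"
        unfolding * C_def by (simp flip: mult.assoc)
      then have diff: "C (\<tau> + \<delta>) - C \<tau> = E \<tau> * (\<integral>w. (A w - d (path w)) * ?c w \<partial>M)"
        using ic[OF iA] ic[OF id] by (simp add: C_def left_diff_distrib right_diff_distrib)
      have "\<bar>\<integral>w. (A w - d (path w)) * ?c w \<partial>M\<bar> \<le> (\<integral>w. \<bar>(A w - d (path w)) * ?c w\<bar> \<partial>M)"
        by (rule integral_abs_bound)
      also have "\<dots> \<le> (\<integral>w. \<bar>A w - d (path w)\<bar> \<partial>M)"
      proof (rule integral_mono)
        show "integrable M (\<lambda>w. \<bar>(A w - d (path w)) * ?c w\<bar>)" by (intro integrable_abs ic) (use iA id in simp)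
      qed (use iA id in \<open>auto simp: abs_mult intro!: mult_left_le\<close>)
      also have "\<dots> \<le> \<delta> * r \<delta>" unfolding A_def by (rule d_r[OF \<delta>])
      finally have "E \<tau> * \<bar>\<integral>w. (A w - d (path w)) * ?c w \<partial>M\<bar> \<le> E \<tau> * (\<delta> * r \<delta>)"
        by (rule mult_left_mono) (simp add: E_def)
      then show ?thesis unfolding diff abs_mult by (simp add: E_def)
    qed
    have der: "DERIV C \<tau> :> 0" for \<tau>
    proof -
      \<comment> \<open>\<open>E\<close> is nonincreasing, so its value at \<open>\<tau> - 1\<close>
        dominates it at the base points of all difference quotients with step below 1, including the
        left-hand ones, which start at \<open>\<tau> + h\<close>.\<close>
      define K where "K = E (\<tau> - 1)"
      have EK: "E (\<tau> - \<delta>) \<le> K" "E \<tau> \<le> K" if "0 \<le> \<delta>" "\<delta> \<le> 1" for \<delta>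
        unfolding K_def E_def using that by (auto intro!: mult_right_mono divide_right_mono)
      have nb: "\<bar>(C (\<tau> + h) - C \<tau>) / h\<bar> \<le> K * r \<bar>h\<bar>" if h: "h \<noteq> 0" "\<bar>h\<bar> < 1" for h
      proof (cases "h > 0")
        case True
        have "\<bar>C (\<tau> + h) - C \<tau>\<bar> \<le> E \<tau> * (h * r h)" by (rule step[OF True])
        also have "\<dots> \<le> K * (h * r h)" using EK(2)[of h] True h r0[of h] by (intro mult_right_mono) auto
        finally show ?thesis using True by (simp add: field_simps)
      next
        case False
        then have h': "- h > 0" using h by simp
        have "\<bar>C (\<tau> + h) - C \<tau>\<bar> = \<bar>C ((\<tau> + h) + (- h)) - C (\<tau> + h)\<bar>" by (simp add: abs_minus_commute)
        also have "\<dots> \<le> E (\<tau> + h) * (- h * r (- h))" by (rule step[OF h'])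
        also have "\<dots> \<le> K * (- h * r (- h))"
          using EK(1)[of "- h"] False h r0[of "- h"] h' by (intro mult_right_mono mult_nonneg_nonneg) auto
        finally show ?thesis using h' by (simp add: field_simps)
      qed
      have "filterlim (\<lambda>h::real. \<bar>h\<bar>) (at_right 0) (at 0)"
        unfolding filterlim_at by (auto intro!: tendsto_eq_intros simp: eventually_at_filter)
      then have "((\<lambda>h. K * r \<bar>h\<bar>) \<longlongrightarrow> K * 0) (at 0)"
        by (intro tendsto_mult tendsto_const filterlim_compose[OF r])
      then have lim: "((\<lambda>h. K * r \<bar>h\<bar>) \<longlongrightarrow> 0) (at 0)" by simp
      have "((\<lambda>h. (C (\<tau> + h) - C \<tau>) / h) \<longlongrightarrow> 0) (at 0)"
      proof (rule Lim_null_comparison[OF _ lim])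
        show "\<forall>\<^sub>F h in at 0. norm ((C (\<tau> + h) - C \<tau>) / h) \<le> K * r \<bar>h\<bar>"
          unfolding eventually_at by (intro exI[of _ 1]) (auto simp: nb simp del: abs_divide)
      qed
      then show ?thesis by (simp add: DERIV_def)
    qed
    have const: "C x = C y" for x y by (rule DERIV_isconst_all) (use der in auto)
    have "(\<lambda>n. C (real n)) \<longlonglongrightarrow> exp (0 * (norm k)\<^sup>2 / 2) * (\<integral>w. d (path w) * cos (0 * W k w + \<theta>) \<partial>M)"
    proof -
      have e0: "(\<lambda>n. exp (- real n)) \<longlonglongrightarrow> 0" by real_asymp
      have e2: "(\<lambda>n. exp (- 2 * real n)) \<longlonglongrightarrow> 0" by real_asymp
      show ?thesis unfolding C_def E_def
      proof (intro tendsto_mult tendsto_exp tendsto_divide tendsto_const e2)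
        show "(\<lambda>n. \<integral>w. d (path w) * cos (exp (- real n) * W k w + \<theta>) \<partial>M)
            \<longlonglongrightarrow> (\<integral>w. d (path w) * cos (0 * W k w + \<theta>) \<partial>M)"
        proof (rule integral_dominated_convergence)
          show "integrable M (\<lambda>w. \<bar>d (path w)\<bar>)" using id by simp
          show "AE w in M. (\<lambda>n. d (path w) * cos (exp (- real n) * W k w + \<theta>)) \<longlonglongrightarrow>
              d (path w) * cos (0 * W k w + \<theta>)"
            by (intro AE_I2 tendsto_intros e0)
          show "AE w in M. norm (d (path w) * cos (exp (- real n) * W k w + \<theta>)) \<le> \<bar>d (path w)\<bar>" for n
            by (auto simp: abs_mult intro!: mult_left_le)
        qed measurable
      qed simp
    qed
    moreover have "(\<integral>w. d (path w) * cos (0 * W k w + \<theta>) \<partial>M) = 0"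
      using mean by simp
    moreover have "(\<lambda>n. C (real n)) = (\<lambda>n. C 0)" using const[of _ 0] by auto
    ultimately have "(\<lambda>n. C 0) \<longlonglongrightarrow> 0" by (simp only: mult_zero_right)
    then have "C 0 = 0" by (simp only: LIMSEQ_const_iff)
    then show ?thesis by (simp add: C_def E_def)
  qed
  \<comment> \<open>Being a functional of the path, \<open>d (path w)\<close> may serve as its own
    test function in the totality statement.\<close>
  have "(\<integral>w. d (path w) * d (path w) \<partial>M) = 0"
    using W_total[OF id Z0 _ sq] by simp
  then have "AE w in M. d (path w) * d (path w) = 0"
    using sq by (subst (asm) integral_nonneg_eq_0_iff_AE) auto
  then show ?thesis by eventually_elim simp
qed

text \<open>For the difference \<open>d\<close> of the two factorizations the equal generator values
  cancel, so the semigroup moves \<open>d\<close> by \<open>o(\<delta>)\<close> in mean, which is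
  what \<open>OU_invariant_eq_0\<close> asks for. Equal means remove the remaining freedom of an
  additive constant.\<close>

lemma OU_generator_inj:
  assumes G: "has_OU_generator M W F LF" "has_OU_generator M W F' LF'"
    and LL: "AE w in M. LF w = LF' w" and EE: "expectation F = expectation F'"
  shows "AE w in M. F w = F' w"
proof -
  obtain \<Phi> where \<Phi>[measurable]: "\<Phi> \<in> borel_measurable \<Omega>" and F\<Phi>: "AE w in M. F w = \<Phi> (path w)"
    and i: "integrable M (\<lambda>w. \<Phi> (path w))" "integrable M F" "integrable M LF"
    and L: "((\<lambda>t. \<integral>w. \<bar>(OU t \<Phi> w - F w) / t - LF w\<bar> \<partial>M) \<longlongrightarrow> 0) (at_right 0)"
    by (rule has_OU_generatorE[OF G(1)])
  obtain \<Phi>' where \<Phi>'[measurable]: "\<Phi>' \<in> borel_measurable \<Omega>" and F\<Phi>': "AE w in M. F' w = \<Phi>' (path w)"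
    and i': "integrable M (\<lambda>w. \<Phi>' (path w))" "integrable M F'" "integrable M LF'"
    and L': "((\<lambda>t. \<integral>w. \<bar>(OU t \<Phi>' w - F' w) / t - LF' w\<bar> \<partial>M) \<longlongrightarrow> 0) (at_right 0)"
    by (rule has_OU_generatorE[OF G(2)])
  have [measurable]: "F \<in> borel_measurable M" "F' \<in> borel_measurable M"
    "LF \<in> borel_measurable M" "LF' \<in> borel_measurable M" using i i' by auto
  define d where "d \<omega> = \<Phi> \<omega> - \<Phi>' \<omega>" for \<omega>
  have [measurable]: "d \<in> borel_measurable \<Omega>" unfolding d_def[abs_def] by measurable
  define R where "R \<Psi> H LH \<delta> = (\<integral>w. \<bar>(OU \<delta> \<Psi> w - H w) / \<delta> - LH w\<bar> \<partial>M)" for \<Psi> H LH \<delta>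
  have "AE w in M. d (path w) = 0"
  proof (rule OU_invariant_eq_0)
    show "d \<in> borel_measurable \<Omega>" by measurable
    show "integrable M (\<lambda>w. d (path w))" unfolding d_def using i i' by auto
    have dF: "AE w in M. F w - F' w = d (path w)" using F\<Phi> F\<Phi>' by eventually_elim (simp add: d_def)
    have "integrable M (\<lambda>w. (F w - F' w)\<^sup>2)"
      using G square_integrable_diff[of M F F'] by (auto simp: has_OU_generator_def square_integrable_def)
    then show "integrable M (\<lambda>w. d (path w) * d (path w))"
      by (rule integrable_cong_AE_imp) (use dF in \<open>auto simp: power2_eq_square\<close>)
    have "(\<integral>w. d (path w) \<partial>M) = (\<integral>w. F w - F' w \<partial>M)"
      using dF by (intro integral_cong_AE) auto
    then show "(\<integral>w. d (path w) \<partial>M) = 0" using i i' EE by simp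
    show "((\<lambda>\<delta>. R \<Phi> F LF \<delta> + R \<Phi>' F' LF' \<delta>) \<longlongrightarrow> 0) (at_right 0)"
      unfolding R_def using tendsto_add[OF L L'] by simp
    fix \<delta> :: real assume \<delta>: "\<delta> > 0"
    define A A' where "A w = OU \<delta> \<Phi> w" and "A' w = OU \<delta> \<Phi>' w" for w
    have iA: "integrable M A" "integrable M A'"
      unfolding A_def[abs_def] A'_def[abs_def] using OU_semigroup_pairing(1) \<delta> i i' by auto
    have cs: "(exp (- \<delta>))\<^sup>2 + (sqrt (1 - exp (- 2 * \<delta>)))\<^sup>2 = 1" using OU_coeffs[of \<delta>] \<delta> by simp
    \<comment> \<open>Additivity of \<open>OU\<close> holds only almost everywhere: where an inner
      integral fails to exist, the Bochner integral has the default value 0. Fubini makes the set of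
      such points null.\<close>
    have AA: "AE w in M. OU \<delta> d w = A w - A' w"
      using MM.AE_integrable_fst'[OF integrable_rotation[OF cs \<Phi> i(1)]]
        MM.AE_integrable_fst'[OF integrable_rotation[OF cs \<Phi>' i'(1)]]
      by eventually_elim (simp add: A_def A'_def OU_semigroup_def d_def)
    have "(\<integral>w. \<bar>OU \<delta> d w - d (path w)\<bar> \<partial>M)
        \<le> (\<integral>w. \<delta> * (\<bar>(A w - F w) / \<delta> - LF w\<bar> + \<bar>(A' w - F' w) / \<delta> - LF' w\<bar>) \<partial>M)"
    proof (rule integral_mono_AE')
      show "AE w in M. \<bar>OU \<delta> d w - d (path w)\<bar>
          \<le> \<delta> * (\<bar>(A w - F w) / \<delta> - LF w\<bar> + \<bar>(A' w - F' w) / \<delta> - LF' w\<bar>)"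
        using LL AA dF
      proof eventually_elim
        case (elim w)
        have "OU \<delta> d w - d (path w) = (A w - F w) - (A' w - F' w)"
          using elim by simp
        also have "\<dots> = \<delta> * (((A w - F w) / \<delta> - LF w) - ((A' w - F' w) / \<delta> - LF' w))"
          using \<delta> elim(1) by (simp add: field_simps)
        finally have e: "OU \<delta> d w - d (path w) = \<dots>" .
        show ?case
          unfolding e abs_mult abs_of_pos[OF \<delta>] using \<delta> by (intro mult_left_mono abs_triangle_ineq4) simp
      qed
    qed (use i i' iA \<delta> in auto)
    also have "\<dots> = \<delta> * (R \<Phi> F LF \<delta> + R \<Phi>' F' LF' \<delta>)"
      unfolding R_def A_def[symmetric] A'_def[symmetric] using i i' iA by simp
    finally show "(\<integral>w. \<bar>OU \<delta> d w - d (path w)\<bar> \<partial>M) \<le> \<delta> * (R \<Phi> F LF \<delta> + R \<Phi>' F' LF' \<delta>)" .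
  qed
  then show ?thesis using F\<Phi> F\<Phi>' by eventually_elim (simp add: d_def)
qed

lemma OU_pseudo_inverse_unique:
  assumes "has_OU_pseudo_inverse M W F G" "has_OU_pseudo_inverse M W F G'"
  shows "AE w in M. G w = G' w"
proof -
  obtain L L' where L: "has_OU_generator M W G L" "AE w in M. - L w = F w"
    "has_OU_generator M W G' L'" "AE w in M. - L' w = F w"
    using assms by (auto simp: has_OU_pseudo_inverse_def)
  have "AE w in M. L w = L' w" using L(2,4) by eventually_elim simp
  then show ?thesis
    using assms by (intro OU_generator_inj[OF L(1,3)]) (auto simp: has_OU_pseudo_inverse_def)
qed

end

subsection \<open>Gaussian integration by parts\<close>

lemma std_normal_has_moments: "has_moments std_normal_distribution (\<lambda>x. x)"
  using integrable_std_normal_moment_abs by (auto simp: has_moments_def integrable_density)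

text \<open>The integrand is the derivative of the density times \<open>u\<close>, and this product
  vanishes at both ends because the density beats polynomial growth.\<close>

lemma gaussian_integration_by_parts:
  assumes u: "\<And>x. (u has_real_derivative u' x) (at x)" and u': "continuous_on UNIV u'"
    and g: "poly_growth UNIV (\<lambda>x. x) u" "poly_growth UNIV (\<lambda>x. x) u'"
  shows "(\<integral>x. std_normal_density x * (u' x - x * u x) \<partial>lborel) = 0"
proof -
  let ?n = std_normal_density
  have cu: "continuous_on UNIV u"
    using u by (intro continuous_at_imp_continuous_on) (auto intro: DERIV_isCont)
  obtain C m where C: "0 \<le> C" and Cu: "\<And>x. \<bar>u x\<bar> \<le> C * (1 + \<bar>x\<bar>) ^ m"
    using g(1) unfolding poly_growth_def by auto
  have [measurable]: "u \<in> borel_measurable borel" "u' \<in> borel_measurable borel"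
    using cu u' by (auto intro: borel_measurable_continuous_onI)
  have int: "integrable lborel (\<lambda>x. ?n x * (u' x - x * u x))"
  proof -
    interpret prob_space std_normal_distribution by (simp add: prob_space_normal_density)
    have "has_moments std_normal_distribution (\<lambda>x. u' x - x * u x)"
      by (rule poly_growth_has_moments[where X = "\<lambda>x. x" and b = "\<lambda>x. x" and f = "\<lambda>x. u' x - x * u x" and A = UNIV])
        (auto intro!: poly_growth_diff poly_growth_mult g poly_growth_gauge std_normal_has_moments)
    from has_moments_integrable[OF this] show ?thesis by (subst (asm) integrable_density) auto
  qed
  have der_n: "(?n has_real_derivative - x * ?n x) (at x)" for x
  proof -
    have "((\<lambda>x. exp (- x\<^sup>2 / 2)) has_real_derivative - x * exp (- x\<^sup>2 / 2)) (at x)"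
      by (auto intro!: derivative_eq_intros)
    from DERIV_cmult[OF this, of "1 / sqrt (2 * pi)"] show ?thesis
      unfolding std_normal_density_def by (simp add: algebra_simps)
  qed
  have der: "((\<lambda>x. ?n x * u x) has_vector_derivative ?n x * (u' x - x * u x)) (at x)" for x
    unfolding has_real_derivative_iff_has_vector_derivative[symmetric]
    by (rule DERIV_cong[OF DERIV_mult[OF der_n u]]) (simp add: algebra_simps)
  have cont: "continuous_on UNIV (\<lambda>x. ?n x * (u' x - x * u x))"
    using DERIV_isCont[OF der_n] cu u'
    by (intro continuous_intros) (auto intro: continuous_at_imp_continuous_on)
  have lim: "((\<lambda>x. ?n x * u x) \<longlongrightarrow> 0) F" if F: "filterlim (\<lambda>x. 1 + \<bar>x\<bar> :: real) at_top F" for F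
  proof (rule Lim_null_comparison)
    have "((\<lambda>x. C * exp (3/2) * ((1 + \<bar>x\<bar>) ^ m / exp (1 + \<bar>x\<bar>))) \<longlongrightarrow> C * exp (3/2) * 0) F"
      by (intro tendsto_mult tendsto_const filterlim_compose[OF tendsto_power_div_exp_0 F])
    then show "((\<lambda>x. C * exp (3/2) * ((1 + \<bar>x\<bar>) ^ m / exp (1 + \<bar>x\<bar>))) \<longlongrightarrow> 0) F" by simp
    show "eventually (\<lambda>x. norm (?n x * u x) \<le> C * exp (3/2) * ((1 + \<bar>x\<bar>) ^ m / exp (1 + \<bar>x\<bar>))) F"
    proof (intro always_eventually allI)
      fix x :: real
      \<comment> \<open>This square trades the Gaussian for an exponential of
        \<open>1 + \<bar>x\<bar>\<close>, the variable of the growth bound; it is also the origin of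
        the constant \<open>exp (3/2)\<close>.\<close>
      have "0 \<le> (\<bar>x\<bar> - 1)\<^sup>2" by simp
      then have "- x\<^sup>2 / 2 \<le> 3/2 - (1 + \<bar>x\<bar>)" by (simp add: power2_eq_square algebra_simps)
      then have "exp (- x\<^sup>2 / 2) \<le> exp (3/2 - (1 + \<bar>x\<bar>))" by simp
      moreover have "1 / sqrt (2 * pi) \<le> 1" using pi_gt3 by simp
      ultimately have "?n x \<le> 1 * exp (3/2 - (1 + \<bar>x\<bar>))"
        unfolding std_normal_density_def by (intro mult_mono) auto
      then have "?n x * \<bar>u x\<bar> \<le> (1 * exp (3/2 - (1 + \<bar>x\<bar>))) * (C * (1 + \<bar>x\<bar>) ^ m)"
        by (intro mult_mono Cu) auto
      also have "\<dots> = C * exp (3/2) * ((1 + \<bar>x\<bar>) ^ m / exp (1 + \<bar>x\<bar>))"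
        unfolding exp_diff by simp
      finally show "norm (?n x * u x) \<le> C * exp (3/2) * ((1 + \<bar>x\<bar>) ^ m / exp (1 + \<bar>x\<bar>))"
        by (simp add: abs_mult)
    qed
  qed
  have "(LBINT x=-\<infinity>..\<infinity>. ?n x * (u' x - x * u x)) = 0 - 0"
  proof (rule interval_integral_FTC_integrable)
    show "((\<lambda>x. ?n x * u x) has_vector_derivative ?n x * (u' x - x * u x)) (at x)" for x by (rule der)
    show "isCont (\<lambda>x. ?n x * (u' x - x * u x)) x" for x
      using cont by (simp add: continuous_on_eq_continuous_at)
    show "set_integrable lborel (einterval (- \<infinity>) \<infinity>) (\<lambda>x. ?n x * (u' x - x * u x))"
      using int by (simp add: set_integrable_def)
    have t: "filterlim (\<lambda>x. 1 + \<bar>x\<bar> :: real) at_top at_top" "filterlim (\<lambda>x. 1 + \<bar>x\<bar> :: real) at_top at_bot"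
      by real_asymp+
    show "(((\<lambda>x. ?n x * u x) \<circ> real_of_ereal) \<longlongrightarrow> 0) (at_right (- \<infinity>))"
      using lim[OF t(2)] by (simp add: ereal_tendsto_simps)
    show "(((\<lambda>x. ?n x * u x) \<circ> real_of_ereal) \<longlongrightarrow> 0) (at_left \<infinity>)"
      using lim[OF t(1)] by (simp add: ereal_tendsto_simps)
  qed simp
  then show ?thesis
    by (simp add: interval_lebesgue_integral_def set_lebesgue_integral_def)
qed

section \<open>Cylinder functions and their chain rule along lines\<close>

text \<open>A retraction of all sequences onto the carrier of the Euclidean space. Since
  \<open>smooth_poly_growth\<close> restricts \<open>\<phi>\<close> on that carrier only, every
  argument is passed through it.\<close>

definition trunc :: "nat \<Rightarrow> (nat \<Rightarrow> real) \<Rightarrow> nat \<Rightarrow> real" where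
  "trunc n x = (\<lambda>i. if i < n then x i else 0)"

lemma sample_trunc: "sample W n h w = trunc n (\<lambda>i. W (h i) w)"
  by (simp add: sample_def trunc_def)

lemma continuous_trunc:
  assumes "continuous_map (Euclidean_space n) euclideanreal \<psi>"
    and "\<And>i. continuous_on S (\<lambda>s. \<gamma> s i)"
  shows "continuous_on S (\<lambda>s. \<psi> (trunc n (\<gamma> s)))"
proof -
  have "continuous_map (top_of_set S) (product_topology (\<lambda>_. euclideanreal) UNIV) (\<lambda>s. trunc n (\<gamma> s))"
    unfolding continuous_map_componentwise_UNIV trunc_def using assms(2) by auto
  then have "continuous_map (top_of_set S) (Euclidean_space n) (\<lambda>s. trunc n (\<gamma> s))"
    unfolding Euclidean_space_def by (auto simp: continuous_map_in_subtopology trunc_def)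
  from continuous_map_compose[OF this assms(1)] show ?thesis
    by (simp add: o_def)
qed

lemma trunc_in_Euclidean_space: "trunc n x \<in> topspace (Euclidean_space n)"
  by (auto simp: topspace_Euclidean_space trunc_def)

lemma smooth_poly_growthD:
  assumes "smooth_poly_growth n \<phi>"
  shows "continuous_map (Euclidean_space n) euclideanreal \<phi>"
    and "i < n \<Longrightarrow> continuous_map (Euclidean_space n) euclideanreal (partial_deriv i \<phi>)"
    and "i < n \<Longrightarrow> ((\<lambda>s. \<phi> ((trunc n x)(i := s))) has_real_derivative partial_deriv i \<phi> (trunc n x)) (at (trunc n x i))"
    and "poly_growth UNIV (\<lambda>x. \<Sum>i<n. \<bar>x i\<bar>) (\<lambda>x. \<phi> (trunc n x))"
    and "i < n \<Longrightarrow> poly_growth UNIV (\<lambda>x. \<Sum>i<n. \<bar>x i\<bar>) (\<lambda>x. partial_deriv i \<phi> (trunc n x))"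
proof -
  have *: "continuous_map (Euclidean_space n) euclideanreal \<psi>"
    "\<forall>x \<in> topspace (Euclidean_space n). \<forall>i<n. (\<lambda>s. \<psi> (x(i := s))) differentiable (at (x i))"
    "poly_growth UNIV (\<lambda>x. \<Sum>i<n. \<bar>x i\<bar>) (\<lambda>x. \<psi> (trunc n x))"
    if "set \<alpha> \<subseteq> {..<n}" "\<psi> = foldr partial_deriv \<alpha> \<phi>" for \<alpha> \<psi>
  proof -
    from assms that show "continuous_map (Euclidean_space n) euclideanreal \<psi>"
      "\<forall>x \<in> topspace (Euclidean_space n). \<forall>i<n. (\<lambda>s. \<psi> (x(i := s))) differentiable (at (x i))"
      unfolding smooth_poly_growth_def Let_def by blast+
    from assms that obtain C k where C: "\<And>x. x \<in> topspace (Euclidean_space n) \<Longrightarrow> \<bar>\<psi> x\<bar> \<le> C * (1 + (\<Sum>i<n. \<bar>x i\<bar>)) ^ k"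
      unfolding smooth_poly_growth_def Let_def by blast
    have "C \<ge> 0" using C[OF trunc_in_Euclidean_space[of n "\<lambda>_. 0"]] by (auto simp: trunc_def intro: order_trans[OF abs_ge_zero])
    then show "poly_growth UNIV (\<lambda>x. \<Sum>i<n. \<bar>x i\<bar>) (\<lambda>x. \<psi> (trunc n x))"
      using C[OF trunc_in_Euclidean_space] by (intro poly_growthI[of C _ _ _ k]) (auto simp: trunc_def sum_nonneg abs_of_nonneg)
  qed
  note 0 = *[OF _ refl, of "[]", simplified] and 1 = *[OF _ refl, of "[i]", simplified]
  show "continuous_map (Euclidean_space n) euclideanreal \<phi>"
    "poly_growth UNIV (\<lambda>x. \<Sum>i<n. \<bar>x i\<bar>) (\<lambda>x. \<phi> (trunc n x))" by (rule 0)+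
  show "i < n \<Longrightarrow> continuous_map (Euclidean_space n) euclideanreal (partial_deriv i \<phi>)"
    "i < n \<Longrightarrow> poly_growth UNIV (\<lambda>x. \<Sum>i<n. \<bar>x i\<bar>) (\<lambda>x. partial_deriv i \<phi> (trunc n x))" using 1 by auto
  show "i < n \<Longrightarrow> ((\<lambda>s. \<phi> ((trunc n x)(i := s))) has_real_derivative partial_deriv i \<phi> (trunc n x)) (at (trunc n x i))"
    using 0(2) trunc_in_Euclidean_space[of n x] unfolding partial_deriv_def
    by (auto simp: DERIV_deriv_iff_real_differentiable)
qed

text \<open>Only coordinatewise differentiability and continuity of the partial derivatives are
  given, so the chain rule along a line is built by letting the coordinates move one by one: in
  \<open>z j y s\<close> the first \<open>j\<close> of them move and the others rest. The base point
  \<open>y\<close> is arbitrary because the next coordinate is moved by updating it.\<close>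

lemma smooth_poly_growth_directional_derivative:
  assumes \<phi>: "smooth_poly_growth n \<phi>"
  shows "((\<lambda>s. \<phi> (trunc n (\<lambda>i. x i + s * a i))) has_real_derivative
    (\<Sum>i<n. a i * partial_deriv i \<phi> (trunc n (\<lambda>i. x i + s * a i)))) (at s)"
proof -
  define z where "z j y s = (\<lambda>i. if i < j then y i + s * a i else y i)" for j and y :: "nat \<Rightarrow> real" and s
  have "((\<lambda>s. \<phi> (trunc n (z j y s))) has_real_derivative
      (\<Sum>i<j. a i * partial_deriv i \<phi> (trunc n (z j y s)))) (at s)" if "j \<le> n" for j y s
    using that
  proof (induction j arbitrary: y s)
    case 0 then show ?case by (simp add: z_def)
  next
    case (Suc j)
    then have j: "j < n" by simp
    \<comment> \<open>Two independent parameters: \<open>s\<close> moves the first \<open>j\<close>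
      coordinates and \<open>t\<close> moves coordinate \<open>j\<close>. The induction hypothesis
      differentiates in \<open>s\<close>, the partial derivative in \<open>t\<close>, and the line
      is the diagonal.\<close>
    define f where "f s t = \<phi> (trunc n (z j (y(j := y j + t * a j)) s))" for s t
    define ft where "ft s t = a j * partial_deriv j \<phi> (trunc n (z j (y(j := y j + t * a j)) s))" for s t
    have zz: "z j (y(j := y j + s * a j)) s = z (Suc j) y s" for s
      by (auto simp: z_def less_Suc_eq fun_eq_iff)
    have fs: "((\<lambda>s'. f s' t) has_derivative
        (\<lambda>h. (\<Sum>i<j. a i * partial_deriv i \<phi> (trunc n (z j (y(j := y j + t * a j)) s))) * h)) (at s within UNIV)" for t
      unfolding f_def using Suc by (auto simp: has_field_derivative_def)
    have ftd: "((\<lambda>t. f s t) has_derivative blinfun_apply (blinfun_scaleR_left (ft s t))) (at t within UNIV)" for s t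
    proof -
      let ?p = "trunc n (z j (y(j := y j + t * a j)) s)"
      have pj: "?p j = y j + t * a j" using j by (simp add: trunc_def z_def)
      have upd: "?p(j := y j + t' * a j) = trunc n (z j (y(j := y j + t' * a j)) s)" for t'
        using j by (auto simp: trunc_def z_def)
      have "((\<lambda>u. \<phi> (?p(j := u))) has_real_derivative partial_deriv j \<phi> ?p) (at (y j + t * a j))"
        using smooth_poly_growthD(3)[OF \<phi> j, of "z j (y(j := y j + t * a j)) s"] pj by simp
      then have "((\<lambda>t'. \<phi> (?p(j := y j + t' * a j))) has_real_derivative partial_deriv j \<phi> ?p * a j) (at t)"
        by (rule DERIV_chain2[where f = "\<lambda>u. \<phi> (?p(j := u))" and g = "\<lambda>t. y j + t * a j"])
          (auto intro!: derivative_eq_intros)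
      then have "((\<lambda>t. f s t) has_real_derivative ft s t) (at t)"
        unfolding upd f_def ft_def by (simp add: mult.commute)
      then show ?thesis
        by (simp add: has_field_derivative_def mult_commute_abs)
    qed
    \<comment> \<open>Joint differentiability follows from the two partial derivatives as soon as
      one of them is jointly continuous; here it is the one in the new parameter.\<close>
    have cont: "continuous (at (s, s) within UNIV \<times> UNIV) (\<lambda>(s, t). blinfun_scaleR_left (ft s t))"
    proof -
      have "continuous_on UNIV (\<lambda>p. partial_deriv j \<phi> (trunc n (z j (y(j := y j + snd p * a j)) (fst p))))"
      proof (rule continuous_trunc[OF smooth_poly_growthD(2)[OF \<phi> j]])
        show "continuous_on UNIV (\<lambda>p. z j (y(j := y j + snd p * a j)) (fst p) i)" for i
          by (cases "i < j"; cases "i = j") (auto simp: z_def intro!: continuous_intros)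
      qed
      then have "continuous_on UNIV (\<lambda>p. blinfun_scaleR_left (ft (fst p) (snd p)))"
        unfolding ft_def by (intro continuous_intros)
      then have "continuous_on UNIV (\<lambda>(s, t). blinfun_scaleR_left (ft s t))"
        by (simp add: case_prod_unfold)
      then show ?thesis by (metis UNIV_I UNIV_Times_UNIV continuous_on_eq_continuous_within)
    qed
    have "((\<lambda>(s, t). f s t) has_derivative
        (\<lambda>(h, k). (\<Sum>i<j. a i * partial_deriv i \<phi> (trunc n (z j (y(j := y j + s * a j)) s))) * h
          + blinfun_apply (blinfun_scaleR_left (ft s s)) k)) (at (s, s) within UNIV \<times> UNIV)"
      by (rule has_derivative_partialsI[OF fs ftd cont]) auto
    then have d: "((\<lambda>(s, t). f s t) has_derivative
        (\<lambda>(h, k). (\<Sum>i<j. a i * partial_deriv i \<phi> (trunc n (z j (y(j := y j + s * a j)) s))) * h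
          + k * ft s s)) (at (s, s))" by simp
    have "((\<lambda>s. (s, s)) has_derivative (\<lambda>h. (h, h))) (at s)"
      by (intro derivative_intros)
    from has_derivative_compose[OF this d]
    have "((\<lambda>s. f s s) has_derivative
        (\<lambda>h. (\<Sum>i<j. a i * partial_deriv i \<phi> (trunc n (z (Suc j) y s))) * h + h * ft s s)) (at s)"
      by (simp add: zz)
    then have "((\<lambda>s. f s s) has_real_derivative
        (\<Sum>i<Suc j. a i * partial_deriv i \<phi> (trunc n (z (Suc j) y s)))) (at s)"
      unfolding has_field_derivative_def
      by (rule has_derivative_eq_rhs) (simp add: ft_def zz algebra_simps fun_eq_iff)
    then show ?case by (simp add: f_def zz)
  qed
  from this[of n x s] show ?thesis
    by (simp add: z_def trunc_def cong: if_cong)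
qed

lemma (in prob_space) square_integrable_mult:
  fixes X Y :: "_ \<Rightarrow> real"
  assumes "square_integrable M X" "square_integrable M Y"
  shows "integrable M (\<lambda>w. X w * Y w)"
proof (rule Bochner_Integration.integrable_bound)
  show "integrable M (\<lambda>w. (norm (X w))\<^sup>2 + (norm (Y w))\<^sup>2)"
    using assms by (auto simp: square_integrable_def)
  show "(\<lambda>w. X w * Y w) \<in> borel_measurable M" using assms by (auto simp: square_integrable_def)
  have "\<bar>a * b\<bar> \<le> a\<^sup>2 + b\<^sup>2" for a b :: real
  proof -
    have "2 * (\<bar>a\<bar> * \<bar>b\<bar>) \<le> a\<^sup>2 + b\<^sup>2"
      using zero_le_power2[of "\<bar>a\<bar> - \<bar>b\<bar>"] unfolding power2_diff by simp
    moreover have "0 \<le> \<bar>a\<bar> * \<bar>b\<bar>" by simp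
    ultimately show ?thesis unfolding abs_mult by linarith
  qed
  then show "AE w in M. norm (X w * Y w) \<le> norm ((norm (X w))\<^sup>2 + (norm (Y w))\<^sup>2)" by auto
qed

lemma (in prob_space) tendsto_L2_weak:
  fixes X :: "nat \<Rightarrow> _ \<Rightarrow> real"
  assumes "tendsto_L2 M X Z sequentially" "\<And>j. square_integrable M (X j)" "square_integrable M Z" "square_integrable M B"
  shows "(\<lambda>j. \<integral>w. X j w * B w \<partial>M) \<longlonglongrightarrow> (\<integral>w. Z w * B w \<partial>M)"
  using assms square_integrable_mult[OF _ assms(4)]
  by (intro tendsto_L2_pairing(2)[OF assms(1)]) (auto simp: square_integrable_def)

lemma tendsto_L2_inner:
  fixes X :: "'i \<Rightarrow> 'w \<Rightarrow> 'h::{real_inner, banach, second_countable_topology}"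
  assumes "tendsto_L2 M X Z F" "norm h = 1"
  shows "tendsto_L2 M (\<lambda>i w. inner (X i w) h) (\<lambda>w. inner (Z w) h) F"
  unfolding tendsto_L2_def
proof (rule tendsto_sandwich[OF _ _ tendsto_const assms(1)[unfolded tendsto_L2_def]])
  have "\<bar>inner x h - inner y h\<bar>\<^sup>2 \<le> (norm (x - y))\<^sup>2" for x y :: 'h
    using Cauchy_Schwarz_ineq2[of "x - y" h] assms(2)
    by (intro power_mono) (auto simp: inner_diff_left)
  then show "\<forall>\<^sub>F i in F. (\<integral>\<^sup>+ w. ennreal ((norm (inner (X i w) h - inner (Z w) h))\<^sup>2) \<partial>M)
      \<le> (\<integral>\<^sup>+ w. ennreal ((norm (X i w - Z w))\<^sup>2) \<partial>M)"
    by (intro always_eventually allI nn_integral_mono ennreal_leI) simp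
qed simp

subsection \<open>Closability of the Malliavin derivative\<close>

lemma square_integrable_inner:
  fixes X :: "'w \<Rightarrow> 'h::{real_inner, banach, second_countable_topology}"
  assumes "square_integrable M X" "norm e = 1"
  shows "square_integrable M (\<lambda>w. inner (X w) e)"
proof -
  have m[measurable]: "X \<in> borel_measurable M" and i: "integrable M (\<lambda>w. (norm (X w))\<^sup>2)"
    using assms by (auto simp: square_integrable_def)
  have "integrable M (\<lambda>w. (norm (inner (X w) e))\<^sup>2)"
  proof (rule Bochner_Integration.integrable_bound[OF i])
    have "\<bar>inner x e\<bar>\<^sup>2 \<le> (norm x)\<^sup>2" for x :: 'h
      using Cauchy_Schwarz_ineq2[of x e] assms(2) by (intro power_mono) auto
    then show "AE w in M. norm ((norm (inner (X w) e))\<^sup>2) \<le> norm ((norm (X w))\<^sup>2)" by simp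
  qed measurable
  then show ?thesis by (simp add: square_integrable_def)
qed

context isonormal_gaussian_process
begin

lemma path_trunc_measurable:
  assumes "continuous_map (Euclidean_space n) euclideanreal \<psi>"
  shows "(\<lambda>\<omega>. \<psi> (trunc n (\<lambda>i. \<omega> (h i)))) \<in> borel_measurable \<Omega>"
proof -
  have "continuous_on UNIV (\<lambda>x. \<psi> (trunc n x))"
    using continuous_trunc[OF assms, of UNIV "\<lambda>x. x"] by simp
  then have "(\<lambda>x. \<psi> (trunc n x)) \<in> borel_measurable borel"
    by (rule borel_measurable_continuous_onI)
  \<comment> \<open>Countably many coordinates enter here, so the product and Borel sigma-algebras
    agree; over the index set of \<open>\<Omega>\<close> they need not.\<close>
  then have m: "(\<lambda>x. \<psi> (trunc n x)) \<in> borel_measurable (Pi\<^sub>M UNIV (\<lambda>_. borel))"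
    using sets_PiM_equal_borel measurable_cong_sets by blast
  have "(\<lambda>\<omega> i. \<omega> (h i)) \<in> measurable \<Omega> (Pi\<^sub>M UNIV (\<lambda>_. borel))"
    by (intro measurable_PiM_single') auto
  from measurable_compose[OF this m] show ?thesis .
qed

lemma sample_measurable:
  assumes "continuous_map (Euclidean_space n) euclideanreal \<psi>"
  shows "(\<lambda>w. \<psi> (sample W n h w)) \<in> borel_measurable M"
  using measurable_compose[OF path_measurable(1) path_trunc_measurable[OF assms, of h]]
  by (simp add: sample_trunc)

lemma growth_has_moments:
  assumes "continuous_map (Euclidean_space n) euclideanreal \<psi>"
    and "poly_growth UNIV (\<lambda>x. \<Sum>i<n. \<bar>x i\<bar>) (\<lambda>x. \<psi> (trunc n x))"
  shows "has_moments M (\<lambda>w. \<psi> (sample W n h w))"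
  using sample_measurable[OF assms(1), of h] unfolding sample_trunc
  by (intro poly_growth_has_moments[OF assms(2)] has_moments_sum has_moments_abs W_has_moments) auto

text \<open>The component along \<open>e\<close> is resampled from the second copy while the
  orthogonal part keeps the first. With the first copy frozen, all remaining randomness is the
  single standard normal variable \<open>W e (snd x)\<close>.\<close>

lemma orthogonal_split_law:
  assumes e: "norm e = 1"
  shows "distr M2 \<Omega> (\<lambda>x a. W (a - inner a e *\<^sub>R e) (fst x) + inner a e * W e (snd x)) = distr M \<Omega> path"
proof (rule W_pair_law)
  have ee: "inner e e = 1" using e by (simp add: power2_norm_eq_inner[symmetric])
  show "AE x in M2. W (a - inner a e *\<^sub>R e) (fst x) + inner a e * W e (snd x)
      = W (a - inner a e *\<^sub>R e) (fst x) + W (inner a e *\<^sub>R e) (snd x)" for a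
    using AE_fst_snd(2)[OF W_scale[of "inner a e" e]] by auto
  show "linear (\<lambda>a. a - inner a e *\<^sub>R e)" "linear (\<lambda>a. inner a e *\<^sub>R e)"
    by (auto intro!: linearI simp: inner_simps algebra_simps)
  show "(norm (a - inner a e *\<^sub>R e))\<^sup>2 + (norm (inner a e *\<^sub>R e))\<^sup>2 = (norm a)\<^sup>2" for a
    unfolding power2_norm_eq_inner by (simp add: inner_simps inner_commute[of e a] ee algebra_simps)
qed measurable

text \<open>Resampling the component along \<open>e\<close> makes the derivative in direction
  \<open>e\<close> an ordinary derivative in one standard normal variable, the other coordinates
  being frozen. The difference of the two integrands becomes \<open>u' x - x * u x\<close>, whose
  Gaussian mean is zero.\<close>

lemma cylindrical_integration_by_parts:
  assumes \<phi>: "smooth_poly_growth n \<phi>" and e: "norm e = 1"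
  shows "(\<integral>w. inner (\<Sum>i<n. partial_deriv i \<phi> (sample W n h w) *\<^sub>R h i) e * cos (W k w + \<theta>) \<partial>M)
    = (\<integral>w. \<phi> (sample W n h w) * (W e w * cos (W k w + \<theta>) + inner k e * sin (W k w + \<theta>)) \<partial>M)"
proof -
  have ee: "inner e e = 1" using e by (simp add: power2_norm_eq_inner[symmetric])
  define \<psi> where "\<psi> x = (\<Sum>i<n. inner (h i) e * partial_deriv i \<phi> x)" for x
  define T1 where "T1 \<omega> = \<psi> (trunc n (\<lambda>i. \<omega> (h i))) * cos (\<omega> k + \<theta>)" for \<omega>
  define T2 where "T2 \<omega> = \<phi> (trunc n (\<lambda>i. \<omega> (h i))) * (\<omega> e * cos (\<omega> k + \<theta>) + inner k e * sin (\<omega> k + \<theta>))" for \<omega>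
  have pm[measurable]: "(\<lambda>\<omega>. \<phi> (trunc n (\<lambda>i. \<omega> (h i)))) \<in> borel_measurable \<Omega>"
    by (rule path_trunc_measurable[OF smooth_poly_growthD(1)[OF \<phi>]])
  have [measurable]: "(\<lambda>\<omega>. \<psi> (trunc n (\<lambda>i. \<omega> (h i)))) \<in> borel_measurable \<Omega>"
    unfolding \<psi>_def
    by (intro borel_measurable_sum borel_measurable_times borel_measurable_const
        path_trunc_measurable[OF smooth_poly_growthD(2)[OF \<phi>]]) auto
  have m[measurable]: "T1 \<in> borel_measurable \<Omega>" "T2 \<in> borel_measurable \<Omega>"
    unfolding T1_def[abs_def] T2_def[abs_def] by measurable
  have hm: "has_moments M (\<lambda>w. \<phi> (sample W n h w))"
    by (rule growth_has_moments[OF smooth_poly_growthD(1)[OF \<phi>] smooth_poly_growthD(4)[OF \<phi>]])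
  have hm': "has_moments M (\<lambda>w. \<psi> (sample W n h w))"
    unfolding \<psi>_def
    by (intro has_moments_intros growth_has_moments[OF smooth_poly_growthD(2)[OF \<phi>] smooth_poly_growthD(5)[OF \<phi>]]) auto
  have bc: "has_moments M (\<lambda>w. cos (W k w + \<theta>))" "has_moments M (\<lambda>w. sin (W k w + \<theta>))"
    by (auto intro!: has_moments_bounded[of _ 1])
  have i1: "integrable M (\<lambda>w. T1 (path w))"
    unfolding T1_def sample_trunc[symmetric] by (intro has_moments_integrable has_moments_mult hm' bc)
  have i2: "integrable M (\<lambda>w. T2 (path w))"
    unfolding T2_def sample_trunc[symmetric]
    by (intro has_moments_integrable has_moments_intros hm bc W_has_moments)
  let ?V = "\<lambda>x a. W (a - inner a e *\<^sub>R e) (fst x) + inner a e * W e (snd x)"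
  have Vm[measurable]: "?V \<in> measurable M2 \<Omega>" by (intro measurable_PiM_single'; auto)
  define T where "T \<omega> = T1 \<omega> - T2 \<omega>" for \<omega>
  have [measurable]: "T \<in> borel_measurable \<Omega>" unfolding T_def[abs_def] by measurable
  have iT: "integrable M (\<lambda>w. T (path w))" unfolding T_def using i1 i2 by auto
  have "integrable (distr M \<Omega> path) T"
    using iT by (subst integrable_distr_eq) auto
  then have iV: "integrable M2 (\<lambda>x. T (?V x))"
    unfolding orthogonal_split_law[OF e, symmetric] by (subst (asm) integrable_distr_eq) auto
  have "(\<integral>w. T (path w) \<partial>M) = integral\<^sup>L (distr M \<Omega> path) T"
    by (subst integral_distr) auto
  also have "\<dots> = (\<integral>x. T (?V x) \<partial>M2)"
    unfolding orthogonal_split_law[OF e, symmetric] by (subst integral_distr) auto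
  also have "\<dots> = (\<integral>w. (\<integral>w'. T (?V (w, w')) \<partial>M) \<partial>M)"
    using MM.integral_fst'[OF iV] by simp
  also have "\<dots> = 0"
  proof (rule integral_eq_zero_AE)
    show "AE w in M. (\<integral>w'. T (?V (w, w')) \<partial>M) = 0"
      using W_zero
    proof eventually_elim
      case (elim w)
      define a where "a i = W (h i - inner (h i) e *\<^sub>R e) w" for i
      define b where "b = W (k - inner k e *\<^sub>R e) w + \<theta>"
      define c where "c i = inner (h i) e" for i
      define p where "p x = trunc n (\<lambda>i. a i + x * c i)" for x
      define u where "u x = \<phi> (p x) * cos (b + inner k e * x)" for x
      define u' where "u' x = \<psi> (p x) * cos (b + inner k e * x) - \<phi> (p x) * (inner k e * sin (b + inner k e * x))" for x
      \<comment> \<open>The orthogonal part of \<open>e\<close> is the zero vector, so outside the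
        null set where \<open>W 0\<close> is nonzero the resampled value of \<open>W e\<close> is
        exactly \<open>W e w'\<close>.\<close>
      have ce: "W (e - inner e e *\<^sub>R e) w = 0" using elim ee by simp
      have TV: "T (?V (w, w')) = u' (W e w') - W e w' * u (W e w')" for w'
        unfolding T_def T1_def T2_def fst_conv snd_conv ce
        by (simp add: u_def u'_def p_def a_def b_def c_def ee algebra_simps)
      have du: "(u has_real_derivative u' x) (at x)" for x
      proof -
        have "((\<lambda>x. \<phi> (p x)) has_real_derivative \<psi> (p x)) (at x)"
          unfolding p_def \<psi>_def c_def
          by (rule smooth_poly_growth_directional_derivative[OF \<phi>])
        then show ?thesis unfolding u_def[abs_def] u'_def
          by (auto intro!: derivative_eq_intros)
      qed
      have cp: "continuous_on UNIV (\<lambda>x. \<phi> (p x))"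
        unfolding p_def by (intro continuous_trunc[OF smooth_poly_growthD(1)[OF \<phi>]] continuous_intros)
      have cp': "continuous_on UNIV (\<lambda>x. \<psi> (p x))"
        unfolding p_def \<psi>_def
        by (intro continuous_intros continuous_trunc[OF smooth_poly_growthD(2)[OF \<phi>]]) auto
      have cu': "continuous_on UNIV u'" unfolding u'_def[abs_def]
        by (intro continuous_intros cp cp')
      have line: "poly_growth UNIV (\<lambda>x. x) (\<lambda>x. q (p x))"
        if "poly_growth UNIV (\<lambda>x. \<Sum>i<n. \<bar>x i\<bar>) (\<lambda>x. q (trunc n x))" for q
        unfolding p_def by (rule poly_growth_compose[OF that]) (auto intro!: poly_growth_intros poly_growth_gauge)
      have g: "poly_growth UNIV (\<lambda>x. x) (\<lambda>x. \<phi> (p x))" "poly_growth UNIV (\<lambda>x. x) (\<lambda>x. \<psi> (p x))"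
        unfolding \<psi>_def
        by (auto intro!: line smooth_poly_growthD[OF \<phi>] poly_growth_sum poly_growth_mult poly_growth_const)
      have gt: "poly_growth UNIV (\<lambda>x. x) (\<lambda>x. cos (b + inner k e * x))"
        "poly_growth UNIV (\<lambda>x. x) (\<lambda>x. sin (b + inner k e * x))"
        by (auto intro!: poly_growth_bounded[of _ _ 1])
      have gu: "poly_growth UNIV (\<lambda>x. x) u" "poly_growth UNIV (\<lambda>x. x) u'"
        unfolding u_def[abs_def] u'_def[abs_def]
        by (intro poly_growth_diff poly_growth_mult poly_growth_const g gt)+
      have cu: "continuous_on UNIV u"
        using du by (intro continuous_at_imp_continuous_on) (auto intro: DERIV_isCont)
      have [measurable]: "u \<in> borel_measurable borel" "u' \<in> borel_measurable borel"
        using cu cu' by (auto intro: borel_measurable_continuous_onI)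
      have "(\<integral>w'. T (?V (w, w')) \<partial>M) = (\<integral>w'. u' (W e w') - W e w' * u (W e w') \<partial>M)"
        unfolding TV ..
      also have "\<dots> = (\<integral>x. u' x - x * u x \<partial>(distr M borel (W e)))"
        by (rule integral_distr[symmetric]) measurable
      also have "\<dots> = (\<integral>x. std_normal_density x * (u' x - x * u x) \<partial>lborel)"
        unfolding W_std_normal[OF e] by (subst integral_density) auto
      also have "\<dots> = 0" by (rule gaussian_integration_by_parts[OF du cu' gu])
      finally show ?case .
    qed
  qed
  finally have "(\<integral>w. T1 (path w) \<partial>M) = (\<integral>w. T2 (path w) \<partial>M)"
    unfolding T_def using i1 i2 by simp
  moreover have "inner (\<Sum>i<n. partial_deriv i \<phi> (sample W n h w) *\<^sub>R h i) e = \<psi> (sample W n h w)" for w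
    unfolding \<psi>_def by (simp add: inner_sum_left mult.commute)
  ultimately show ?thesis
    unfolding T1_def T2_def sample_trunc by simp
qed

lemma cylindrical_derivative_properties:
  assumes "cylindrical_derivative W F X"
  shows "has_moments M F" and "X \<in> borel_measurable M"
    and "has_moments M (\<lambda>w. inner (X w) e)"
    and "\<exists>\<Psi>\<in>borel_measurable \<Omega>. \<forall>w. inner (X w) e = \<Psi> (path w)"
    and "norm e = 1 \<Longrightarrow> (\<integral>w. inner (X w) e * cos (W k w + \<theta>) \<partial>M)
      = (\<integral>w. F w * (W e w * cos (W k w + \<theta>) + inner k e * sin (W k w + \<theta>)) \<partial>M)"
proof -
  obtain n h \<phi> where \<phi>: "smooth_poly_growth n \<phi>" and F: "F = (\<lambda>w. \<phi> (sample W n h w))"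
    and X: "X = (\<lambda>w. \<Sum>i<n. partial_deriv i \<phi> (sample W n h w) *\<^sub>R h i)"
    using assms unfolding cylindrical_derivative_def by blast
  have Xe: "inner (X w) e = (\<Sum>i<n. inner (h i) e * partial_deriv i \<phi> (sample W n h w))" for w
    unfolding X by (simp add: inner_sum_left mult.commute)
  show "has_moments M F"
    unfolding F by (rule growth_has_moments[OF smooth_poly_growthD(1)[OF \<phi>] smooth_poly_growthD(4)[OF \<phi>]])
  show "X \<in> borel_measurable M"
    unfolding X
    by (intro borel_measurable_sum borel_measurable_scaleR borel_measurable_const
        sample_measurable[OF smooth_poly_growthD(2)[OF \<phi>]]) auto
  show "has_moments M (\<lambda>w. inner (X w) e)"
    unfolding Xe
    by (intro has_moments_intros growth_has_moments[OF smooth_poly_growthD(2)[OF \<phi>] smooth_poly_growthD(5)[OF \<phi>]]) auto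
  have "(\<lambda>\<omega>. \<Sum>i<n. inner (h i) e * partial_deriv i \<phi> (trunc n (\<lambda>i. \<omega> (h i)))) \<in> borel_measurable \<Omega>"
    by (intro borel_measurable_sum borel_measurable_times borel_measurable_const
        path_trunc_measurable[OF smooth_poly_growthD(2)[OF \<phi>]]) auto
  then show "\<exists>\<Psi>\<in>borel_measurable \<Omega>. \<forall>w. inner (X w) e = \<Psi> (path w)"
    unfolding Xe sample_trunc by (rule rev_bexI) simp
  show "norm e = 1 \<Longrightarrow> (\<integral>w. inner (X w) e * cos (W k w + \<theta>) \<partial>M)
      = (\<integral>w. F w * (W e w * cos (W k w + \<theta>) + inner k e * sin (W k w + \<theta>)) \<partial>M)"
    unfolding F X by (rule cylindrical_integration_by_parts[OF \<phi>])
qed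

text \<open>Both sides are continuous under mean square convergence, so the cylindrical formula
  passes to the closure. The weight on the right contains the unbounded variable \<open>W e\<close>,
  but it has all moments, and square integrability is all that the limit requires.\<close>

lemma malliavin_derivative_pairing:
  assumes "has_malliavin_derivative M W F X" and e: "norm e = 1"
  shows "(\<integral>w. inner (X w) e * cos (W k w + \<theta>) \<partial>M)
    = (\<integral>w. F w * (W e w * cos (W k w + \<theta>) + inner k e * sin (W k w + \<theta>)) \<partial>M)"
proof -
  obtain Fs Xs where c: "\<And>j. cylindrical_derivative W (Fs j) (Xs j)"
    and L: "tendsto_L2 M Fs F sequentially" "tendsto_L2 M Xs X sequentially"
    and sq: "square_integrable M F" "square_integrable M X"
    using assms unfolding has_malliavin_derivative_def by blast
  note cp = cylindrical_derivative_properties[OF c]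
  let ?B = "\<lambda>w. W e w * cos (W k w + \<theta>) + inner k e * sin (W k w + \<theta>)"
  let ?A = "\<lambda>w. cos (W k w + \<theta>)"
  have A: "has_moments M ?A" "has_moments M (\<lambda>w. sin (W k w + \<theta>))" by (auto intro!: has_moments_bounded[of _ 1])
  have B: "has_moments M ?B" by (intro has_moments_intros W_has_moments A)
  have "(\<lambda>j. \<integral>w. Fs j w * ?B w \<partial>M) \<longlonglongrightarrow> (\<integral>w. F w * ?B w \<partial>M)"
    by (intro tendsto_L2_weak L sq has_moments_square_integrable cp B)
  moreover have "(\<lambda>j. \<integral>w. inner (Xs j w) e * ?A w \<partial>M) \<longlonglongrightarrow> (\<integral>w. inner (X w) e * ?A w \<partial>M)"
    by (intro tendsto_L2_weak tendsto_L2_inner L e square_integrable_inner sq has_moments_square_integrable[OF A(1)]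
        has_moments_square_integrable[OF cp(3)])
  ultimately show ?thesis
    using cp(5)[OF e] LIMSEQ_unique by simp
qed

text \<open>The right-hand side of the pairing involves the functional but not its derivative, so
  the difference of two versions is orthogonal to every cosine in each unit direction. Allowing
  almost surely equal functionals makes the result applicable to two versions of a
  pseudo-inverse.\<close>

lemma malliavin_derivative_unique:
  assumes D: "has_malliavin_derivative M W F X" "has_malliavin_derivative M W F' X'"
    and FF: "AE w in M. F w = F' w"
  shows "AE w in M. X w = X' w"
proof -
  have sq: "square_integrable M X" "square_integrable M X'" "square_integrable M F" "square_integrable M F'"
    using D by (auto simp: has_malliavin_derivative_def)
  have [measurable]: "X \<in> borel_measurable M" "X' \<in> borel_measurable M"
    "F \<in> borel_measurable M" "F' \<in> borel_measurable M"
    using sq by (auto simp: square_integrable_def)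
  obtain Fs Xs where c: "\<And>j. cylindrical_derivative W (Fs j) (Xs j)" and L: "tendsto_L2 M Xs X sequentially"
    using D(1) unfolding has_malliavin_derivative_def by blast
  obtain Fs' Xs' where c': "\<And>j. cylindrical_derivative W (Fs' j) (Xs' j)" and L': "tendsto_L2 M Xs' X' sequentially"
    using D(2) unfolding has_malliavin_derivative_def by blast
  have unit: "AE w in M. inner (X w - X' w) e = 0" if e: "norm e = 1" for e
  proof -
    define Z where "Z w = inner (X w) e - inner (X' w) e" for w
    have sqZ: "square_integrable M Z"
      unfolding Z_def[abs_def] by (intro square_integrable_diff square_integrable_inner sq e)
    have iZ: "integrable M Z" by (rule square_integrable_imp_L1[OF finite_measure_axioms sqZ])
    have Z0: "(\<integral>w. Z w * cos (W k w + \<theta>) \<partial>M) = 0" for k \<theta>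
    proof -
      let ?A = "\<lambda>w. cos (W k w + \<theta>)"
      have A: "square_integrable M ?A" by (intro has_moments_square_integrable has_moments_bounded[of _ 1]) auto
      have "(\<integral>w. Z w * ?A w \<partial>M) = (\<integral>w. inner (X w) e * ?A w \<partial>M) - (\<integral>w. inner (X' w) e * ?A w \<partial>M)"
        unfolding Z_def left_diff_distrib
        by (intro Bochner_Integration.integral_diff square_integrable_mult square_integrable_inner sq e A)
      also have "\<dots> = 0"
        unfolding malliavin_derivative_pairing[OF D(1) e] malliavin_derivative_pairing[OF D(2) e]
        using FF by (subst integral_cong_AE[of _ _ "\<lambda>w. F' w * (W e w * cos (W k w + \<theta>) + inner k e * sin (W k w + \<theta>))"]) auto
      finally show ?thesis .
    qed
    \<comment> \<open>\<open>Z\<close> is not known to factor through the path, so totality cannot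
      be applied with \<open>Z\<close> as its own test function. The cylindrical approximants do
      factor; orthogonality to them survives the limit and then reaches \<open>X\<close> and
      \<open>X'\<close>.\<close>
    have orth: "(\<integral>w. inner (V w) e * Z w \<partial>M) = 0"
      if V: "\<And>j. cylindrical_derivative W (Hs j) (Vs j)" "tendsto_L2 M Vs V sequentially" "square_integrable M V" for V Hs Vs
    proof -
      note cV = cylindrical_derivative_properties[OF V(1)]
      have sVs: "square_integrable M (\<lambda>w. inner (Vs j w) e)" for j
        by (rule has_moments_square_integrable[OF cV(3)])
      have iVs: "integrable M (\<lambda>w. inner (Vs j w) e * Z w)" for j
        by (rule square_integrable_mult[OF sVs sqZ])
      have "(\<lambda>j. \<integral>w. inner (Vs j w) e * Z w \<partial>M) \<longlonglongrightarrow> (\<integral>w. inner (V w) e * Z w \<partial>M)"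
        by (rule tendsto_L2_weak[OF tendsto_L2_inner[OF V(2) e] sVs square_integrable_inner[OF V(3) e] sqZ])
      moreover have "(\<integral>w. inner (Vs j w) e * Z w \<partial>M) = 0" for j
      proof -
        obtain Q where Q: "Q \<in> borel_measurable \<Omega>" "\<And>w. inner (Vs j w) e = Q (path w)" using cV(4) by blast
        show ?thesis using W_total[OF iZ Z0 Q(1)] iVs[of j] unfolding Q(2) by simp
      qed
      ultimately show ?thesis by (simp add: LIMSEQ_const_iff)
    qed
    have ZZ: "Z w * Z w = inner (X w) e * Z w - inner (X' w) e * Z w" for w
      by (simp add: Z_def algebra_simps)
    have "(\<integral>w. Z w * Z w \<partial>M) = (\<integral>w. inner (X w) e * Z w \<partial>M) - (\<integral>w. inner (X' w) e * Z w \<partial>M)"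
      unfolding ZZ
      by (intro Bochner_Integration.integral_diff square_integrable_mult square_integrable_inner sq e sqZ)
    also have "\<dots> = 0" using orth[OF c L sq(1)] orth[OF c' L' sq(2)] by simp
    finally have "AE w in M. Z w * Z w = 0"
      using square_integrable_mult[OF sqZ sqZ] by (subst (asm) integral_nonneg_eq_0_iff_AE) auto
    then show ?thesis by eventually_elim (simp add: Z_def inner_diff_left)
  qed
  have all: "AE w in M. inner (X w - X' w) a = 0" for a
  proof (cases "a = 0")
    case False
    have "AE w in M. inner (X w - X' w) (a /\<^sub>R norm a) = 0" by (rule unit) (use False in simp)
    then show ?thesis by eventually_elim (use False in simp)
  qed simp
  \<comment> \<open>The null set of \<open>all\<close> depends on the direction. Separability
    reduces to countably many directions, and the vectors orthogonal to \<open>X w - X' w\<close>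
    form a closed set, so they are everything.\<close>
  obtain B :: "'h set" where B: "countable B" "\<And>S. open S \<Longrightarrow> S \<noteq> {} \<Longrightarrow> \<exists>d\<in>B. d \<in> S"
    using countable_dense_setE by blast
  have "AE w in M. \<forall>b\<in>B. inner (X w - X' w) b = 0"
    by (intro AE_ball_countable[THEN iffD2] B(1) ballI all)
  then show ?thesis
  proof eventually_elim
    case (elim w)
    have "closed {b. inner (X w - X' w) b = 0}" by (intro closed_Collect_eq continuous_intros)
    then have "open (- {b. inner (X w - X' w) b = 0})" by (simp add: open_closed)
    then have "- {b. inner (X w - X' w) b = 0} = {}" using B(2) elim by blast
    then have "inner (X w - X' w) (X w - X' w) = 0" by blast
    then show ?case by simp
  qed
qed

end

subsection \<open>Smooth radial functions\<close>

text \<open>Only the growth on the half line matters: the argument will be half a squared norm.\<close>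

coinductive smooth_growth :: "(real \<Rightarrow> real) \<Rightarrow> bool" where
  smooth_growthI: "poly_growth {0..} (\<lambda>x. x) f \<Longrightarrow> (\<And>x. (f has_real_derivative f' x) (at x)) \<Longrightarrow>
    smooth_growth f' \<Longrightarrow> smooth_growth f"

lemma smooth_growth_bound: "smooth_growth f \<Longrightarrow> poly_growth {0..} (\<lambda>x. x) f"
  by (erule smooth_growth.cases) simp

lemma smooth_growth_has_deriv:
  "smooth_growth f \<Longrightarrow> \<exists>f'. smooth_growth f' \<and> (\<forall>x. (f has_real_derivative f' x) (at x))"
  by (erule smooth_growth.cases) blast

lemma smooth_growth_deriv:
  assumes "smooth_growth f" "\<And>x. (f has_real_derivative f' x) (at x)"
  shows "smooth_growth f'"
proof -
  obtain g where g: "smooth_growth g" "\<And>x. (f has_real_derivative g x) (at x)"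
    using smooth_growth_has_deriv[OF assms(1)] by blast
  have "f' = g" by (rule ext) (rule DERIV_unique[OF assms(2) g(2)])
  with g(1) show ?thesis by simp
qed

lemma smooth_growth_continuous: "smooth_growth f \<Longrightarrow> continuous_on S f"
  using smooth_growth_has_deriv[of f] by (meson DERIV_isCont continuous_at_imp_continuous_on)

lemma smooth_growth_measurable: "smooth_growth f \<Longrightarrow> f \<in> borel_measurable borel"
  by (intro borel_measurable_continuous_onI smooth_growth_continuous)

text \<open>An inductive closure serves as the coinduction invariant: every member has polynomial
  growth and a derivative in the class. Taking \<open>smooth_growth\<close> as a base case yields
  sums and products for that predicate as well, and the free phase of the sine makes cosines
  members.\<close>

inductive smooth_alg :: "(real \<Rightarrow> real) \<Rightarrow> bool" where
  base: "smooth_growth f \<Longrightarrow> smooth_alg f"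
| const: "smooth_alg (\<lambda>_. c)"
| exp: "smooth_alg (\<lambda>x. exp (- x))"
| sin: "smooth_alg (\<lambda>x. sin (c * exp (- x) + \<theta>))"
| add: "smooth_alg f \<Longrightarrow> smooth_alg g \<Longrightarrow> smooth_alg (\<lambda>x. f x + g x)"
| mult: "smooth_alg f \<Longrightarrow> smooth_alg g \<Longrightarrow> smooth_alg (\<lambda>x. f x * g x)"

lemma smooth_alg_growth: "smooth_alg f \<Longrightarrow> poly_growth {0..} (\<lambda>x. x) f"
  by (induction rule: smooth_alg.induct)
    (auto intro: smooth_growth_bound poly_growth_const poly_growth_add poly_growth_mult poly_growth_bounded[of _ _ 1])

lemma smooth_alg_deriv:
  "smooth_alg f \<Longrightarrow> \<exists>f'. smooth_alg f' \<and> (\<forall>x. (f has_real_derivative f' x) (at x))"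
proof (induction rule: smooth_alg.induct)
  case (base f) then show ?case using smooth_growth_has_deriv smooth_alg.base by blast
next
  case (const c)
  show ?case by (intro exI[of _ "\<lambda>_. 0"]) (auto intro: smooth_alg.const)
next
  case exp
  have "smooth_alg (\<lambda>x. (-1) * exp (- x))" by (intro smooth_alg.mult smooth_alg.const smooth_alg.exp)
  moreover have "((\<lambda>x. exp (- x)) has_real_derivative (-1) * exp (- x)) (at x)" for x :: real
    by (auto intro!: derivative_eq_intros)
  ultimately show ?case by blast
next
  case (sin c \<theta>)
  have "smooth_alg (\<lambda>x. (- c) * (exp (- x) * sin (c * exp (- x) + (\<theta> + pi / 2))))"
    by (intro smooth_alg.mult smooth_alg.const smooth_alg.exp smooth_alg.sin)
  moreover have "((\<lambda>x. sin (c * exp (- x) + \<theta>)) has_real_derivative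
      (- c) * (exp (- x) * sin (c * exp (- x) + (\<theta> + pi / 2)))) (at x)" for x :: real
    by (auto intro!: derivative_eq_intros simp: sin_add cos_add algebra_simps)
  ultimately show ?case by blast
next
  case (add f g)
  then obtain f' g' where "smooth_alg f'" "smooth_alg g'" "\<And>x. (f has_real_derivative f' x) (at x)"
    "\<And>x. (g has_real_derivative g' x) (at x)" by blast
  then show ?case by (intro exI[of _ "\<lambda>x. f' x + g' x"]) (auto intro: smooth_alg.add DERIV_add)
next
  case (mult f g)
  then obtain f' g' where *: "smooth_alg f'" "smooth_alg g'" "\<And>x. (f has_real_derivative f' x) (at x)"
    "\<And>x. (g has_real_derivative g' x) (at x)" by blast
  then have "smooth_alg (\<lambda>x. f' x * g x + g' x * f x)" using mult.hyps by (intro smooth_alg.add smooth_alg.mult)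
  moreover have "((\<lambda>x. f x * g x) has_real_derivative f' x * g x + g' x * f x) (at x)" for x
    using * by (auto intro: DERIV_mult)
  ultimately show ?case by blast
qed

lemma smooth_alg_imp_smooth_growth: "smooth_alg f \<Longrightarrow> smooth_growth f"
proof (coinduction arbitrary: f rule: smooth_growth.coinduct)
  case smooth_growth
  then show ?case using smooth_alg_growth smooth_alg_deriv by blast
qed

lemma smooth_growth_const: "smooth_growth (\<lambda>_. c)"
  by (rule smooth_alg_imp_smooth_growth[OF smooth_alg.const])

lemma smooth_growth_sin: "smooth_growth (\<lambda>x. sin (c * exp (- x)))"
  using smooth_alg_imp_smooth_growth[OF smooth_alg.sin[of c 0]] by simp

lemma smooth_growth_add: "smooth_growth f \<Longrightarrow> smooth_growth g \<Longrightarrow> smooth_growth (\<lambda>x. f x + g x)"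
  by (rule smooth_alg_imp_smooth_growth) (rule smooth_alg.add[OF smooth_alg.base smooth_alg.base])

lemma smooth_growth_cmult: "smooth_growth f \<Longrightarrow> smooth_growth (\<lambda>x. c * f x)"
  by (rule smooth_alg_imp_smooth_growth) (rule smooth_alg.mult[OF smooth_alg.const smooth_alg.base])

lemma smooth_growth_diff: "smooth_growth f \<Longrightarrow> smooth_growth g \<Longrightarrow> smooth_growth (\<lambda>x. f x - g x)"
  using smooth_growth_add[OF _ smooth_growth_cmult[of g "-1"], of f] by simp

lemma smooth_growth_sum: "(\<And>i. i \<in> A \<Longrightarrow> smooth_growth (f i)) \<Longrightarrow> smooth_growth (\<lambda>x. \<Sum>i\<in>A. f i x)"
  by (induction A rule: infinite_finite_induct) (auto intro: smooth_growth_const smooth_growth_add)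

section \<open>Averages along segments, division by the variable and antiderivatives\<close>

text \<open>The integral form of Hadamard's quotient. The weight is present because each
  differentiation under the integral sign brings out one more factor \<open>\<tau>\<close>.\<close>

definition avg :: "nat \<Rightarrow> (real \<Rightarrow> real) \<Rightarrow> real \<Rightarrow> real" where
  "avg n k x = integral {0..1} (\<lambda>\<tau>. \<tau> ^ n * k (x * \<tau>))"

lemma avg_continuous_integrand:
  fixes k :: "real \<Rightarrow> real"
  assumes "continuous_on UNIV k"
  shows "continuous_on S (\<lambda>\<tau>. \<tau> ^ n * k (x * \<tau>))"
proof -
  have "continuous_on S (\<lambda>\<tau>. k (x * \<tau>))"
    by (rule continuous_on_compose2[OF assms]) (auto intro!: continuous_intros)
  then show ?thesis by (intro continuous_on_mult continuous_on_power continuous_on_id)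
qed

lemma avg_deriv:
  assumes k: "\<And>x. (k has_real_derivative k' x) (at x)" and k': "continuous_on UNIV k'"
  shows "(avg n k has_real_derivative avg (Suc n) k' x) (at x)"
proof -
  have ck: "continuous_on UNIV k"
    using k by (meson DERIV_isCont continuous_at_imp_continuous_on)
  have "((\<lambda>x. integral (cbox 0 1) (\<lambda>\<tau>. \<tau> ^ n * k (x * \<tau>))) has_real_derivative
      integral (cbox 0 1) (\<lambda>\<tau>. \<tau> ^ Suc n * k' (x * \<tau>))) (at x within UNIV)"
  proof (rule leibniz_rule_field_derivative)
    show "((\<lambda>x. t ^ n * k (x * t)) has_real_derivative t ^ Suc n * k' (x * t)) (at x within UNIV)" for x t
    proof -
      have "((\<lambda>x. k (x * t)) has_real_derivative k' (x * t) * t) (at x)"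
        by (rule DERIV_chain2[OF k]) (auto intro!: derivative_eq_intros)
      from DERIV_cmult[OF this, of "t ^ n"] show ?thesis by (simp add: algebra_simps)
    qed
    show "(\<lambda>\<tau>. \<tau> ^ n * k (x * \<tau>)) integrable_on cbox 0 1" for x
      by (intro integrable_continuous avg_continuous_integrand ck)
    have "continuous_on (UNIV \<times> cbox 0 1) (\<lambda>p::real \<times> real. k' (fst p * snd p))"
      by (rule continuous_on_compose2[OF k']) (auto intro!: continuous_intros)
    then show "continuous_on (UNIV \<times> cbox 0 1) (\<lambda>(x, t). t ^ Suc n * k' (x * t))"
      unfolding case_prod_unfold
      by (intro continuous_on_mult continuous_on_power continuous_on_snd continuous_on_id)
  qed auto
  then show ?thesis by (simp add: avg_def[abs_def])
qed

lemma avg_growth: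
  assumes g: "poly_growth {0..} (\<lambda>x. x) k" and k: "continuous_on UNIV k"
  shows "poly_growth {0..} (\<lambda>x. x) (avg n k)"
proof -
  obtain C m where C: "0 \<le> C" "\<And>x. 0 \<le> x \<Longrightarrow> \<bar>k x\<bar> \<le> C * (1 + x) ^ m"
    using g unfolding poly_growth_def by auto
  show ?thesis
  proof (rule poly_growthI[OF C(1)])
    fix x :: real assume "x \<in> {0..}"
    then have x: "x \<ge> 0" by simp
    have "norm (integral (cbox 0 1) (\<lambda>\<tau>. \<tau> ^ n * k (x * \<tau>))) \<le> C * (1 + x) ^ m * measure lborel (cbox 0 (1::real))"
    proof (rule integrable_bound)
      show "(\<lambda>\<tau>. \<tau> ^ n * k (x * \<tau>)) integrable_on cbox 0 1"
        by (intro integrable_continuous avg_continuous_integrand k)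
      show "0 \<le> C * (1 + x) ^ m" using C x by simp
      fix \<tau> :: real assume \<tau>: "\<tau> \<in> cbox 0 1"
      have "\<bar>k (x * \<tau>)\<bar> \<le> C * (1 + x * \<tau>) ^ m" using \<tau> x by (intro C) auto
      also have "\<dots> \<le> C * (1 + x) ^ m"
        using \<tau> x C by (intro mult_left_mono power_mono) (auto simp: mult_left_le)
      finally have "\<bar>\<tau>\<bar> ^ n * \<bar>k (x * \<tau>)\<bar> \<le> 1 * (C * (1 + x) ^ m)"
        using \<tau> by (intro mult_mono power_le_one) auto
      then show "norm (\<tau> ^ n * k (x * \<tau>)) \<le> C * (1 + x) ^ m" by (simp add: abs_mult power_abs)
    qed
    then show "\<bar>avg n k x\<bar> \<le> C * (1 + \<bar>x\<bar>) ^ m" using x by (simp add: avg_def)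
  qed
qed

text \<open>Differentiation raises \<open>n\<close> by one and replaces \<open>k\<close> by its
  derivative, so the family of all such averages is stable; hence the coinduction over both
  parameters.\<close>

lemma smooth_growth_avg: "smooth_growth k \<Longrightarrow> smooth_growth (avg n k)"
proof (coinduction arbitrary: k n rule: smooth_growth.coinduct)
  case smooth_growth
  then obtain k' where k': "smooth_growth k'" "\<And>x. (k has_real_derivative k' x) (at x)"
    using smooth_growth_has_deriv by blast
  have "poly_growth {0..} (\<lambda>x. x) (avg n k)"
    by (intro avg_growth smooth_growth_bound smooth_growth_continuous smooth_growth)
  moreover have "(avg n k has_real_derivative avg (Suc n) k' x) (at x)" for x
    by (rule avg_deriv[OF k'(2) smooth_growth_continuous[OF k'(1)]])
  ultimately show ?case using k'(1) by blast
qed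

lemma integral_unit_interval:
  fixes F f :: "real \<Rightarrow> real"
  assumes "\<And>t. (F has_real_derivative f t) (at t)"
  shows "integral {0..1} f = F 1 - F 0"
  using assms
  by (intro integral_unique fundamental_theorem_of_calculus)
    (auto simp: has_real_derivative_iff_has_vector_derivative[symmetric] intro: has_field_derivative_at_within)

lemma DERIV_scaled:
  fixes k :: "real \<Rightarrow> real"
  assumes "\<And>x. (k has_real_derivative k' x) (at x)"
  shows "((\<lambda>t. k (x * t)) has_real_derivative x * k' (x * t)) (at t)"
proof -
  have "((\<lambda>t. x * t) has_real_derivative x) (at t)" by (auto intro!: derivative_eq_intros)
  from DERIV_chain2[OF assms this] show ?thesis by (simp add: mult.commute)
qed

text \<open>Hadamard's lemma: when \<open>k\<close> vanishes at 0, division by \<open>x\<close>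
  leaves a function that is regular at 0.\<close>

lemma avg_FTC:
  assumes "\<And>x. (k has_real_derivative k' x) (at x)"
  shows "x * avg 0 k' x = k x - k 0"
  using integral_unit_interval[OF DERIV_scaled[OF assms], of x] by (simp add: avg_def flip: integral_mult_right)

text \<open>Integrating the derivative of \<open>\<tau> * k (x * \<tau>)\<close> over the unit
  interval gives \<open>k x = avg 0 k x + x * avg 1 k' x\<close>, and the right-hand side is the
  derivative sought. Written this way the antiderivative needs no case split on the sign of
  \<open>x\<close> and inherits the growth of \<open>k\<close>.\<close>

lemma antiderivative_avg:
  assumes k: "\<And>x. (k has_real_derivative k' x) (at x)" and k': "continuous_on UNIV k'"
  shows "((\<lambda>x. x * avg 0 k x) has_real_derivative k x) (at x)"
proof -
  have ck: "continuous_on UNIV k"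
    using k by (meson DERIV_isCont continuous_at_imp_continuous_on)
  have "integral {0..1} (\<lambda>\<tau>. k (x * \<tau>) + x * (\<tau> * k' (x * \<tau>))) = 1 * k (x * 1) - 0 * k (x * 0)"
    by (rule integral_unit_interval, rule DERIV_cong[OF DERIV_mult[OF DERIV_ident DERIV_scaled[OF k]]])
      (simp add: algebra_simps)
  moreover have "integral {0..1} (\<lambda>\<tau>. k (x * \<tau>) + x * (\<tau> * k' (x * \<tau>))) = avg 0 k x + x * avg 1 k' x"
  proof -
    have "(\<lambda>\<tau>. k (x * \<tau>)) integrable_on {0..1}" "(\<lambda>\<tau>. \<tau> * k' (x * \<tau>)) integrable_on {0..1}"
      using avg_continuous_integrand[OF ck, of "{0..1}" 0 x] avg_continuous_integrand[OF k', of "{0..1}" 1 x]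
      by (auto intro: integrable_continuous_real)
    then show ?thesis
      by (subst Henstock_Kurzweil_Integration.integral_add) (auto simp: avg_def intro: integrable_on_mult_right)
  qed
  ultimately have e: "k x = avg 0 k x + x * avg 1 k' x" by simp
  have "((\<lambda>x. x * avg 0 k x) has_real_derivative 1 * avg 0 k x + avg (Suc 0) k' x * x) (at x)"
    by (rule DERIV_mult[OF DERIV_ident avg_deriv[OF assms]])
  then show ?thesis using e by (simp add: algebra_simps)
qed

lemma smooth_growth_antiderivative:
  assumes "smooth_growth k"
  shows "smooth_growth (\<lambda>x. x * avg 0 k x)" "((\<lambda>x. x * avg 0 k x) has_real_derivative k x) (at x)"
proof -
  obtain k' where k': "smooth_growth k'" "\<And>x. (k has_real_derivative k' x) (at x)"
    using smooth_growth_has_deriv[OF assms] by blast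
  show d: "((\<lambda>x. x * avg 0 k x) has_real_derivative k x) (at x)" for x
    by (rule antiderivative_avg[OF k'(2) smooth_growth_continuous[OF k'(1)]])
  show "smooth_growth (\<lambda>x. x * avg 0 k x)"
    by (rule smooth_growthI[OF _ d assms])
      (intro poly_growth_mult poly_growth_gauge avg_growth smooth_growth_bound smooth_growth_continuous assms)
qed

text \<open>
  With \<open>u = exp (- x)\<close>, \<open>inverse_profile c\<close> is \<open>u\<^sup>-\<^sup>1\<close> times the integral over \<open>{0..u}\<close> of the centered
  profile \<open>sin (c v) - (1 - cos c) / c\<close>.
\<close>

definition inverse_profile :: "real \<Rightarrow> real \<Rightarrow> real" where
  "inverse_profile c x = (exp x * (1 - cos (c * exp (- x))) - (1 - cos c)) / c"

text \<open>The product rule reproduces the function itself from the factor \<open>exp x\<close>,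
  while the integral contributes the profile. The growing exponential thus never has to be treated
  alone.\<close>

lemma inverse_profile_deriv:
  assumes "c \<noteq> 0"
  shows "(inverse_profile c has_real_derivative
    inverse_profile c x - (sin (c * exp (- x)) - (1 - cos c) / c)) (at x)"
proof -
  have "exp x * exp (- x) = (1::real)" by (simp add: exp_minus)
  then show ?thesis
    unfolding inverse_profile_def[abs_def] using assms
    by (auto intro!: derivative_eq_intros simp: field_simps)
qed

text \<open>The inequality \<open>1 - cos v \<le> \<bar>v\<bar>\<close> at
  \<open>v = c * exp (- x)\<close> cancels the factor \<open>exp x\<close>, leaving
  \<open>\<bar>c\<bar>\<close>; the remaining 2 bounds \<open>1 - cos c\<close>.\<close>

lemma inverse_profile_bounded:
  assumes "c \<noteq> 0" shows "\<bar>inverse_profile c x\<bar> \<le> (\<bar>c\<bar> + 2) / \<bar>c\<bar>"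
proof -
  have c1: "1 - cos v \<le> \<bar>v\<bar>" for v :: real
  proof -
    have "1 - cos v = 2 * (sin (v / 2))\<^sup>2" using cos_double_sin[of "v / 2"] by simp
    also have "\<dots> = 2 * (\<bar>sin (v / 2)\<bar> * \<bar>sin (v / 2)\<bar>)" by (simp add: power2_eq_square)
    also have "\<dots> \<le> 2 * (\<bar>v / 2\<bar> * 1)" by (intro mult_left_mono mult_mono abs_sin_x_le_abs_x) auto
    finally show ?thesis by simp
  qed
  have "exp x * (1 - cos (c * exp (- x))) \<le> exp x * (\<bar>c\<bar> * exp (- x))"
    using c1[of "c * exp (- x)"] by (intro mult_left_mono) (auto simp: abs_mult)
  also have "\<dots> = \<bar>c\<bar>" by (simp add: exp_minus)
  finally have "\<bar>exp x * (1 - cos (c * exp (- x))) - (1 - cos c)\<bar> \<le> \<bar>c\<bar> + 2"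
    using cos_le_one[of "c * exp (- x)"] cos_ge_minus_one[of c] cos_le_one[of c] by (smt (verit) exp_ge_zero mult_nonneg_nonneg)
  then show ?thesis unfolding inverse_profile_def abs_divide by (intro divide_right_mono) auto
qed

text \<open>Every derivative contains \<open>inverse_profile c\<close> again. Adding an arbitrary
  \<open>h\<close> with \<open>smooth_growth h\<close> gives an invariant stable under
  differentiation: the profile is absorbed into the new \<open>h\<close>.\<close>

lemma smooth_growth_inverse_profile:
  assumes c: "c \<noteq> 0" shows "smooth_growth (inverse_profile c)"
proof -
  have "smooth_growth (\<lambda>x. inverse_profile c x + h x)" if "smooth_growth h" for h
    using that
  proof (coinduction arbitrary: h rule: smooth_growth.coinduct)
    case smooth_growth
    note h = smooth_growth
    let ?f = "\<lambda>x. inverse_profile c x + h x"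
    obtain h' where h': "smooth_growth h'" "\<And>x. (h has_real_derivative h' x) (at x)"
      using smooth_growth_has_deriv[OF h] by blast
    define e where "e x = h' x - (sin (c * exp (- x)) - (1 - cos c) / c)" for x
    have "poly_growth {0..} (\<lambda>x. x) ?f"
      by (rule poly_growth_add[OF poly_growth_bounded[OF inverse_profile_bounded[OF c]] smooth_growth_bound[OF h]])
    moreover have "(?f has_real_derivative inverse_profile c x + e x) (at x)" for x
      unfolding e_def using DERIV_add[OF inverse_profile_deriv[OF c] h'(2)] by (simp add: algebra_simps)
    moreover have "smooth_growth e" unfolding e_def[abs_def]
      by (intro smooth_growth_diff h' smooth_growth_sin smooth_growth_const)
    ultimately show ?case
      by (intro exI[of _ ?f] exI[of _ "\<lambda>x. inverse_profile c x + e x"]) auto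
  qed
  from this[OF smooth_growth_const[of 0]] show ?thesis by simp
qed

section \<open>Radial functions of two coordinates\<close>

definition radial :: "(real \<Rightarrow> real) \<Rightarrow> (nat \<Rightarrow> real) \<Rightarrow> real" where
  "radial k x = k (((x 0)\<^sup>2 + (x 1)\<^sup>2) / 2)"

text \<open>The partial derivative of a radial function is a coordinate times a radial function,
  since the argument is half a squared norm. Polynomials in the coordinates with radial coefficients
  are therefore closed under partial derivatives of every order.\<close>

inductive radial_poly :: "((nat \<Rightarrow> real) \<Rightarrow> real) \<Rightarrow> bool" where
  radial: "smooth_growth k \<Longrightarrow> radial_poly (radial k)"
| coord: "radial_poly F \<Longrightarrow> i < 2 \<Longrightarrow> radial_poly (\<lambda>x. x i * F x)"
| add: "radial_poly F \<Longrightarrow> radial_poly G \<Longrightarrow> radial_poly (\<lambda>x. F x + G x)"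

lemma radial_deriv:
  assumes "\<And>x. (k has_real_derivative k' x) (at x)" "j < 2"
  shows "((\<lambda>s. radial k (x(j := s))) has_real_derivative (x(j := s)) j * radial k' (x(j := s))) (at s)"
proof -
  have "j = 0 \<or> j = 1" using assms(2) by auto
  then show ?thesis
    unfolding radial_def
    by (elim disjE; simp)
      (rule DERIV_cong[OF DERIV_chain2[OF assms(1)]]; auto intro!: derivative_eq_intros)+
qed

lemma radial_poly_deriv:
  assumes "radial_poly F" "j < 2"
  shows "\<exists>F'. radial_poly F' \<and> (\<forall>x s. ((\<lambda>s. F (x(j := s))) has_real_derivative F' (x(j := s))) (at s))"
  using assms(1)
proof (induction rule: radial_poly.induct)
  case (radial k)
  then obtain k' where k': "\<And>x. (k has_real_derivative k' x) (at x)" "smooth_growth k'"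
    using smooth_growth_has_deriv by blast
  have "radial_poly (\<lambda>x. x j * radial k' x)"
    by (rule radial_poly.coord[OF radial_poly.radial[OF k'(2)] assms(2)])
  then show ?case using radial_deriv[OF k'(1) assms(2)] by blast
next
  case (add F G)
  then obtain F' G' where "radial_poly F'" "radial_poly G'"
    "\<And>x s. ((\<lambda>s. F (x(j := s))) has_real_derivative F' (x(j := s))) (at s)"
    "\<And>x s. ((\<lambda>s. G (x(j := s))) has_real_derivative G' (x(j := s))) (at s)" by blast
  then show ?case
    using radial_poly.add[of F' G'] DERIV_add by blast
next
  case (coord F i)
  then obtain F' where F': "radial_poly F'"
    "\<And>x s. ((\<lambda>s. F (x(j := s))) has_real_derivative F' (x(j := s))) (at s)" by blast
  show ?case
  proof (cases "i = j")
    case True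
    have "((\<lambda>s. (x(j := s)) i * F (x(j := s))) has_real_derivative
        F (x(j := s)) + (x(j := s)) i * F' (x(j := s))) (at s)" for x s
      using DERIV_mult[OF DERIV_ident F'(2)[of x s]] True by (simp add: algebra_simps)
    then show ?thesis
      using radial_poly.add[OF coord.hyps(1) radial_poly.coord[OF F'(1) coord.hyps(2)]] by blast
  next
    case False
    have "((\<lambda>s. (x(j := s)) i * F (x(j := s))) has_real_derivative
        (x(j := s)) i * F' (x(j := s))) (at s)" for x s
      using DERIV_cmult[OF F'(2)[of x s], of "x i"] False by simp
    then show ?thesis
      using radial_poly.coord[OF F'(1) coord.hyps(2)] by blast
  qed
qed

lemma radial_poly_growth:
  assumes "radial_poly F"
  shows "poly_growth UNIV (\<lambda>x. \<Sum>i<2. \<bar>x i\<bar>) F"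
proof -
  have coord: "poly_growth UNIV (\<lambda>x. \<Sum>i<2. \<bar>x i\<bar>) (\<lambda>x. x i)" if i: "i < 2" for i :: nat
  proof (rule poly_growth_le[OF poly_growth_gauge])
    fix x :: "nat \<Rightarrow> real"
    have "\<bar>x i\<bar> \<le> (\<Sum>i<2. \<bar>x i\<bar>)" using i by (intro member_le_sum) auto
    then show "\<bar>x i\<bar> \<le> \<bar>\<Sum>i<2. \<bar>x i\<bar>\<bar>" by linarith
  qed
  show ?thesis
    using assms
  proof (induction rule: radial_poly.induct)
    case (radial k)
    have "poly_growth UNIV (\<lambda>x. \<Sum>i::nat<2. \<bar>x i\<bar>) (\<lambda>x. 1 / 2 * ((x 0)\<^sup>2 + (x 1)\<^sup>2))"
      by (intro poly_growth_mult poly_growth_add poly_growth_power poly_growth_const coord) auto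
    then show ?case
      unfolding radial_def[abs_def]
      by (intro poly_growth_compose[OF smooth_growth_bound[OF radial]]) auto
  qed (auto intro: poly_growth_mult poly_growth_add coord)
qed

lemma radial_poly_continuous:
  assumes "radial_poly F" shows "continuous_on UNIV F"
  using assms
proof (induction rule: radial_poly.induct)
  case (radial k)
  have "continuous_on UNIV (\<lambda>x::nat \<Rightarrow> real. ((x 0)\<^sup>2 + (x 1)\<^sup>2) / 2)"
    by (intro continuous_intros continuous_on_product_coordinates) auto
  then show ?case
    unfolding radial_def[abs_def]
    using continuous_on_compose2[OF smooth_growth_continuous[OF radial, of UNIV]] by blast
next
  case (coord F i)
  then show ?case by (intro continuous_on_mult continuous_on_product_coordinates)
next
  case (add F G)
  then show ?case by (intro continuous_on_add)
qed

lemma radial_poly_partial_deriv: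
  assumes "radial_poly F" "j < 2"
  shows "radial_poly (partial_deriv j F)"
proof -
  obtain F' where F': "radial_poly F'"
    "\<And>x s. ((\<lambda>s. F (x(j := s))) has_real_derivative F' (x(j := s))) (at s)"
    using radial_poly_deriv[OF assms] by blast
  have "partial_deriv j F x = F' x" for x
    unfolding partial_deriv_def using DERIV_imp_deriv[OF F'(2)[of x "x j"]] by simp
  then have "partial_deriv j F = F'" by (rule ext)
  then show ?thesis using F'(1) by simp
qed

lemma radial_poly_smooth_poly_growth:
  assumes "radial_poly F" shows "smooth_poly_growth 2 F"
  unfolding smooth_poly_growth_def Let_def
proof (intro allI impI)
  fix \<alpha> :: "nat list" assume "set \<alpha> \<subseteq> {..<2}"
  then have \<psi>: "radial_poly (foldr partial_deriv \<alpha> F)"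
    using assms by (induction \<alpha>) (auto intro: radial_poly_partial_deriv)
  let ?\<psi> = "foldr partial_deriv \<alpha> F"
  have "continuous_map (Euclidean_space 2) euclideanreal ?\<psi>"
  proof -
    have "continuous_map euclidean euclideanreal ?\<psi>"
      by (rule continuous_map_iff_continuous2[THEN iffD2, OF radial_poly_continuous[OF \<psi>]])
    then show ?thesis
      unfolding Euclidean_space_def euclidean_product_topology by (rule continuous_map_from_subtopology)
  qed
  moreover have "(\<lambda>s. ?\<psi> (x(i := s))) differentiable at (x i)" if "i < 2" for x i
    using radial_poly_deriv[OF \<psi> that] real_differentiable_def by blast
  moreover obtain C k where "\<And>x. \<bar>?\<psi> x\<bar> \<le> C * (1 + (\<Sum>i<2. \<bar>x i\<bar>)) ^ k"
    using radial_poly_growth[OF \<psi>] unfolding poly_growth_def by (auto simp: sum_nonneg abs_of_nonneg)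
  ultimately show "continuous_map (Euclidean_space 2) euclideanreal ?\<psi> \<and>
       (\<forall>x\<in>topspace (Euclidean_space 2). \<forall>i<2. (\<lambda>s. ?\<psi> (x(i := s))) differentiable at (x i)) \<and>
       (\<exists>C k. \<forall>x\<in>topspace (Euclidean_space 2). \<bar>?\<psi> x\<bar> \<le> C * (1 + (\<Sum>i<2. \<bar>x i\<bar>)) ^ k)"
    by blast
qed

lemma (in finite_measure) smooth_growth_has_moments:
  assumes k: "smooth_growth k" and X: "has_moments M X" "\<And>w. X w \<ge> 0"
  shows "has_moments M (\<lambda>w. k (X w))"
proof -
  have "(\<lambda>w. k (X w)) \<in> borel_measurable M"
    using smooth_growth_measurable[OF k] has_moments_measurable[OF X(1)] by measurable
  then show ?thesis using X by (intro poly_growth_has_moments[OF smooth_growth_bound[OF k]]) auto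
qed

context isonormal_gaussian_process
begin

definition half_square :: "'h \<Rightarrow> 'h \<Rightarrow> 'w \<Rightarrow> real" where
  "half_square f g w = ((W f w)\<^sup>2 + (W g w)\<^sup>2) / 2"

lemma half_square_nonneg: "half_square f g w \<ge> 0"
  by (simp add: half_square_def)

lemma half_square_has_moments: "has_moments M (half_square f g)"
proof -
  have "has_moments M (\<lambda>w. 1 / 2 * ((W f w) ^ 2 + (W g w) ^ 2))"
    by (intro has_moments_intros W_has_moments)
  then show ?thesis by (simp add: half_square_def[abs_def])
qed

text \<open>The functional is itself smooth and cylindrical in the two variables \<open>W f\<close>
  and \<open>W g\<close>, so constant sequences witness membership in the closure.\<close>

lemma radial_malliavin_derivative:
  assumes k: "smooth_growth k" and k': "\<And>x. (k has_real_derivative k' x) (at x)"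
  shows "has_malliavin_derivative M W (\<lambda>w. k (half_square f g w))
    (\<lambda>w. k' (half_square f g w) *\<^sub>R (W f w *\<^sub>R f + W g w *\<^sub>R g))"
proof -
  define h where "h = (\<lambda>i::nat. if i = 0 then f else g)"
  let ?F = "\<lambda>w. k (half_square f g w)"
  let ?X = "\<lambda>w. k' (half_square f g w) *\<^sub>R (W f w *\<^sub>R f + W g w *\<^sub>R g)"
  have s: "sample W 2 h w 0 = W f w" "sample W 2 h w 1 = W g w" for w
    by (simp_all add: sample_def h_def)
  have pd: "partial_deriv j (radial k) x = x j * radial k' x" if "j < 2" for j x
    unfolding partial_deriv_def using DERIV_imp_deriv[OF radial_deriv[OF k' that, of x "x j"]] by simp
  have "cylindrical_derivative W ?F ?X"
    unfolding cylindrical_derivative_def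
  proof (intro exI conjI)
    show "smooth_poly_growth 2 (radial k)"
      by (intro radial_poly_smooth_poly_growth radial_poly.radial k)
    show "?F = (\<lambda>w. radial k (sample W 2 h w))"
      unfolding radial_def s half_square_def ..
    show "?X = (\<lambda>w. \<Sum>i<2. partial_deriv i (radial k) (sample W 2 h w) *\<^sub>R h i)"
    proof
      fix w
      have "(\<Sum>i<2. partial_deriv i (radial k) (sample W 2 h w) *\<^sub>R h i)
          = partial_deriv 0 (radial k) (sample W 2 h w) *\<^sub>R f + partial_deriv 1 (radial k) (sample W 2 h w) *\<^sub>R g"
        by (simp add: numeral_2_eq_2 h_def)
      also have "\<dots> = ?X w"
      proof -
        have r: "radial k' (sample W 2 h w) = k' (half_square f g w)"
          unfolding radial_def s half_square_def ..
        have p0: "partial_deriv 0 (radial k) (sample W 2 h w) = W f w * k' (half_square f g w)"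
          by (subst pd, simp) (simp only: s r)
        have p1: "partial_deriv 1 (radial k) (sample W 2 h w) = W g w * k' (half_square f g w)"
          by (subst pd, simp) (simp only: s r)
        show ?thesis unfolding p0 p1 scaleR_add_right scaleR_scaleR by (simp only: mult.commute)
      qed
      finally show "?X w = (\<Sum>i<2. partial_deriv i (radial k) (sample W 2 h w) *\<^sub>R h i)" ..
    qed
  qed
  moreover have "square_integrable M ?F"
    by (rule has_moments_square_integrable[OF smooth_growth_has_moments[OF k half_square_has_moments half_square_nonneg]])
  moreover have "square_integrable M ?X"
  proof -
    have k'2: "smooth_growth k'" by (rule smooth_growth_deriv[OF k k'])
    have hm: "has_moments M (\<lambda>w. k' (half_square f g w))"
      by (rule smooth_growth_has_moments[OF k'2 half_square_has_moments half_square_nonneg])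
    have "square_integrable M (\<lambda>w. (k' (half_square f g w) * W a w) *\<^sub>R a)" for a
    proof -
      have m: "has_moments M (\<lambda>w. k' (half_square f g w) * W a w)"
        by (intro has_moments_mult hm W_has_moments)
      have "integrable M (\<lambda>w. (norm a)\<^sup>2 * (k' (half_square f g w) * W a w) ^ 2)"
        by (intro integrable_mult_right has_moments_integrable has_moments_power m)
      then show ?thesis
        using has_moments_measurable[OF m]
        by (auto simp: square_integrable_def power_mult_distrib mult.commute)
    qed
    from square_integrable_add[OF this[of f] this[of g]] show ?thesis
      by (simp add: scaleR_add_right)
  qed
  ultimately show ?thesis
    unfolding has_malliavin_derivative_def
    by (intro conjI exI[of _ "\<lambda>_. ?F"] exI[of _ "\<lambda>_. ?X"]) (auto simp: tendsto_L2_def)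
qed

end

subsection \<open>The generator on radial functionals\<close>

text \<open>Half the squared norm of \<open>cos t * z + sin t * z'\<close> for plane vectors
  \<open>z\<close> and \<open>z'\<close>, where \<open>a\<close> and \<open>b\<close> are half their
  squared norms and \<open>m\<close> is their inner product.\<close>

definition rotated :: "real \<Rightarrow> real \<Rightarrow> real \<Rightarrow> real \<Rightarrow> real" where
  "rotated a b m t = a * (cos t)\<^sup>2 + b * (sin t)\<^sup>2 + m * (sin t * cos t)"

text \<open>Second-order expansion in the angle with cubic remainder. \<open>K\<close> and
  \<open>N\<close> are chosen before the parameters because the estimate is later integrated over
  them. Nonnegativity of \<open>rotated\<close> keeps the argument of \<open>\<Gamma>\<close> in the
  half line where growth is known, and the bound on \<open>m\<close> lets \<open>a + b\<close> gauge
  all parameters.\<close>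

lemma rotated_taylor:
  assumes \<Gamma>: "smooth_growth \<Gamma>" and G1: "\<And>x. (\<Gamma> has_real_derivative G1 x) (at x)"
    and G2: "\<And>x. (G1 has_real_derivative G2 x) (at x)"
  shows "\<exists>K N. K \<ge> 0 \<and> (\<forall>a b m t. 0 \<le> a \<longrightarrow> 0 \<le> b \<longrightarrow> \<bar>m\<bar> \<le> a + b \<longrightarrow> (\<forall>s. 0 \<le> rotated a b m s) \<longrightarrow> 0 < t \<longrightarrow>
    \<bar>\<Gamma> (rotated a b m t) - \<Gamma> a - t * (G1 a * m) - t\<^sup>2 / 2 * (G2 a * m\<^sup>2 + G1 a * (2 * (b - a)))\<bar>
      \<le> K * (1 + a + b) ^ N * t ^ 3)"
proof -
  have sg1: "smooth_growth G1" by (rule smooth_growth_deriv[OF \<Gamma> G1])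
  have sg2: "smooth_growth G2" by (rule smooth_growth_deriv[OF sg1 G2])
  obtain G3 where sg3: "smooth_growth G3" and G3: "\<And>x. (G2 has_real_derivative G3 x) (at x)"
    using smooth_growth_has_deriv[OF sg2] by blast
  \<comment> \<open>\<open>r1\<close> and \<open>r2\<close> are the first two derivatives of
    \<open>rotated\<close>. That function combines a constant with the sine and cosine of the double
    angle, so its third derivative is \<open>- 4\<close> times \<open>r1\<close>.\<close>
  define r1 where "r1 a b m s = 2 * (b - a) * (sin s * cos s) + m * ((cos s)\<^sup>2 - (sin s)\<^sup>2)" for a b m s :: real
  define r2 where "r2 a b m s = 2 * (b - a) * ((cos s)\<^sup>2 - (sin s)\<^sup>2) - 4 * m * (sin s * cos s)" for a b m s :: real
  define D3 where "D3 a b m s = G3 (rotated a b m s) * (r1 a b m s) ^ 3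
      + 3 * G2 (rotated a b m s) * r1 a b m s * r2 a b m s + G1 (rotated a b m s) * (- 4 * r1 a b m s)" for a b m s
  \<comment> \<open>Packing parameters and angle into a tuple turns the uniform remainder bound into
    an instance of polynomial growth with gauge \<open>a + b\<close>.\<close>
  define A where "A = {(a, b, m, s :: real). 0 \<le> a \<and> 0 \<le> b \<and> \<bar>m\<bar> \<le> a + b \<and> (\<forall>s. 0 \<le> rotated a b m s)}"
  have "poly_growth A (\<lambda>(a, b, m, s). a + b) (\<lambda>(a, b, m, s). D3 a b m s)"
  proof -
    have v: "poly_growth A (\<lambda>(a, b, m, s). a + b) (\<lambda>(a, b, m, s). a)"
      "poly_growth A (\<lambda>(a, b, m, s). a + b) (\<lambda>(a, b, m, s). b)"
      "poly_growth A (\<lambda>(a, b, m, s). a + b) (\<lambda>(a, b, m, s). m)"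
      by (rule poly_growth_le[OF poly_growth_gauge]; auto simp: A_def)+
    have t: "poly_growth A (\<lambda>(a, b, m, s). a + b) (\<lambda>(a, b, m, s). sin s)"
      "poly_growth A (\<lambda>(a, b, m, s). a + b) (\<lambda>(a, b, m, s). cos s)"
      by (rule poly_growth_bounded[of _ _ 1]; auto)+
    note int = v[unfolded case_prod_unfold] t[unfolded case_prod_unfold]
      poly_growth_mult poly_growth_add poly_growth_diff poly_growth_power poly_growth_const
    have r: "poly_growth A (\<lambda>(a, b, m, s). a + b) (\<lambda>(a, b, m, s). rotated a b m s)"
      "poly_growth A (\<lambda>(a, b, m, s). a + b) (\<lambda>(a, b, m, s). r1 a b m s)"
      "poly_growth A (\<lambda>(a, b, m, s). a + b) (\<lambda>(a, b, m, s). r2 a b m s)"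
      unfolding rotated_def r1_def r2_def case_prod_unfold by (intro int)+
    have G: "poly_growth A (\<lambda>(a, b, m, s). a + b) (\<lambda>(a, b, m, s). G (rotated a b m s))" if "smooth_growth G" for G
      using poly_growth_compose[OF smooth_growth_bound[OF that] _ r(1)] by (auto simp: A_def case_prod_unfold)
    show ?thesis
      unfolding D3_def case_prod_unfold
      by (intro int r[unfolded case_prod_unfold] G[unfolded case_prod_unfold] sg1 sg2 sg3)
  qed
  then obtain K N where K0: "0 \<le> K" and K: "\<And>x. x \<in> A \<Longrightarrow>
      \<bar>case x of (a, b, m, s) \<Rightarrow> D3 a b m s\<bar> \<le> K * (1 + \<bar>case x of (a, b, m, s) \<Rightarrow> a + b\<bar>) ^ N"
    unfolding poly_growth_def by blast
  show ?thesis
  proof (intro exI conjI allI impI)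
    fix a b m t :: real
    assume a: "0 \<le> a" and b: "0 \<le> b" and m: "\<bar>m\<bar> \<le> a + b" and pos: "\<forall>s. 0 \<le> rotated a b m s" and t: "0 < t"
    let ?r = "rotated a b m" and ?r1 = "r1 a b m" and ?r2 = "r2 a b m"
    have dr: "(?r has_real_derivative ?r1 s) (at s)" for s
      unfolding rotated_def[abs_def] r1_def
      by (auto intro!: derivative_eq_intros simp: algebra_simps power2_eq_square)
    have dr1: "(?r1 has_real_derivative ?r2 s) (at s)" for s
      unfolding r1_def[abs_def] r2_def
      by (auto intro!: derivative_eq_intros simp: algebra_simps power2_eq_square)
    have dr2: "(?r2 has_real_derivative - 4 * ?r1 s) (at s)" for s
      unfolding r2_def[abs_def] r1_def
      by (auto intro!: derivative_eq_intros simp: algebra_simps power2_eq_square)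
    define D1 where "D1 s = G1 (?r s) * ?r1 s" for s
    define D2 where "D2 s = G2 (?r s) * (?r1 s)\<^sup>2 + G1 (?r s) * ?r2 s" for s
    have d1: "(D1 has_real_derivative D2 s) (at s)" for s
      unfolding D1_def[abs_def] D2_def
      by (rule DERIV_cong[OF DERIV_mult[OF DERIV_chain2[OF G2 dr] dr1]]) (simp add: power2_eq_square algebra_simps)
    have d2: "(D2 has_real_derivative D3 a b m s) (at s)" for s
      unfolding D2_def[abs_def] D3_def
      by (rule DERIV_cong[OF DERIV_add[OF DERIV_mult[OF DERIV_chain2[OF G3 dr] DERIV_power[OF dr1]]
              DERIV_mult[OF DERIV_chain2[OF G2 dr] dr2]]])
        (simp add: power2_eq_square power3_eq_cube algebra_simps)
    define diff where "diff n = (if n = 0 then \<lambda>s. \<Gamma> (?r s) else if n = 1 then D1 else if n = 2 then D2 else D3 a b m)"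
      for n :: nat
    have "\<exists>s. 0 < s \<and> s < t \<and> \<Gamma> (?r t) = (\<Sum>n<3. diff n 0 / fact n * t ^ n) + diff 3 s / fact 3 * t ^ 3"
    proof (rule Maclaurin[OF t])
      show "\<forall>n s. n < 3 \<and> 0 \<le> s \<and> s \<le> t \<longrightarrow> (diff n has_real_derivative diff (Suc n) s) (at s)"
        using DERIV_chain2[OF G1 dr] d1 d2 by (auto simp: diff_def less_Suc_eq numeral_3_eq_3 D1_def)
    qed (auto simp: diff_def)
    then obtain s where "\<Gamma> (?r t) = \<Gamma> (?r 0) + D1 0 * t + D2 0 / 2 * t\<^sup>2 + D3 a b m s / 6 * t ^ 3"
      by (auto simp: diff_def numeral_3_eq_3 fact_numeral power2_eq_square)
    moreover have "?r 0 = a" "D1 0 = G1 a * m" "D2 0 = G2 a * m\<^sup>2 + G1 a * (2 * (b - a))"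
      by (simp_all add: D1_def D2_def rotated_def r1_def r2_def)
    moreover have "v - u - t * p - t\<^sup>2 / 2 * q = R" if "v = u + p * t + q / 2 * t\<^sup>2 + R" for v u p q R
      using that by (simp add: algebra_simps)
    ultimately have e: "\<Gamma> (?r t) - \<Gamma> a - t * (G1 a * m) - t\<^sup>2 / 2 * (G2 a * m\<^sup>2 + G1 a * (2 * (b - a)))
        = D3 a b m s / 6 * t ^ 3" by metis
    have "\<bar>D3 a b m s\<bar> \<le> K * (1 + a + b) ^ N"
      using K[of "(a, b, m, s)"] a b m pos by (simp add: A_def add.assoc)
    then have "\<bar>D3 a b m s\<bar> / 6 * t ^ 3 \<le> K * (1 + a + b) ^ N * t ^ 3"
      using t by (intro mult_right_mono) auto
    then show "\<bar>\<Gamma> (?r t) - \<Gamma> a - t * (G1 a * m) - t\<^sup>2 / 2 * (G2 a * m\<^sup>2 + G1 a * (2 * (b - a)))\<bar>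
      \<le> K * (1 + a + b) ^ N * t ^ 3"
      unfolding e using t by (simp add: abs_mult)
  qed (rule K0)
qed

text \<open>Mehler's two coefficients are the cosine and sine of this angle. It must approach 0
  through positive values, because the Taylor estimate is stated for positive angles.\<close>

lemma filterlim_arccos_exp: "filterlim (\<lambda>t. arccos (exp (- t))) (at_right 0) (at_right 0)"
  unfolding filterlim_at
proof
  show "\<forall>\<^sub>F t in at_right 0. arccos (exp (- t)) \<in> {0<..} \<and> arccos (exp (- t)) \<noteq> 0"
    using eventually_at_right_less[of "0::real"]
  proof eventually_elim
    case (elim t)
    have "arccos 1 < arccos (exp (- t))"
      using elim by (intro arccos_less_arccos) (auto intro: order_trans[of _ 0])
    then show ?case by simp
  qed
  have "continuous_on {0..} (\<lambda>t::real. arccos (exp (- t)))"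
    by (rule continuous_on_arccos) (auto intro!: continuous_intros intro: order_trans[of _ 0])
  then have "((\<lambda>t::real. arccos (exp (- t))) \<longlongrightarrow> arccos (exp (- 0))) (at 0 within {0..})"
    by (simp only: continuous_on_def) (metis atLeast_iff order_refl)
  then have "((\<lambda>t::real. arccos (exp (- t))) \<longlongrightarrow> arccos (exp (- 0))) (at_right 0)"
    by (rule tendsto_within_subset) auto
  then show "((\<lambda>t::real. arccos (exp (- t))) \<longlongrightarrow> 0) (at_right 0)" by simp
qed

context isonormal_gaussian_process
begin

text \<open>Averaging the Taylor expansion over the independent copy uses only three moments:
  \<open>m\<close> has mean 0, its square has mean \<open>2 * ?a w\<close>, and \<open>?a\<close>
  has mean 1. The quadratic coefficient becomes \<open>?L\<close>, and half the squared angle is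
  asymptotically \<open>t\<close>.\<close>

lemma radial_generator:
  assumes fg: "norm f = 1" "norm g = 1" "inner f g = 0"
    and \<Gamma>: "smooth_growth \<Gamma>" and G1: "\<And>x. (\<Gamma> has_real_derivative G1 x) (at x)"
    and G2: "\<And>x. (G1 has_real_derivative G2 x) (at x)"
  shows "has_OU_generator M W (\<lambda>w. \<Gamma> (half_square f g w))
    (\<lambda>w. 2 * half_square f g w * G2 (half_square f g w) + 2 * (1 - half_square f g w) * G1 (half_square f g w))"
    (is "has_OU_generator M W ?F ?L")
proof -
  let ?a = "half_square f g"
  have sg1: "smooth_growth G1" by (rule smooth_growth_deriv[OF \<Gamma> G1])
  have sg2: "smooth_growth G2" by (rule smooth_growth_deriv[OF sg1 G2])
  note hm = smooth_growth_has_moments[OF _ half_square_has_moments half_square_nonneg]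
  have hF: "has_moments M ?F" by (rule hm[OF \<Gamma>])
  have hL: "has_moments M ?L"
    by (intro has_moments_intros half_square_has_moments hm[OF sg1] hm[OF sg2])
  have [measurable]: "\<Gamma> \<in> borel_measurable borel" by (rule smooth_growth_measurable[OF \<Gamma>])
  have am[measurable]: "?a \<in> borel_measurable M" by (rule has_moments_measurable[OF half_square_has_moments])
  define \<Phi> where "\<Phi> \<omega> = \<Gamma> (((\<omega> f)\<^sup>2 + (\<omega> g)\<^sup>2) / 2)" for \<omega> :: "'h \<Rightarrow> real"
  have \<Phi>[measurable]: "\<Phi> \<in> borel_measurable \<Omega>" unfolding \<Phi>_def[abs_def] by measurable
  obtain K N where K0: "K \<ge> 0" and K: "\<And>a b m t. 0 \<le> a \<Longrightarrow> 0 \<le> b \<Longrightarrow> \<bar>m\<bar> \<le> a + b \<Longrightarrow>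
      (\<And>s. 0 \<le> rotated a b m s) \<Longrightarrow> 0 < t \<Longrightarrow>
      \<bar>\<Gamma> (rotated a b m t) - \<Gamma> a - t * (G1 a * m) - t\<^sup>2 / 2 * (G2 a * m\<^sup>2 + G1 a * (2 * (b - a)))\<bar>
      \<le> K * (1 + a + b) ^ N * t ^ 3"
    using rotated_taylor[OF \<Gamma> G1 G2] by blast
  define cN where "cN = (\<integral>w. (1 + ?a w) ^ N \<partial>M)"
  have hN: "has_moments M (\<lambda>w. (1 + ?a w) ^ N)" by (intro has_moments_intros half_square_has_moments)
  have cov: "expectation (\<lambda>w. (W f w)\<^sup>2) = 1" "expectation (\<lambda>w. (W g w)\<^sup>2) = 1"
    "expectation (\<lambda>w. W f w * W g w) = 0"
    using covariance[of f f] covariance[of g g] covariance[of f g] fg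
    by (simp_all add: power2_eq_square[symmetric] power2_norm_eq_inner[symmetric])
  have i2: "integrable M (\<lambda>w. (W h w)\<^sup>2)" for h
    by (intro has_moments_integrable has_moments_power W_has_moments)
  have Ea: "expectation ?a = 1"
    unfolding half_square_def[abs_def] using cov i2 by simp
  define m where "m w w' = W f w * W f w' + W g w * W g w'" for w w'
  have hm_m: "has_moments M (m w)" for w
    unfolding m_def[abs_def] by (intro has_moments_intros W_has_moments)
  have Em: "expectation (m w) = 0" for w
    unfolding m_def[abs_def] using W_integrable(1) by (simp add: centered)
  have Em2: "expectation (\<lambda>w'. (m w w')\<^sup>2) = 2 * ?a w" for w
  proof -
    have e: "(m w w')\<^sup>2 = (W f w)\<^sup>2 * (W f w')\<^sup>2 + (W g w)\<^sup>2 * (W g w')\<^sup>2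
        + (2 * W f w * W g w) * (W f w' * W g w')" for w'
      unfolding m_def by (simp add: power2_eq_square algebra_simps)
    have "expectation (\<lambda>w'. (m w w')\<^sup>2) = (W f w)\<^sup>2 * 1 + (W g w)\<^sup>2 * 1 + (2 * W f w * W g w) * 0"
      unfolding e
      using i2 W_integrable(2)
      by (simp add: cov)
    then show ?thesis by (simp add: half_square_def)
  qed
  have m_le: "\<bar>m w w'\<bar> \<le> ?a w + ?a w'" for w w'
  proof -
    have "2 * \<bar>x * y\<bar> \<le> x\<^sup>2 + y\<^sup>2" for x y :: real
      using zero_le_power2[of "\<bar>x\<bar> - \<bar>y\<bar>"] unfolding power2_diff by (simp add: abs_mult)
    from this[of "W f w" "W f w'"] this[of "W g w" "W g w'"]
      abs_triangle_ineq[of "W f w * W f w'" "W g w * W g w'"] show ?thesis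
      unfolding m_def half_square_def add_divide_distrib by linarith
  qed
  have rot: "((cos s * W f w + sin s * W f w')\<^sup>2 + (cos s * W g w + sin s * W g w')\<^sup>2) / 2
      = rotated (?a w) (?a w') (m w w') s" for s w w'
    unfolding rotated_def half_square_def m_def
    by (simp add: power2_eq_square field_simps)
  have rot0: "0 \<le> rotated (?a w) (?a w') (m w w') s" for s w w'
    unfolding rot[symmetric] by simp
  have key: "\<bar>OU t \<Phi> w - ?F w - \<theta>\<^sup>2 / 2 * ?L w\<bar> \<le> K * cN * (1 + ?a w) ^ N * \<theta> ^ 3"
    if t: "t > 0" and \<theta>: "\<theta> = arccos (exp (- t))" and \<theta>0: "\<theta> > 0" for t \<theta> w
  proof -
    have e1: "exp (- t) \<le> 1" "- 1 \<le> exp (- t)" using t by (auto intro: order_trans[of _ 0])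
    have ct: "cos \<theta> = exp (- t)" unfolding \<theta> using e1 by (intro cos_arccos) auto
    have st: "sin \<theta> = sqrt (1 - exp (- 2 * t))"
      unfolding \<theta> using e1 by (subst sin_arccos) (auto simp: exp_double[symmetric])
    have OU: "OU t \<Phi> w = (\<integral>w'. \<Gamma> (rotated (?a w) (?a w') (m w w') \<theta>) \<partial>M)"
      unfolding OU_semigroup_def \<Phi>_def ct[symmetric] st[symmetric] rot ..
    have hR: "has_moments M (\<lambda>w'. \<Gamma> (rotated (?a w) (?a w') (m w w') \<theta>))"
    proof (rule smooth_growth_has_moments[OF \<Gamma>])
      show "has_moments M (\<lambda>w'. rotated (?a w) (?a w') (m w w') \<theta>)"
        unfolding rotated_def by (intro has_moments_intros half_square_has_moments hm_m)
    qed (rule rot0)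
    let ?R = "\<lambda>w'. \<Gamma> (rotated (?a w) (?a w') (m w w') \<theta>) - \<Gamma> (?a w) - \<theta> * (G1 (?a w) * m w w')
       - \<theta>\<^sup>2 / 2 * (G2 (?a w) * (m w w')\<^sup>2 + G1 (?a w) * (2 * (?a w' - ?a w)))"
    have hRR: "has_moments M ?R"
      by (intro has_moments_intros hR hm_m half_square_has_moments)
    have "expectation ?R = OU t \<Phi> w - \<Gamma> (?a w) - \<theta> * (G1 (?a w) * expectation (m w))
       - \<theta>\<^sup>2 / 2 * (G2 (?a w) * expectation (\<lambda>w'. (m w w')\<^sup>2) + G1 (?a w) * (2 * (expectation ?a - ?a w)))"
    proof -
      have i: "integrable M (\<lambda>w'. \<Gamma> (rotated (?a w) (?a w') (m w w') \<theta>))" "integrable M (m w)"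
        "integrable M (\<lambda>w'. (m w w')\<^sup>2)" "integrable M ?a"
        by (intro has_moments_integrable hR hm_m has_moments_power half_square_has_moments)+
      show ?thesis unfolding OU using i by (simp add: prob_space)
    qed
    also have "\<dots> = OU t \<Phi> w - ?F w - \<theta>\<^sup>2 / 2 * ?L w"
      unfolding Em Em2 Ea by (simp add: algebra_simps)
    finally have "\<bar>OU t \<Phi> w - ?F w - \<theta>\<^sup>2 / 2 * ?L w\<bar> = \<bar>expectation ?R\<bar>" by simp
    also have "\<dots> \<le> expectation (\<lambda>w'. \<bar>?R w'\<bar>)" by (rule integral_abs_bound)
    also have "\<dots> \<le> expectation (\<lambda>w'. K * (1 + ?a w) ^ N * \<theta> ^ 3 * (1 + ?a w') ^ N)"
    proof (rule integral_mono)
      show "integrable M (\<lambda>w'. \<bar>?R w'\<bar>)" by (intro has_moments_integrable has_moments_abs hRR)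
      show "integrable M (\<lambda>w'. K * (1 + ?a w) ^ N * \<theta> ^ 3 * (1 + ?a w') ^ N)"
        by (intro integrable_mult_right has_moments_integrable hN)
      fix w'
      have "\<bar>?R w'\<bar> \<le> K * (1 + ?a w + ?a w') ^ N * \<theta> ^ 3"
        by (intro K half_square_nonneg m_le rot0 \<theta>0)
      \<comment> \<open>Separating the variables lets \<open>w'\<close> be integrated out into the
        constant \<open>cN\<close>, leaving a random factor in \<open>w\<close> that has all
        moments.\<close>
      also have "\<dots> \<le> K * ((1 + ?a w) * (1 + ?a w')) ^ N * \<theta> ^ 3"
      proof -
        have "0 \<le> ?a w * ?a w'" by (intro mult_nonneg_nonneg half_square_nonneg)
        then have "1 + ?a w + ?a w' \<le> (1 + ?a w) * (1 + ?a w')" by (simp add: algebra_simps)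
        then show ?thesis
          using K0 \<theta>0 half_square_nonneg by (intro mult_right_mono mult_left_mono power_mono) (auto intro!: add_nonneg_nonneg)
      qed
      also have "\<dots> = K * (1 + ?a w) ^ N * \<theta> ^ 3 * (1 + ?a w') ^ N"
        unfolding power_mult_distrib by (simp only: ac_simps)
      finally show "\<bar>?R w'\<bar> \<le> K * (1 + ?a w) ^ N * \<theta> ^ 3 * (1 + ?a w') ^ N" .
    qed
    also have "\<dots> = K * cN * (1 + ?a w) ^ N * \<theta> ^ 3"
      unfolding cN_def by simp
    finally show ?thesis .
  qed
  \<comment> \<open>\<open>B\<close> dominates both the limit and the remainder; a pointwise bound
    by a deterministic rate times a variable with all moments gives mean square convergence at
    once.\<close>
  define B where "B w = \<bar>?L w\<bar> + K * cN * (1 + ?a w) ^ N" for w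
  have hB: "has_moments M B" unfolding B_def[abs_def]
    by (intro has_moments_intros hN hL half_square_has_moments)
  have cN0: "cN \<ge> 0" unfolding cN_def using half_square_nonneg by (intro integral_nonneg_AE AE_I2) (auto intro!: add_nonneg_nonneg)
  \<comment> \<open>With \<open>t = - ln (cos \<theta>)\<close> the first summand is the relative
    error of half the squared angle as a substitute for \<open>t\<close>, and the second is the
    cubic remainder divided by \<open>t\<close>.\<close>
  define \<delta> where "\<delta> \<theta> = \<bar>\<theta>\<^sup>2 / (2 * - ln (cos \<theta>)) - 1\<bar> + \<theta> ^ 3 / - ln (cos \<theta>)" for \<theta> :: real
  have \<delta>lim: "(\<delta> \<longlongrightarrow> 0) (at_right 0)" unfolding \<delta>_def[abs_def] by real_asymp
  define \<epsilon> where "\<epsilon> t = \<delta> (arccos (exp (- t)))" for t :: real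
  have \<epsilon>lim: "(\<epsilon> \<longlongrightarrow> 0) (at_right 0)"
    unfolding \<epsilon>_def[abs_def] by (rule filterlim_compose[OF \<delta>lim filterlim_arccos_exp])
  have bound: "\<forall>\<^sub>F t in at_right 0. \<forall>w. \<bar>(OU t \<Phi> w - ?F w) / t - ?L w\<bar> \<le> \<epsilon> t * B w"
  proof -
    have "\<forall>\<^sub>F t in at_right 0. (0::real) < arccos (exp (- t))"
      using filterlim_arccos_exp unfolding filterlim_at by (auto elim!: eventually_mono)
    with eventually_at_right_less[of "0::real"] show ?thesis
    proof eventually_elim
      case (elim t)
      define \<theta> where "\<theta> = arccos (exp (- t))"
      have \<theta>0: "\<theta> > 0" using elim by (simp add: \<theta>_def)
      have e1: "exp (- t) \<le> 1" "- 1 \<le> exp (- t)" using elim by (auto intro: order_trans[of _ 0])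
      have tl: "- ln (cos \<theta>) = t" unfolding \<theta>_def using e1 by (subst cos_arccos) auto
      have \<epsilon>t: "\<epsilon> t = \<bar>\<theta>\<^sup>2 / (2 * t) - 1\<bar> + \<theta> ^ 3 / t"
        unfolding \<epsilon>_def \<delta>_def \<theta>_def[symmetric] tl ..
      have est: "\<bar>x / t - l\<bar> \<le> (\<bar>z / (2 * t) - 1\<bar> + y / t) * (\<bar>l\<bar> + u)"
        if "\<bar>x - z / 2 * l\<bar> \<le> u * y" "u \<ge> 0" "y \<ge> 0" for x z l u y
      proof -
        have "x / t - l = (x - z / 2 * l) / t + (z / (2 * t) - 1) * l" using elim by (simp add: field_simps)
        then have "\<bar>x / t - l\<bar> \<le> \<bar>x - z / 2 * l\<bar> / t + \<bar>z / (2 * t) - 1\<bar> * \<bar>l\<bar>"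
          using elim abs_triangle_ineq[of "(x - z / 2 * l) / t" "(z / (2 * t) - 1) * l"] by (simp add: abs_mult)
        also have "\<dots> \<le> u * y / t + \<bar>z / (2 * t) - 1\<bar> * \<bar>l\<bar>"
          using that elim by (intro add_mono divide_right_mono) auto
        also have "\<dots> \<le> (\<bar>z / (2 * t) - 1\<bar> + y / t) * (\<bar>l\<bar> + u)"
        proof -
          have "0 \<le> \<bar>z / (2 * t) - 1\<bar> * u" "0 \<le> y / t * \<bar>l\<bar>" using that elim by simp_all
          then show ?thesis by (simp add: distrib_left distrib_right mult.commute)
        qed
        finally show ?thesis .
      qed
      show ?case
        unfolding \<epsilon>t B_def
        using key[OF elim(1) \<theta>_def \<theta>0] \<theta>0 K0 cN0 half_square_nonneg[of f g]
        by (intro allI est) (auto simp: diff_diff_eq)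
    qed
  qed
  have L2: "tendsto_L2 M (\<lambda>t w. (OU t \<Phi> w - ?F w) / t) ?L (at_right 0)"
    unfolding tendsto_L2_def
  proof (rule tendsto_sandwich[OF _ _ tendsto_const])
    define \<beta> where "\<beta> = (\<integral>w. (B w)\<^sup>2 \<partial>M)"
    have iB: "integrable M (\<lambda>w. (B w)\<^sup>2)" by (intro has_moments_integrable has_moments_power hB)
    show "\<forall>\<^sub>F t in at_right 0. (\<integral>\<^sup>+ w. ennreal ((norm ((OU t \<Phi> w - ?F w) / t - ?L w))\<^sup>2) \<partial>M)
        \<le> ennreal ((\<epsilon> t)\<^sup>2 * \<beta>)"
      using bound
    proof eventually_elim
      case (elim t)
      have "(\<integral>\<^sup>+ w. ennreal ((norm ((OU t \<Phi> w - ?F w) / t - ?L w))\<^sup>2) \<partial>M)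
          \<le> (\<integral>\<^sup>+ w. ennreal ((\<epsilon> t)\<^sup>2 * (B w)\<^sup>2) \<partial>M)"
      proof (intro nn_integral_mono ennreal_leI)
        fix w
        have "\<bar>(OU t \<Phi> w - ?F w) / t - ?L w\<bar>\<^sup>2 \<le> (\<epsilon> t * B w)\<^sup>2"
          using elim by (intro power_mono) auto
        then show "(norm ((OU t \<Phi> w - ?F w) / t - ?L w))\<^sup>2 \<le> (\<epsilon> t)\<^sup>2 * (B w)\<^sup>2"
          by (simp add: power_mult_distrib)
      qed
      also have "\<dots> = ennreal (\<integral>w. (\<epsilon> t)\<^sup>2 * (B w)\<^sup>2 \<partial>M)"
        using iB by (intro nn_integral_eq_integral) auto
      finally show ?case by (simp add: \<beta>_def)
    qed
    have "((\<lambda>t. (\<epsilon> t)\<^sup>2 * \<beta>) \<longlongrightarrow> 0\<^sup>2 * \<beta>) (at_right 0)"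
      by (intro tendsto_mult tendsto_power \<epsilon>lim tendsto_const)
    then show "((\<lambda>t. ennreal ((\<epsilon> t)\<^sup>2 * \<beta>)) \<longlongrightarrow> 0) (at_right 0)"
      using tendsto_ennrealI by fastforce
  qed simp
  show ?thesis
    unfolding has_OU_generator_def
  proof (intro conjI bexI[OF _ \<Phi>])
    show "AE w in M. ?F w = \<Phi> (path w)" by (simp add: \<Phi>_def half_square_def)
  qed (intro has_moments_square_integrable hF hL L2)+
qed

end

subsection \<open>The centered profile\<close>

text \<open>The subtracted constant is the integral of \<open>sin (c * v)\<close> over
  \<open>v\<close> in the unit interval, the mean that a uniform variable would give; it is
  identified with the expectation only in \<open>centered_profile_mean\<close>.\<close>

definition centered_profile :: "real \<Rightarrow> real \<Rightarrow> real" where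
  "centered_profile c x = sin (c * exp (- x)) - (1 - cos c) / c"

lemma smooth_growth_centered_profile: "smooth_growth (centered_profile c)"
  unfolding centered_profile_def[abs_def] by (intro smooth_growth_diff smooth_growth_sin smooth_growth_const)

text \<open>\<open>inverse_profile c\<close> vanishes at 0, so half its Hadamard quotient is a
  regular \<open>q\<close>. Differentiating \<open>2 * x * q x = inverse_profile c x\<close> and
  inserting \<open>inverse_profile_deriv\<close> gives the equation of the generator.\<close>

lemma profile_potential:
  assumes c: "c \<noteq> 0"
  shows "\<exists>\<Gamma> q q'. smooth_growth \<Gamma> \<and> (\<forall>x. (\<Gamma> has_real_derivative q x) (at x)) \<and>
    (\<forall>x. (q has_real_derivative q' x) (at x)) \<and>
    (\<forall>x. 2 * x * q x = inverse_profile c x) \<and>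
    (\<forall>x. 2 * x * q' x + 2 * (1 - x) * q x = - centered_profile c x)"
proof -
  let ?k = "inverse_profile c"
  let ?k' = "\<lambda>x. inverse_profile c x - centered_profile c x"
  have dk: "(?k has_real_derivative ?k' x) (at x)" for x
    using inverse_profile_deriv[OF c] by (simp add: centered_profile_def)
  have sk': "smooth_growth ?k'"
    by (intro smooth_growth_diff smooth_growth_inverse_profile c smooth_growth_centered_profile)
  define q where "q x = 1 / 2 * avg 0 ?k' x" for x
  have sq: "smooth_growth q"
    unfolding q_def[abs_def] by (rule smooth_growth_cmult[OF smooth_growth_avg[OF sk']])
  have k0: "?k 0 = 0" by (simp add: inverse_profile_def)
  have xq: "2 * x * q x = ?k x" for x
    using avg_FTC[OF dk, of x] k0 by (simp add: q_def)
  obtain q' where q': "\<And>x. (q has_real_derivative q' x) (at x)"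
    using smooth_growth_has_deriv[OF sq] by blast
  have "2 * q x + 2 * x * q' x = ?k' x" for x
  proof (rule DERIV_unique[OF _ dk])
    have "((\<lambda>x. 2 * x * q x) has_real_derivative 2 * q x + 2 * x * q' x) (at x)"
      by (rule DERIV_cong[OF DERIV_mult[OF DERIV_cmult[OF DERIV_ident] q']]) simp
    then show "(?k has_real_derivative 2 * q x + 2 * x * q' x) (at x)" by (simp only: xq)
  qed
  then have "2 * x * q' x + 2 * (1 - x) * q x = - centered_profile c x" for x
    using xq[of x] by (simp add: algebra_simps)
  then show ?thesis
    using smooth_growth_antiderivative[OF sq] q' xq by blast
qed

context isonormal_gaussian_process
begin

text \<open>There is no circularity: the potential is built from the explicit constant alone, before
  anything is known about the expectation.\<close>

lemma centered_profile_mean: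
  assumes fg: "norm f = 1" "norm g = 1" "inner f g = 0" and c: "c \<noteq> 0"
  shows "expectation (\<lambda>w. sin (c * exp (- half_square f g w))) = (1 - cos c) / c"
proof -
  obtain \<Gamma> q q' where \<Gamma>: "smooth_growth \<Gamma>" "\<And>x. (\<Gamma> has_real_derivative q x) (at x)"
    "\<And>x. (q has_real_derivative q' x) (at x)"
    "\<And>x. 2 * x * q' x + 2 * (1 - x) * q x = - centered_profile c x"
    using profile_potential[OF c] by blast
  have "expectation (\<lambda>w. - centered_profile c (half_square f g w)) = 0"
    using OU_generator_mean[OF radial_generator[OF fg \<Gamma>(1-3)]] unfolding \<Gamma>(4) .
  moreover have "integrable M (\<lambda>w. sin (c * exp (- half_square f g w)))"
    using has_moments_integrable[OF smooth_growth_has_moments[OF smooth_growth_sin half_square_has_moments half_square_nonneg]]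
    by blast
  ultimately show ?thesis by (simp add: centered_profile_def prob_space)
qed

end

text \<open>Derivative and pseudo-inverse are relations between a functional and its versions. The
  existence part keeps the statement about all versions from being vacuous.\<close>

theorem proposition2:
  fixes M :: "'w measure"
    and W :: "'h::{real_inner, banach, second_countable_topology} \<Rightarrow> 'w \<Rightarrow> real"
    and f g :: 'h
    and T :: real
    and U Y :: "'w \<Rightarrow> real"
    and P :: "nat set"
  assumes "isonormal_gaussian_process M W"
    and "norm f = 1" and "norm g = 1" and "inner f g = 0"
    and "\<And>w. U w = exp (- (1 / 2) * ((W f w)\<^sup>2 + (W g w)\<^sup>2))"
    and "T > 0"
    and "P = {p. prime p \<and> real p \<le> T}"
    and "\<And>w. Y w = (\<Sum>p\<in>P. sin (T * U w * ln (real p)) / sqrt (real p)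
                        - (\<integral>v. sin (T * U v * ln (real p)) \<partial>M) / sqrt (real p))"
  shows "(\<exists>DY G DG. has_malliavin_derivative M W Y DY \<and> has_OU_pseudo_inverse M W Y G \<and>
            has_malliavin_derivative M W G DG) \<and>
         (\<forall>DY G DG. has_malliavin_derivative M W Y DY \<longrightarrow> has_OU_pseudo_inverse M W Y G \<longrightarrow>
            has_malliavin_derivative M W G DG \<longrightarrow>
            (AE w in M. inner (DY w) (DG w) =
              (\<Sum>p1\<in>P. \<Sum>p2\<in>P.
                 ln (real p2) / ln (real p1) * (1 / sqrt (real p1 * real p2)) *
                 ((U w - 1) * cos (T * U w * ln (real p2))
                  - U w * cos (T * U w * ln (real p2)) * cos (T * ln (real p1))
                  + cos (T * U w * ln (real p1)) * cos (T * U w * ln (real p2))))))"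
proof -
  interpret isonormal_gaussian_process M W by fact
  note fg = assms(2-4)
  let ?a = "half_square f g"
  let ?S = "\<lambda>w p1 p2. ln (real p2) / ln (real p1) * (1 / sqrt (real p1 * real p2)) *
    ((U w - 1) * cos (T * U w * ln (real p2))
      - U w * cos (T * U w * ln (real p2)) * cos (T * ln (real p1))
      + cos (T * U w * ln (real p1)) * cos (T * U w * ln (real p2)))"
  define c where "c p = T * ln (real p)" for p :: nat
  define s where "s p = 1 / sqrt (real p)" for p :: nat
  have lnp: "ln (real p) > 0" if "p \<in> P" for p
    using that prime_gt_1_nat[of p] unfolding assms(7) by (auto intro!: ln_gt_zero)
  \<comment> \<open>The profiles divide by \<open>c p\<close>, which is legitimate because primes
    exceed 1.\<close>
  have c0: "c p \<noteq> 0" if "p \<in> P" for p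
    using lnp[OF that] \<open>T > 0\<close> by (simp add: c_def)
  have U: "U w = exp (- ?a w)" for w
    unfolding assms(5) half_square_def by simp
  have sinU: "sin (T * U w * ln (real p)) = sin (c p * exp (- ?a w))" for w p
    by (simp only: c_def U ac_simps)
  define \<eta> where "\<eta> x = (\<Sum>p\<in>P. s p * centered_profile (c p) x)" for x
  have Y: "Y = (\<lambda>w. \<eta> (?a w))"
  proof
    fix w
    show "Y w = \<eta> (?a w)"
      unfolding assms(8) \<eta>_def sinU
    proof (rule sum.cong[OF refl])
      fix p assume "p \<in> P"
      from centered_profile_mean[OF fg c0[OF this]]
      show "sin (c p * exp (- ?a w)) / sqrt (real p) - (\<integral>v. sin (c p * exp (- ?a v)) \<partial>M) / sqrt (real p)
          = s p * centered_profile (c p) (?a w)"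
        by (simp add: centered_profile_def s_def diff_divide_distrib)
    qed
  qed
  have "\<forall>p. \<exists>\<Gamma> q q'. p \<in> P \<longrightarrow> smooth_growth \<Gamma> \<and> (\<forall>x. (\<Gamma> has_real_derivative q x) (at x)) \<and>
      (\<forall>x. (q has_real_derivative q' x) (at x)) \<and>
      (\<forall>x. 2 * x * q x = inverse_profile (c p) x) \<and>
      (\<forall>x. 2 * x * q' x + 2 * (1 - x) * q x = - centered_profile (c p) x)"
    using profile_potential[OF c0] by blast
  then obtain \<Gamma> q q' where pot: "\<And>p. p \<in> P \<Longrightarrow> smooth_growth (\<Gamma> p)"
    "\<And>p x. p \<in> P \<Longrightarrow> (\<Gamma> p has_real_derivative q p x) (at x)"
    "\<And>p x. p \<in> P \<Longrightarrow> (q p has_real_derivative q' p x) (at x)"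
    "\<And>p x. p \<in> P \<Longrightarrow> 2 * x * q p x = inverse_profile (c p) x"
    "\<And>p x. p \<in> P \<Longrightarrow> 2 * x * q' p x + 2 * (1 - x) * q p x = - centered_profile (c p) x"
    by metis
  define \<Theta> where "\<Theta> x = (\<Sum>p\<in>P. s p * \<Gamma> p x)" for x
  define Q where "Q x = (\<Sum>p\<in>P. s p * q p x)" for x
  define Q' where "Q' x = (\<Sum>p\<in>P. s p * q' p x)" for x
  have s\<Theta>: "smooth_growth \<Theta>" unfolding \<Theta>_def[abs_def]
    by (rule smooth_growth_sum, rule smooth_growth_cmult, rule pot(1))
  have d\<Theta>: "(\<Theta> has_real_derivative Q x) (at x)" for x
    unfolding \<Theta>_def[abs_def] Q_def by (intro DERIV_sum DERIV_cmult pot(2))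
  have dQ: "(Q has_real_derivative Q' x) (at x)" for x
    unfolding Q_def[abs_def] Q'_def by (intro DERIV_sum DERIV_cmult pot(3))
  have xQ: "2 * x * Q x = (\<Sum>p\<in>P. s p * inverse_profile (c p) x)" for x
    unfolding Q_def sum_distrib_left using pot(4) by (intro sum.cong) (auto simp: mult.left_commute)
  have LQ: "2 * x * Q' x + 2 * (1 - x) * Q x = - \<eta> x" for x
  proof -
    have "2 * x * Q' x + 2 * (1 - x) * Q x = (\<Sum>p\<in>P. s p * (2 * x * q' p x + 2 * (1 - x) * q p x))"
      unfolding Q_def Q'_def sum_distrib_left sum.distrib[symmetric]
      by (intro sum.cong) (auto simp: algebra_simps)
    also have "\<dots> = - \<eta> x"
      unfolding \<eta>_def sum_negf[symmetric] using pot(5) by (intro sum.cong) auto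
    finally show ?thesis .
  qed
  \<comment> \<open>The pseudo-inverse is normalised to mean zero; subtracting the mean changes
    neither the derivative nor the generator.\<close>
  define e where "e = expectation (\<lambda>w. \<Theta> (?a w))"
  define \<Psi> where "\<Psi> x = \<Theta> x - e" for x
  have s\<Psi>: "smooth_growth \<Psi>" unfolding \<Psi>_def[abs_def] by (intro smooth_growth_diff s\<Theta> smooth_growth_const)
  have d\<Psi>: "(\<Psi> has_real_derivative Q x) (at x)" for x
    unfolding \<Psi>_def[abs_def] using DERIV_diff[OF d\<Theta> DERIV_const] by simp
  have s\<eta>: "smooth_growth \<eta>" unfolding \<eta>_def[abs_def]
    by (rule smooth_growth_sum, rule smooth_growth_cmult, rule smooth_growth_centered_profile)
  define \<eta>' where "\<eta>' x = (\<Sum>p\<in>P. s p * (- c p * exp (- x) * cos (c p * exp (- x))))" for x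
  have d\<eta>: "(\<eta> has_real_derivative \<eta>' x) (at x)" for x
    unfolding \<eta>_def[abs_def] \<eta>'_def centered_profile_def
    by (intro DERIV_sum DERIV_cmult) (auto intro!: derivative_eq_intros)
  let ?V = "\<lambda>w. W f w *\<^sub>R f + W g w *\<^sub>R g"
  define G0 where "G0 w = \<Psi> (?a w)" for w
  define DY0 where "DY0 w = \<eta>' (?a w) *\<^sub>R ?V w" for w
  define DG0 where "DG0 w = Q (?a w) *\<^sub>R ?V w" for w
  have mY: "has_malliavin_derivative M W Y DY0"
    unfolding Y DY0_def[abs_def] by (rule radial_malliavin_derivative[OF s\<eta> d\<eta>])
  have mG: "has_malliavin_derivative M W G0 DG0"
    unfolding G0_def[abs_def] DG0_def[abs_def] by (rule radial_malliavin_derivative[OF s\<Psi> d\<Psi>])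
  have inv: "has_OU_pseudo_inverse M W Y G0"
  proof -
    have gen: "has_OU_generator M W G0 (\<lambda>w. - Y w)"
      using radial_generator[OF fg s\<Psi> d\<Psi> dQ] unfolding G0_def[abs_def] LQ Y .
    have "square_integrable M Y" using mY by (simp add: has_malliavin_derivative_def)
    moreover have "(\<integral>w. Y w \<partial>M) = 0" using OU_generator_mean[OF gen] by simp
    moreover have "(\<integral>w. G0 w \<partial>M) = 0"
      using has_moments_integrable[OF smooth_growth_has_moments[OF s\<Theta> half_square_has_moments half_square_nonneg]]
      unfolding G0_def \<Psi>_def e_def by (simp add: prob_space)
    ultimately show ?thesis
      unfolding has_OU_pseudo_inverse_def using gen by (auto intro!: exI[of _ "\<lambda>w. - Y w"])
  qed
  have val: "inner (DY0 w) (DG0 w) =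
      (\<Sum>p1\<in>P. \<Sum>p2\<in>P. ?S w p1 p2)" for w
  proof -
    \<comment> \<open>By orthonormality this is precisely the factor in \<open>xQ\<close>, so the
      quotient behind \<open>Q\<close> disappears and only \<open>inverse_profile\<close> is
      left.\<close>
    have "inner (?V w) (?V w) = 2 * ?a w"
      using fg by (simp add: inner_simps half_square_def power2_eq_square inner_commute[of g f]
          norm_eq_1)
    then have "inner (DY0 w) (DG0 w) = \<eta>' (?a w) * (2 * ?a w * Q (?a w))"
      unfolding DY0_def DG0_def by simp
    \<comment> \<open>The factors are swapped so that \<open>p1\<close> belongs to the
      pseudo-inverse, which divides by \<open>c p1\<close>, and \<open>p2\<close> to the derivative
      of \<open>Y\<close>, which multiplies by \<open>c p2\<close>; hence the orientation of the
      quotient of logarithms.\<close>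
    also have "\<dots> = (\<Sum>p1\<in>P. \<Sum>p2\<in>P. (s p1 * inverse_profile (c p1) (?a w)) *
        (s p2 * (- c p2 * exp (- ?a w) * cos (c p2 * exp (- ?a w)))))"
      unfolding xQ \<eta>'_def by (subst mult.commute) (rule sum_product)
    also have "\<dots> = (\<Sum>p1\<in>P. \<Sum>p2\<in>P. ?S w p1 p2)"
    proof (intro sum.cong refl)
      fix p1 p2 assume p: "p1 \<in> P" "p2 \<in> P"
      define u C1 C2 K where "u = exp (- ?a w)" and "C1 = cos (c p1 * u)" and "C2 = cos (c p2 * u)"
        and "K = cos (c p1)"
      have u: "exp (?a w) = 1 / u" "u > 0" by (simp_all add: u_def exp_minus field_simps)
      have ss: "s p1 * s p2 = 1 / sqrt (real p1 * real p2)" by (simp add: s_def real_sqrt_mult)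
      have cc: "c p2 / c p1 = ln (real p2) / ln (real p1)" using \<open>T > 0\<close> by (simp add: c_def)
      have "(s p1 * inverse_profile (c p1) (?a w)) * (s p2 * (- c p2 * exp (- ?a w) * cos (c p2 * exp (- ?a w))))
        = (c p2 / c p1) * (s p1 * s p2) * (- (u * (1 / u * (1 - C1) - (1 - K)) * C2))"
        unfolding inverse_profile_def u u_def[symmetric] C1_def[symmetric] C2_def[symmetric] K_def[symmetric]
        by simp
      \<comment> \<open>The factor \<open>1 / u\<close> is the \<open>exp x\<close> of
        \<open>inverse_profile\<close> and cancels the \<open>u\<close> produced by differentiating
        \<open>exp (- x)\<close>.\<close>
      also have "- (u * (1 / u * (1 - C1) - (1 - K)) * C2) = (u - 1) * C2 - u * C2 * K + C1 * C2"
        using u(2) by (simp add: field_simps)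
      finally show "(s p1 * inverse_profile (c p1) (?a w)) * (s p2 * (- c p2 * exp (- ?a w) * cos (c p2 * exp (- ?a w))))
        = ?S w p1 p2"
        unfolding ss cc by (simp only: C1_def C2_def K_def U u_def[symmetric] c_def ac_simps)
    qed
    finally show ?thesis .
  qed
  show ?thesis
  proof (intro conjI allI impI)
    show "\<exists>DY G DG. has_malliavin_derivative M W Y DY \<and> has_OU_pseudo_inverse M W Y G \<and>
        has_malliavin_derivative M W G DG"
      using mY mG inv by blast
    fix DY G DG
    assume D: "has_malliavin_derivative M W Y DY" and G: "has_OU_pseudo_inverse M W Y G"
      and DG: "has_malliavin_derivative M W G DG"
    have "AE w in M. DY w = DY0 w" by (rule malliavin_derivative_unique[OF D mY]) simp
    moreover have "AE w in M. DG w = DG0 w"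
      by (rule malliavin_derivative_unique[OF DG mG OU_pseudo_inverse_unique[OF G inv]])
    ultimately show "AE w in M. inner (DY w) (DG w) = (\<Sum>p1\<in>P. \<Sum>p2\<in>P. ?S w p1 p2)"
      by eventually_elim (simp only: val)
  qed
qed

end
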